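(* Let $\mathcal{G}$ be a non-compact connected metric graph, not isometric to $\mathbb{R}^+=[0,+\infty)$, having a finite number of vertices and edges. If $\mathcal{E}_{\mathcal{G}}(\mu_{\mathcal{G}})$ is achieved, then there exists an open half-line $\ell\subset\mathcal{G}$ such that $\mu_{\mathcal{G}\setminus\ell}<\mu_{\mathcal{G}}$.
   Context: Metric graphs: each edge $e$ is identified either with a closed bounded interval $[0,|e|]$ (bounded edge) or with a copy of $[0,+\infty)$ (half-line, whose end at $+\infty$ is a vertex at infinity; distinct half-lines have distinct vertices at infinity). Loops and multiple edges are allowed. A graph is non-compact if it has at least one half-line. Without loss of generality every vertex is assumed to have degree different from $2$ (possible unless $\mathcal{G}$ is isometric to $\mathbb{R}$, which is seen as two half-lines glued at a vertex of degree $2$). An open half-line $\ell\subset\mathcal{G}$ is an unbounded edge of the underlying combinatorial graph, and $\mathcal{G}\setminus\ell$ is the graph obtained from $\mathcal{G}$ by removing the edge $\ell$ and the corresponding vertex at infinity (the finite vertex at which $\ell$ starts is kept). $H^1(\mathcal{G})$ is the space of continuous (real-valued) functions $u$ on $\mathcal{G}$ with $u|_e\in H^1(e)$ for every edge $e$; for $\mu>0$, $H^1_\mu(\mathcal{G})=\{u\in H^1(\mathcal{G}):\int_{\mathcal{G}}|u|^2=\mu\}$. The energy is $E(u,\mathcal{G})=\frac12\int_{\mathcal{G}}|u'|^2-\frac16\int_{\mathcal{G}}|u|^6$, and the ground state level is $\mathcal{E}_{\mathcal{G}}(\mu)=\inf_{u\in H^1_\mu(\mathcal{G})}E(u,\mathcal{G})$;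 it is achieved if there is $u\in H^1_\mu(\mathcal{G})$ with $E(u,\mathcal{G})=\mathcal{E}_{\mathcal{G}}(\mu)$. Critical mass: for a non-compact metric graph $\mathcal{G}$, $\mu_{\mathcal{G}}>0$ is defined by $\frac{3}{\mu_{\mathcal{G}}^2}=\sup_{0\ne u\in H^1(\mathcal{G})}\frac{\|u\|_{L^6}^6}{\|u\|_{L^2}^4\|u'\|_{L^2}^2}$ (the optimal constant in the Gagliardo–Nirenberg inequality $\|u\|_{L^6(\mathcal{G})}^6\le\frac{3}{\mu_{\mathcal{G}}^2}\|u\|_{L^2(\mathcal{G})}^4\|u'\|_{L^2(\mathcal{G})}^2$). The critical mass is only considered for non-compact graphs, so the conclusion includes that $\mathcal{G}\setminus\ell$ is non-compact. *)

theory Defs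
  imports "HOL-Analysis.Analysis" "Graph_Theory.Digraph_Component"
begin

text \<open>
  The underlying combinatorial graph is a (multi)digraph \<open>G\<close> with loops and multiple arcs allowed; the
  orientation of an arc only says which end has coordinate \<open>0\<close>. The function \<open>L\<close> gives the length of
  each edge, with \<open>L e = \<infinity>\<close> for half-lines. The tail of a half-line is its finite vertex and its head
  is its vertex at infinity, which is an element of \<open>verts G\<close> but not a point of the metric space.
\<close>

locale metric_graph = fin_digraph G
  for G :: "('v, 'e) pre_digraph" and L :: "'e \<Rightarrow> ereal" +
  assumes length_pos: "e \<in> arcs G \<Longrightarrow> 0 < L e"
    and infinity_not_tail: "\<lbrakk>e \<in> arcs G; L e = \<infinity>; e' \<in> arcs G\<rbrakk> \<Longrightarrow> tail G e' \<noteq> head G e"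
    and infinity_head_unique:
      "\<lbrakk>e \<in> arcs G; L e = \<infinity>; e' \<in> arcs G; head G e' = head G e\<rbrakk> \<Longrightarrow> e' = e"

definition half_lines :: "('v, 'e) pre_digraph \<Rightarrow> ('e \<Rightarrow> ereal) \<Rightarrow> 'e set" where
  "half_lines G L = {e \<in> arcs G. L e = \<infinity>}"

definition noncompact :: "('v, 'e) pre_digraph \<Rightarrow> ('e \<Rightarrow> ereal) \<Rightarrow> bool" where
  "noncompact G L \<longleftrightarrow> half_lines G L \<noteq> {}"

definition remove_half_line :: "('v, 'e) pre_digraph \<Rightarrow> 'e \<Rightarrow> ('v, 'e) pre_digraph" where
  "remove_half_line G l = pre_digraph.del_vert (pre_digraph.del_arc G l) (head G l)"

text \<open>A loop contributes twice to the degree of its vertex.\<close>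

definition degree :: "('v, 'e) pre_digraph \<Rightarrow> 'v \<Rightarrow> nat" where
  "degree G v = in_degree G v + out_degree G v"

text \<open>
  The convention on the presentation of a metric graph: no vertex has degree \<open>2\<close>, except that the
  real line is presented as two half-lines glued at a vertex of degree \<open>2\<close>.
\<close>

definition no_degree_two :: "('v, 'e) pre_digraph \<Rightarrow> ('e \<Rightarrow> ereal) \<Rightarrow> bool" where
  "no_degree_two G L \<longleftrightarrow>
     (\<forall>v \<in> verts G. degree G v \<noteq> 2) \<or>
     (\<exists>e\<^sub>1 e\<^sub>2. e\<^sub>1 \<noteq> e\<^sub>2 \<and> arcs G = {e\<^sub>1, e\<^sub>2} \<and> L e\<^sub>1 = \<infinity> \<and> L e\<^sub>2 = \<infinity> \<and> tail G e\<^sub>1 = tail G e\<^sub>2)"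


section \<open>The metric space\<close>

datatype ('v, 'e) graph_point = Vertex 'v | Inner 'e real

definition edge_interval :: "('e \<Rightarrow> ereal) \<Rightarrow> 'e \<Rightarrow> real set" where
  "edge_interval L e = {x. 0 \<le> x \<and> ereal x \<le> L e}"

definition edge_interior :: "('e \<Rightarrow> ereal) \<Rightarrow> 'e \<Rightarrow> real set" where
  "edge_interior L e = {x. 0 < x \<and> ereal x < L e}"

text \<open>The point of the graph with coordinate \<open>x \<in> edge_interval L e\<close> on the edge \<open>e\<close>.\<close>

definition edge_point ::
  "('v, 'e) pre_digraph \<Rightarrow> ('e \<Rightarrow> ereal) \<Rightarrow> 'e \<Rightarrow> real \<Rightarrow> ('v, 'e) graph_point" where
  "edge_point G L e x =
     (if x = 0 then Vertex (tail G e)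
      else if ereal x = L e then Vertex (head G e)
      else Inner e x)"

definition graph_points ::
  "('v, 'e) pre_digraph \<Rightarrow> ('e \<Rightarrow> ereal) \<Rightarrow> ('v, 'e) graph_point set" where
  "graph_points G L =
     Vertex ` (verts G - head G ` half_lines G L) \<union>
     {Inner e x | e x. e \<in> arcs G \<and> x \<in> edge_interior L e}"

text \<open>
  \<open>graph_chain G L p q r\<close>: the points \<open>p\<close> and \<open>q\<close> are joined by a finite chain of segments, each
  lying in a single edge, of total length \<open>r\<close>. The infimum of these lengths is the shortest path
  distance (it is meaningful on connected graphs).
\<close>

inductive graph_chain :: "('v, 'e) pre_digraph \<Rightarrow> ('e \<Rightarrow> ereal) \<Rightarrow>
    ('v, 'e) graph_point \<Rightarrow> ('v, 'e) graph_point \<Rightarrow> real \<Rightarrow> bool"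
  for G :: "('v, 'e) pre_digraph" and L :: "'e \<Rightarrow> ereal" where
  refl: "p \<in> graph_points G L \<Longrightarrow> graph_chain G L p p 0"
| step: "\<lbrakk>graph_chain G L p (edge_point G L e s) r; e \<in> arcs G;
          s \<in> edge_interval L e; t \<in> edge_interval L e\<rbrakk>
         \<Longrightarrow> graph_chain G L p (edge_point G L e t) (r + \<bar>s - t\<bar>)"

definition graph_dist :: "('v, 'e) pre_digraph \<Rightarrow> ('e \<Rightarrow> ereal) \<Rightarrow>
    ('v, 'e) graph_point \<Rightarrow> ('v, 'e) graph_point \<Rightarrow> real" where
  "graph_dist G L p q = Inf {r. graph_chain G L p q r}"

definition isometric_to_ray :: "('v, 'e) pre_digraph \<Rightarrow> ('e \<Rightarrow> ereal) \<Rightarrow> bool" where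
  "isometric_to_ray G L \<longleftrightarrow>
     (\<exists>f. bij_betw f {0::real..} (graph_points G L) \<and>
          (\<forall>s\<ge>0. \<forall>t\<ge>0. graph_dist G L (f s) (f t) = \<bar>s - t\<bar>))"


section \<open>Sobolev spaces\<close>

definition L2_on :: "real set \<Rightarrow> (real \<Rightarrow> real) \<Rightarrow> bool" where
  "L2_on I f \<longleftrightarrow> set_borel_measurable lborel I f \<and> set_integrable lborel I (\<lambda>x. (f x)\<^sup>2)"

text \<open>Weak derivatives on an open interval \<open>I\<close>, tested against compactly supported functions in \<open>C\<^sup>1\<close>.\<close>

definition has_weak_deriv_on :: "(real \<Rightarrow> real) \<Rightarrow> (real \<Rightarrow> real) \<Rightarrow> real set \<Rightarrow> bool" where
  "has_weak_deriv_on f g I \<longleftrightarrow>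
     (\<forall>\<phi> K. \<phi> C1_differentiable_on UNIV \<and> compact K \<and> K \<subseteq> I \<and> (\<forall>x. x \<notin> K \<longrightarrow> \<phi> x = 0) \<longrightarrow>
        (LINT x:I|lborel. f x * deriv \<phi> x) = - (LINT x:I|lborel. g x * \<phi> x))"

definition H1_on :: "real set \<Rightarrow> (real \<Rightarrow> real) \<Rightarrow> bool" where
  "H1_on I f \<longleftrightarrow> L2_on I f \<and> (\<exists>g. L2_on I g \<and> has_weak_deriv_on f g I)"

text \<open>The weak derivative is unique up to null sets, so integrals do not depend on the choice.\<close>

definition weak_deriv :: "real set \<Rightarrow> (real \<Rightarrow> real) \<Rightarrow> real \<Rightarrow> real" where
  "weak_deriv I f = (SOME g. L2_on I g \<and> has_weak_deriv_on f g I)"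

text \<open>
  Functions on the graph are functions on all of the type \<open>graph_point\<close>, of which only the values
  on \<open>graph_points G L\<close> matter. The graph carries the quotient topology of the disjoint union of the
  edges, so continuity means continuity of all restrictions to closed edges; that these agree at
  common vertices is built into \<open>edge_point\<close>.
\<close>

definition edge_restrict :: "('v, 'e) pre_digraph \<Rightarrow> ('e \<Rightarrow> ereal) \<Rightarrow>
    (('v, 'e) graph_point \<Rightarrow> real) \<Rightarrow> 'e \<Rightarrow> real \<Rightarrow> real" where
  "edge_restrict G L u e x = u (edge_point G L e x)"

definition H1_graph :: "('v, 'e) pre_digraph \<Rightarrow> ('e \<Rightarrow> ereal) \<Rightarrow>
    (('v, 'e) graph_point \<Rightarrow> real) set" where
  "H1_graph G L = {u. \<forall>e \<in> arcs G.
     continuous_on (edge_interval L e) (edge_restrict G L u e) \<and>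
     H1_on (edge_interior L e) (edge_restrict G L u e)}"

text \<open>\<open>graph_power_int G L p u\<close> is \<open>\<integral>|u|\<^sup>p\<close>, that is, the \<open>p\<close>-th power of the \<open>L\<^sup>p\<close> norm of \<open>u\<close>.\<close>

definition graph_power_int :: "('v, 'e) pre_digraph \<Rightarrow> ('e \<Rightarrow> ereal) \<Rightarrow> nat \<Rightarrow>
    (('v, 'e) graph_point \<Rightarrow> real) \<Rightarrow> real" where
  "graph_power_int G L p u =
     (\<Sum>e \<in> arcs G. LINT x:edge_interior L e|lborel. \<bar>edge_restrict G L u e x\<bar> ^ p)"

definition graph_deriv_sq_int :: "('v, 'e) pre_digraph \<Rightarrow> ('e \<Rightarrow> ereal) \<Rightarrow>
    (('v, 'e) graph_point \<Rightarrow> real) \<Rightarrow> real" where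
  "graph_deriv_sq_int G L u =
     (\<Sum>e \<in> arcs G. LINT x:edge_interior L e|lborel.
        \<bar>weak_deriv (edge_interior L e) (edge_restrict G L u e) x\<bar>\<^sup>2)"


section \<open>Energy, ground states and critical mass\<close>

definition H1_mass :: "('v, 'e) pre_digraph \<Rightarrow> ('e \<Rightarrow> ereal) \<Rightarrow> real \<Rightarrow>
    (('v, 'e) graph_point \<Rightarrow> real) set" where
  "H1_mass G L \<mu> = {u \<in> H1_graph G L. graph_power_int G L 2 u = \<mu>}"

definition energy :: "('v, 'e) pre_digraph \<Rightarrow> ('e \<Rightarrow> ereal) \<Rightarrow>
    (('v, 'e) graph_point \<Rightarrow> real) \<Rightarrow> real" where
  "energy G L u = 1/2 * graph_deriv_sq_int G L u - 1/6 * graph_power_int G L 6 u"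

definition ground_level :: "('v, 'e) pre_digraph \<Rightarrow> ('e \<Rightarrow> ereal) \<Rightarrow> real \<Rightarrow> ereal" where
  "ground_level G L \<mu> = (INF u \<in> H1_mass G L \<mu>. ereal (energy G L u))"

definition ground_level_achieved :: "('v, 'e) pre_digraph \<Rightarrow> ('e \<Rightarrow> ereal) \<Rightarrow> real \<Rightarrow> bool" where
  "ground_level_achieved G L \<mu> \<longleftrightarrow>
     (\<exists>u \<in> H1_mass G L \<mu>. ereal (energy G L u) = ground_level G L \<mu>)"

definition nonzero_on_graph :: "('v, 'e) pre_digraph \<Rightarrow> ('e \<Rightarrow> ereal) \<Rightarrow>
    (('v, 'e) graph_point \<Rightarrow> real) \<Rightarrow> bool" where
  "nonzero_on_graph G L u \<longleftrightarrow> (\<exists>p \<in> graph_points G L. u p \<noteq> 0)"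

text \<open>
  On a connected non-compact graph neither factor of the denominator vanishes for \<open>u \<noteq> 0\<close>, and the
  supremum is finite and positive, so that the critical mass is well defined there.
\<close>

definition GN_quotient :: "('v, 'e) pre_digraph \<Rightarrow> ('e \<Rightarrow> ereal) \<Rightarrow>
    (('v, 'e) graph_point \<Rightarrow> real) \<Rightarrow> real" where
  "GN_quotient G L u =
     graph_power_int G L 6 u / ((graph_power_int G L 2 u)\<^sup>2 * graph_deriv_sq_int G L u)"

definition critical_mass :: "('v, 'e) pre_digraph \<Rightarrow> ('e \<Rightarrow> ereal) \<Rightarrow> real" where
  "critical_mass G L = (THE \<mu>. 0 < \<mu> \<and>
     ereal (3 / \<mu>\<^sup>2) =
       (SUP u \<in> {u \<in> H1_graph G L. nonzero_on_graph G L u}. ereal (GN_quotient G L u)))"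

end

theory Submission
  imports Defs
begin

text \<open>
  For \<open>h = max \<bar>u\<bar>\<close> the density \<open>u'\<^sup>2 / 2 + u\<^sup>2 (h\<^sup>4 - u\<^sup>4) / 6\<close> dominates \<open>\<bar>\<Psi>(u)'\<bar>\<close>, where
  \<open>\<Psi>' t = t \<surd>((h\<^sup>4 - t\<^sup>4) / 3)\<close>. Integrated along a path from a maximum point of \<open>\<bar>u\<bar>\<close> to
  infinity this gives \<open>h\<^sup>4 (m - mass u) / 6 \<le> energy u\<close>, with \<open>m = \<surd>3 \<pi> / 4\<close> the critical mass of the
  half-line. Let \<open>\<mu>\<close> be the critical mass of \<open>G\<close>; a ground state at mass \<open>\<mu>\<close> has energy \<open>0\<close>, its
  modulus \<open>u\<close> is again one, and \<open>u > 0\<close> everywhere.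

  If \<open>G\<close> has at least two half-lines and \<open>u\<close> has nonnegative energy on one of them, \<open>l\<close>, then \<open>u\<close>
  restricted to \<open>G \<setminus> l\<close> has nonpositive energy and mass less than \<open>\<mu>\<close>, which is the claim. If \<open>u\<close>
  has negative energy on every half-line, the inequality above gives each of them mass greater than
  \<open>m\<close>, so \<open>\<mu> > 2 m\<close>; but solitons pushed to infinity along a half-line give \<open>\<mu> \<le> 2 m\<close>.

  If \<open>G\<close> has a single half-line, spreading half-solitons over it gives \<open>\<mu> \<le> m\<close>. As \<open>G\<close> is not a
  half-line, some path from a maximum point to infinity omits an interval, on which the density must
  then vanish, so that \<open>u = h\<close> there. This contradicts the Euler-Lagrange equation.
\<close>

section \<open>Indefinite integrals\<close>

text \<open>The Gagliardo-Nirenberg inequality with constant 3 / \<open>\<mu>\<close>^2 says exactly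
  that the energy is nonnegative at mass \<open>\<mu>\<close>, and spreading functions out makes it
  tend to 0; so a ground state at the critical mass is an optimizer (pot = 3 kin) and has a first
  variation. Conversely, 3 kin <= pot at a mass below \<open>\<mu>\<close> makes the inequality for
  \<open>\<mu>\<close> fail strictly as soon as pot > 0. Removing a half-line strictly gains only if
  it carries mass and the rest carries potential, hence the need for u > 0; a logarithmic energy
  estimate gives it without regularity of u. The domination by the density is 2|ab| <= a^2 + b^2,
  with equality along solitons. With one half-line and the maximum at a vertex, the omitted interval
  comes from the degree convention: the vertex of the half-line has two further edge ends, and a
  shortest path uses at most one. Weak derivatives are given by a choice operator, so the calculus
  runs on arbitrary representatives, characterized as integrands of indefinite integrals. Half-open
  intervals make these additive; testing compact subintervals of \<open>I\<close> keeps the notion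
  local.\<close>

definition ac_deriv :: "real set \<Rightarrow> (real \<Rightarrow> real) \<Rightarrow> (real \<Rightarrow> real) \<Rightarrow> bool" where
  "ac_deriv I f g \<longleftrightarrow>
     (\<forall>x y. x \<le> y \<and> {x..y} \<subseteq> I \<longrightarrow>
        set_integrable lborel {x<..y} g \<and> (LBINT t:{x<..y}. g t) = f y - f x)"

lemma set_integral_Ioc_split:
  fixes g :: "real \<Rightarrow> real"
  assumes "x \<le> y" "y \<le> z" "set_integrable lborel {x<..z} g"
  shows "(LBINT t:{x<..z}. g t) = (LBINT t:{x<..y}. g t) + (LBINT t:{y<..z}. g t)"
proof -
  have "{x<..z} = {x<..y} \<union> {y<..z}" using assms by auto
  moreover have "set_integrable lborel {x<..y} g" "set_integrable lborel {y<..z} g"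
    using assms by (auto intro: set_integrable_subset)
  ultimately show ?thesis by (simp add: set_integral_Un)
qed

lemma set_borel_measurable_mult:
  fixes f g :: "real \<Rightarrow> real"
  assumes "set_borel_measurable M A f" "set_borel_measurable M A g"
  shows "set_borel_measurable M A (\<lambda>x. f x * g x)"
proof -
  have "(\<lambda>x. indicator A x *\<^sub>R (f x * g x)) = (\<lambda>x. (indicator A x *\<^sub>R f x) * (indicator A x *\<^sub>R g x))"
    by (auto simp: indicator_def)
  then show ?thesis using assms unfolding set_borel_measurable_def by simp
qed

lemma set_integrable_imp_measurable:
  fixes f :: "'a \<Rightarrow> real"
  shows "set_integrable M A f \<Longrightarrow> set_borel_measurable M A f"
  unfolding set_integrable_def set_borel_measurable_def by auto

lemma set_integrable_mult_bounded:
  fixes h g :: "real \<Rightarrow> real"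
  assumes g: "set_integrable M A g" and h: "set_borel_measurable M A h"
    and K: "\<And>t. t \<in> A \<Longrightarrow> \<bar>h t\<bar> \<le> K"
  shows "set_integrable M A (\<lambda>t. h t * g t)"
proof (rule set_integrable_bound)
  show "set_integrable M A (\<lambda>t. K * g t)" using g by simp
  show "set_borel_measurable M A (\<lambda>t. h t * g t)"
    using set_borel_measurable_mult[OF h set_integrable_imp_measurable[OF g]] .
  show "AE x in M. x \<in> A \<longrightarrow> norm (h x * g x) \<le> norm (K * g x)"
  proof (rule AE_I2, rule impI)
    fix x assume "x \<in> A"
    then have "\<bar>h x\<bar> \<le> \<bar>K\<bar>" using K[of x] by linarith
    then show "norm (h x * g x) \<le> norm (K * g x)"
      by (simp add: abs_mult mult_right_mono)
  qed
qed

lemma set_borel_measurable_continuous_on: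
  fixes h :: "real \<Rightarrow> real"
  assumes "continuous_on S h" "S \<in> sets borel" "A \<in> sets borel" "A \<subseteq> S"
  shows "set_borel_measurable lborel A h"
proof -
  have "continuous_on A h" using assms continuous_on_subset by blast
  then have "(\<lambda>x. indicator A x *\<^sub>R h x) \<in> borel_measurable borel"
    using borel_measurable_continuous_on_indicator[OF assms(3)] by blast
  then show ?thesis unfolding set_borel_measurable_def by simp
qed

lemma set_integrable_mult_continuous:
  fixes h g :: "real \<Rightarrow> real"
  assumes g: "set_integrable lborel {x<..y} g" and h: "continuous_on {x..y} h"
  shows "set_integrable lborel {x<..y} (\<lambda>t. h t * g t)"
proof -
  have "bounded (h ` {x..y})"
    using h compact_continuous_image compact_imp_bounded by blast
  then obtain K where "\<And>t. t \<in> {x..y} \<Longrightarrow> \<bar>h t\<bar> \<le> K"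
    unfolding bounded_iff by (metis image_eqI real_norm_def)
  then have "\<bar>h t\<bar> \<le> K" if "t \<in> {x<..y}" for t using that by auto
  moreover have "set_borel_measurable lborel {x<..y} h"
    using h by (rule set_borel_measurable_continuous_on) auto
  ultimately show ?thesis using set_integrable_mult_bounded[OF g] by blast
qed

lemma set_integrable_continuous_Ioc:
  fixes h :: "real \<Rightarrow> real"
  assumes "continuous_on {x..y} h"
  shows "set_integrable lborel {x<..y} h"
  using borel_integrable_atLeastAtMost'[OF assms] by (rule set_integrable_subset) auto

lemma set_integral_Ioc_eq_Icc:
  fixes g :: "real \<Rightarrow> real"
  shows "(LBINT t:{x<..y}. g t) = (LBINT t:{x..y}. g t)"
    and "set_integrable lborel {x<..y} g = set_integrable lborel {x..y} g"
proof -
  show "(LBINT t:{x<..y}. g t) = (LBINT t:{x..y}. g t)"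
    by (rule set_integral_discrete_difference[where X="{x}"]) auto
  show "set_integrable lborel {x<..y} g = set_integrable lborel {x..y} g"
    by (rule set_integrable_discrete_difference[where X="{x}"]) auto
qed

lemma ac_derivD:
  assumes "ac_deriv I f g" "x \<le> y" "{x..y} \<subseteq> I"
  shows "set_integrable lborel {x<..y} g" "(LBINT t:{x<..y}. g t) = f y - f x"
  using assms unfolding ac_deriv_def by auto

lemma ac_deriv_subset: "ac_deriv I f g \<Longrightarrow> J \<subseteq> I \<Longrightarrow> ac_deriv J f g"
  unfolding ac_deriv_def by blast

lemma ac_deriv_cong:
  assumes "ac_deriv I f g" "\<And>x. x \<in> I \<Longrightarrow> f x = f' x" "\<And>x. x \<in> I \<Longrightarrow> g x = g' x"
  shows "ac_deriv I f' g'"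
  unfolding ac_deriv_def
proof (intro allI impI)
  fix x y :: real assume xy: "x \<le> y \<and> {x..y} \<subseteq> I"
  have 1: "set_integrable lborel {x<..y} g = set_integrable lborel {x<..y} g'"
    using xy assms(3) by (intro set_integrable_cong) (auto simp: subset_iff)
  have 2: "(LBINT t:{x<..y}. g t) = (LBINT t:{x<..y}. g' t)"
    using xy assms(3) by (intro set_lebesgue_integral_cong) (auto simp: subset_iff)
  have "f x = f' x" "f y = f' y" using xy assms(2) by auto
  with 1 2 ac_derivD[OF assms(1)] xy
  show "set_integrable lborel {x<..y} g' \<and> (LBINT t:{x<..y}. g' t) = f' y - f' x"
    by auto
qed

lemma ac_deriv_continuous:
  assumes ac: "ac_deriv I f g" and I: "open I"
  shows "continuous_on I f"
proof -
  have "isCont f z" if zI: "z \<in> I" for z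
  proof -
    obtain e where e: "e > 0" "cball z e \<subseteq> I" using I zI unfolding open_contains_cball by auto
    define a b where "a = z - e" and "b = z + e"
    have ab: "{a..b} \<subseteq> I" "a \<le> b" "a < z" "z < b"
      using e by (auto simp: a_def b_def cball_eq_atLeastAtMost)
    have int: "set_integrable lborel {a..b} g"
      using ac_derivD(1)[OF ac ab(2,1)] set_integral_Ioc_eq_Icc(2) by blast
    then have "g integrable_on {a..b}" by (rule set_borel_integral_eq_integral)
    then have "continuous_on {a..b} (\<lambda>x. integral {a..x} g)"
      by (rule indefinite_integral_continuous_1)
    then have "continuous_on {a..b} (\<lambda>x. f a + integral {a..x} g)"
      by (intro continuous_intros)
    moreover have "f a + integral {a..x} g = f x" if "x \<in> {a..b}" for x
    proof -
      have "{a..x} \<subseteq> I" "a \<le> x" using that ab by auto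
      then have "f x - f a = (LBINT t:{a..x}. g t)"
        using ac_derivD(2)[OF ac] set_integral_Ioc_eq_Icc(1) by metis
      also have "\<dots> = integral {a..x} g"
        by (rule set_borel_integral_eq_integral(2))
           (rule set_integrable_subset[OF int], use that in auto)
      finally show ?thesis by simp
    qed
    ultimately have "continuous_on {a..b} f"
      by (rule continuous_on_eq)
    then show ?thesis using ab continuous_on_interior[of "{a..b}" f z] by auto
  qed
  then show ?thesis by (simp add: continuous_at_imp_continuous_on)
qed

lemma ac_deriv_add:
  assumes "ac_deriv I f g" "ac_deriv I f' g'"
  shows "ac_deriv I (\<lambda>x. f x + f' x) (\<lambda>x. g x + g' x)"
  unfolding ac_deriv_def
  using ac_derivD[OF assms(1)] ac_derivD[OF assms(2)] by (auto simp: set_integral_add)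

lemma ac_deriv_cmult:
  assumes "ac_deriv I f g"
  shows "ac_deriv I (\<lambda>x. c * f x) (\<lambda>x. c * g x)"
  unfolding ac_deriv_def
  using ac_derivD[OF assms] by (auto simp: right_diff_distrib)

lemma ac_deriv_diff:
  assumes "ac_deriv I f g" "ac_deriv I f' g'"
  shows "ac_deriv I (\<lambda>x. f x - f' x) (\<lambda>x. g x - g' x)"
  using ac_deriv_add[OF assms(1) ac_deriv_cmult[OF assms(2), of "-1"]] by simp

lemma ac_deriv_C1:
  assumes d: "\<And>x. x \<in> I \<Longrightarrow> (f has_real_derivative g x) (at x)" and c: "continuous_on I g"
  shows "ac_deriv I f g"
  unfolding ac_deriv_def
proof (intro allI impI)
  fix x y :: real assume xy: "x \<le> y \<and> {x..y} \<subseteq> I"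
  then have c': "continuous_on {x..y} g" using c continuous_on_subset by blast
  have "(LBINT t:{x..y}. g t) = f y - f x"
    unfolding set_lebesgue_integral_def
  proof (rule integral_FTC_atLeastAtMost)
    show "(f has_vector_derivative g t) (at t within {x..y})" if "x \<le> t" "t \<le> y" for t
    proof -
      have "t \<in> I" using xy that by auto
      then show ?thesis using d
        by (meson has_vector_derivative_at_within has_real_derivative_iff_has_vector_derivative)
    qed
  qed (use xy c' in auto)
  then show "set_integrable lborel {x<..y} g \<and> (LBINT t:{x<..y}. g t) = f y - f x"
    using set_integrable_continuous_Ioc[OF c'] set_integral_Ioc_eq_Icc by auto
qed

text \<open>
  On a short interval the mean value theorem gives \<open>F (f b) - F (f a) = F' (f t) (f b - f a)\<close> for
  some \<open>t\<close> between \<open>a\<close> and \<open>b\<close>, and \<open>F' \<circ> f\<close> is nearly constant there; \<open>F\<close> may have a singular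
  derivative at the ends of the range, which is the case for the calibration used below.
\<close>

lemma chain_rule_Icc:
  assumes xy: "x \<le> y" and ac: "ac_deriv {x..y} f g" and cf: "continuous_on {x..y} f"
    and ran: "f ` {x..y} \<subseteq> {c..d}"
    and cF: "continuous_on {c..d} F" and cF': "continuous_on {c..d} F'"
    and dF: "\<And>t. c < t \<Longrightarrow> t < d \<Longrightarrow> (F has_real_derivative F' t) (at t)"
  shows "set_integrable lborel {x<..y} (\<lambda>t. F' (f t) * g t)"
    and "(LBINT t:{x<..y}. F' (f t) * g t) = F (f y) - F (f x)"
proof -
  let ?h = "\<lambda>t. F' (f t)"
  have ch: "continuous_on {x..y} ?h"
    using continuous_on_compose2[OF cF' cf] ran by auto
  have gi: "set_integrable lborel {x<..y} g" using ac_derivD(1)[OF ac] xy by auto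
  show hi: "set_integrable lborel {x<..y} (\<lambda>t. ?h t * g t)"
    by (rule set_integrable_mult_continuous[OF gi ch])
  have "\<bar>F (f y) - F (f x) - (LBINT t:{x<..y}. ?h t * g t)\<bar> \<le> e * (LBINT t:{x<..y}. \<bar>g t\<bar>)"
    if e: "e > 0" for e
  proof -
    \<comment> \<open>The error is bounded by a multiple of the integral of |g|, which is additive,
      so the estimate for short intervals extends to \<open>{x..y}\<close> by bisection.\<close>
    define P where "P a b \<longleftrightarrow> (x \<le> a \<and> a \<le> b \<and> b \<le> y \<longrightarrow>
       \<bar>F (f b) - F (f a) - (LBINT t:{a<..b}. ?h t * g t)\<bar> \<le> e * (LBINT t:{a<..b}. \<bar>g t\<bar>))"
      for a b
    have "uniformly_continuous_on {x..y} ?h" using ch compact_uniformly_continuous by blast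
    then obtain r where r: "r > 0"
      "\<And>s t. s \<in> {x..y} \<Longrightarrow> t \<in> {x..y} \<Longrightarrow> dist t s < r \<Longrightarrow> dist (?h t) (?h s) < e"
      using e unfolding uniformly_continuous_on_def by metis
    have short: "P a b" if ab': "b - a < r" for a b
      unfolding P_def
    proof (intro impI)
      assume ab: "x \<le> a \<and> a \<le> b \<and> b \<le> y"
      have sub: "{a..b} \<subseteq> {x..y}" using ab by auto
      have gab: "set_integrable lborel {a<..b} g" "(LBINT t:{a<..b}. g t) = f b - f a"
        using ac_derivD[OF ac _ sub] ab by auto
      have hab: "set_integrable lborel {a<..b} (\<lambda>t. ?h t * g t)"
        by (rule set_integrable_mult_continuous[OF gab(1) continuous_on_subset[OF ch sub]])
      have "\<exists>t\<in>{a..b}. F (f b) - F (f a) = ?h t * (f b - f a)"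
      proof -
        have fr: "f a \<in> {c..d}" "f b \<in> {c..d}" using ran ab by (auto simp: image_subset_iff)
        have mv: "\<exists>z. u < z \<and> z < v \<and> F v - F u = (v - u) * F' z"
          if "u < v" "u \<in> {c..d}" "v \<in> {c..d}" for u v
        proof -
          have "continuous_on {u..v} F" by (rule continuous_on_subset[OF cF]) (use that in auto)
          moreover have "(F has_derivative (\<lambda>h. F' z * h)) (at z)" if "u < z" "z < v" for z
            using dF[of z] that \<open>u \<in> {c..d}\<close> \<open>v \<in> {c..d}\<close> by (auto simp: has_field_derivative_def)
          ultimately obtain z where "u < z" "z < v" "F v - F u = F' z * (v - u)"
            using mvt[of u v F "\<lambda>z h. F' z * h"] \<open>u < v\<close> by metis
          then show ?thesis by (auto simp: mult.commute)
        qed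
        have cab: "continuous_on {a..b} f" using cf sub continuous_on_subset by blast
        consider "f a = f b" | "f a < f b" | "f b < f a" by linarith
        then show ?thesis
        proof cases
          case 1 then show ?thesis using ab by auto
        next
          case 2
          then obtain z where z: "f a < z" "z < f b" "F (f b) - F (f a) = (f b - f a) * F' z"
            using mv[OF 2 fr] by auto
          obtain t where "t \<ge> a" "t \<le> b" "f t = z"
            using IVT'[of f a z b] z ab cab by auto
          then show ?thesis using z by (auto simp: mult.commute)
        next
          case 3
          then obtain z where z: "f b < z" "z < f a" "F (f a) - F (f b) = (f a - f b) * F' z"
            using mv[OF 3 fr(2,1)] by auto
          obtain t where "t \<ge> a" "t \<le> b" "f t = z"
            using IVT2'[of f b z a] z ab cab by auto
          then have "F (f b) - F (f a) = ?h t * (f b - f a)" using z by (simp add: algebra_simps)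
          then show ?thesis using \<open>t \<ge> a\<close> \<open>t \<le> b\<close> by auto
        qed
      qed
      then obtain s where s: "s \<in> {a..b}" "F (f b) - F (f a) = ?h s * (f b - f a)" by auto
      have "F (f b) - F (f a) - (LBINT t:{a<..b}. ?h t * g t)
          = (LBINT t:{a<..b}. ?h s * g t) - (LBINT t:{a<..b}. ?h t * g t)"
        using s gab by simp
      also have "\<dots> = (LBINT t:{a<..b}. ?h s * g t - ?h t * g t)"
        using gab hab by (subst set_integral_diff) auto
      finally have "\<bar>F (f b) - F (f a) - (LBINT t:{a<..b}. ?h t * g t)\<bar>
          = \<bar>LBINT t:{a<..b}. ?h s * g t - ?h t * g t\<bar>" by simp
      also have "\<dots> \<le> (LBINT t:{a<..b}. \<bar>?h s * g t - ?h t * g t\<bar>)"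
        using set_integral_norm_bound[of lborel "{a<..b}" "\<lambda>t. ?h s * g t - ?h t * g t"] gab hab
        by auto
      also have "\<dots> \<le> (LBINT t:{a<..b}. e * \<bar>g t\<bar>)"
      proof (rule set_integral_mono)
        show "set_integrable lborel {a<..b} (\<lambda>t. \<bar>?h s * g t - ?h t * g t\<bar>)"
          using gab hab by (intro set_integrable_abs) auto
        show "set_integrable lborel {a<..b} (\<lambda>t. e * \<bar>g t\<bar>)"
          using gab by (intro set_integrable_mult_right set_integrable_abs) auto
        fix t assume t: "t \<in> {a<..b}"
        have "dist s t < r" using t s ab' by (auto simp: dist_real_def)
        then have "\<bar>?h s - ?h t\<bar> < e"
          using r(2)[of t s] t s sub by (auto simp: dist_real_def)
        then have "\<bar>?h s - ?h t\<bar> * \<bar>g t\<bar> \<le> e * \<bar>g t\<bar>"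
          by (intro mult_right_mono) auto
        then show "\<bar>?h s * g t - ?h t * g t\<bar> \<le> e * \<bar>g t\<bar>"
          by (simp add: abs_mult[symmetric] left_diff_distrib)
      qed
      also have "\<dots> = e * (LBINT t:{a<..b}. \<bar>g t\<bar>)" by simp
      finally show "\<bar>F (f b) - F (f a) - (LBINT t:{a<..b}. ?h t * g t)\<bar>
         \<le> e * (LBINT t:{a<..b}. \<bar>g t\<bar>)" .
    qed
    have "P x y"
      using xy
    proof (induct rule: Bolzano)
      case (local z)
      then show ?case using r(1) short by blast
    next
      case (trans a b c)
      show ?case unfolding P_def
      proof (intro impI)
        assume ac': "x \<le> a \<and> a \<le> c \<and> c \<le> y"
        then have g3: "set_integrable lborel {a<..c} g" "set_integrable lborel {a<..c} (\<lambda>t. ?h t * g t)"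
          using gi hi by (auto intro: set_integrable_subset)
        have "\<bar>F (f b) - F (f a) - (LBINT t:{a<..b}. ?h t * g t)\<bar> \<le> e * (LBINT t:{a<..b}. \<bar>g t\<bar>)"
          "\<bar>F (f c) - F (f b) - (LBINT t:{b<..c}. ?h t * g t)\<bar> \<le> e * (LBINT t:{b<..c}. \<bar>g t\<bar>)"
          using trans ac' unfolding P_def by auto
        moreover have "(LBINT t:{a<..c}. ?h t * g t) = (LBINT t:{a<..b}. ?h t * g t) + (LBINT t:{b<..c}. ?h t * g t)"
          using trans g3 by (intro set_integral_Ioc_split) auto
        moreover have "(LBINT t:{a<..c}. \<bar>g t\<bar>) = (LBINT t:{a<..b}. \<bar>g t\<bar>) + (LBINT t:{b<..c}. \<bar>g t\<bar>)"
          using trans g3 by (intro set_integral_Ioc_split set_integrable_abs) auto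
        ultimately show "\<bar>F (f c) - F (f a) - (LBINT t:{a<..c}. ?h t * g t)\<bar> \<le> e * (LBINT t:{a<..c}. \<bar>g t\<bar>)"
          by (simp add: distrib_left)
      qed
    qed
    then show ?thesis using xy unfolding P_def by auto
  qed
  note * = this
  let ?Z = "F (f y) - F (f x) - (LBINT t:{x<..y}. ?h t * g t)"
  let ?K = "LBINT t:{x<..y}. \<bar>g t\<bar>"
  have K: "?K \<ge> 0" unfolding set_lebesgue_integral_def by (rule Bochner_Integration.integral_nonneg) auto
  have "\<bar>?Z\<bar> \<le> 0 + e" if "e > 0" for e
  proof -
    have "\<bar>?Z\<bar> \<le> (e / (?K + 1)) * ?K" using *[of "e / (?K + 1)"] that K by auto
    also have "\<dots> \<le> e" using that K by (simp add: field_simps)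
    finally show ?thesis by simp
  qed
  then have "\<bar>?Z\<bar> \<le> 0" by (rule field_le_epsilon)
  then show "(LBINT t:{x<..y}. ?h t * g t) = F (f y) - F (f x)" by simp
qed


lemma ac_deriv_chain_Icc:
  assumes ac: "ac_deriv I f g" and I: "open I"
    and ran: "\<And>x. x \<in> I \<Longrightarrow> f x \<in> {c..d}"
    and cF: "continuous_on {c..d} F" and cF': "continuous_on {c..d} F'"
    and dF: "\<And>t. c < t \<Longrightarrow> t < d \<Longrightarrow> (F has_real_derivative F' t) (at t)"
  shows "ac_deriv I (\<lambda>x. F (f x)) (\<lambda>x. F' (f x) * g x)"
  unfolding ac_deriv_def
proof (intro allI impI)
  fix x y :: real assume xy: "x \<le> y \<and> {x..y} \<subseteq> I"
  have "f ` {x..y} \<subseteq> {c..d}" using xy ran by blast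
  then show "set_integrable lborel {x<..y} (\<lambda>x. F' (f x) * g x) \<and>
      (LBINT t:{x<..y}. F' (f t) * g t) = F (f y) - F (f x)"
    using chain_rule_Icc[OF _ ac_deriv_subset[OF ac] continuous_on_subset[OF ac_deriv_continuous[OF ac I]]
        _ cF cF' dF, of x y] xy by blast
qed

text \<open>The image of a compact interval under \<open>f\<close> is a compact interval inside
  \<open>T\<close>, on which \<open>F\<close> is C^1; \<open>T\<close> itself may be unbounded. This
  version serves the smooth outer functions.\<close>

lemma ac_deriv_chain:
  assumes ac: "ac_deriv I f g" and I: "open I" and T: "is_interval T"
    and ran: "\<And>x. x \<in> I \<Longrightarrow> f x \<in> T"
    and dF: "\<And>t. t \<in> T \<Longrightarrow> (F has_real_derivative F' t) (at t)" and cF': "continuous_on T F'"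
  shows "ac_deriv I (\<lambda>x. F (f x)) (\<lambda>x. F' (f x) * g x)"
  unfolding ac_deriv_def
proof (intro allI impI)
  fix x y :: real assume xy: "x \<le> y \<and> {x..y} \<subseteq> I"
  have cf: "continuous_on {x..y} f"
    using continuous_on_subset[OF ac_deriv_continuous[OF ac I]] xy by blast
  then obtain c d where cd: "f ` {x..y} = {c..d}"
    using continuous_image_closed_interval xy by metis
  have "f ` {x..y} \<subseteq> T" using xy ran by blast
  then have T': "{c..d} \<subseteq> T" using cd by simp
  have "continuous_on {c..d} F"
    by (rule continuous_on_subset[OF _ T'], rule DERIV_continuous_on)
       (rule has_field_derivative_at_within[OF dF])
  then show "set_integrable lborel {x<..y} (\<lambda>x. F' (f x) * g x) \<and>
      (LBINT t:{x<..y}. F' (f t) * g t) = F (f y) - F (f x)"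
    using chain_rule_Icc[OF _ ac_deriv_subset[OF ac] cf _ _ continuous_on_subset[OF cF' T'], where F=F]
      xy cd dF T' by (auto simp: subset_iff)
qed

text \<open>Polarization, f f' = ((f + f')^2 - (f - f')^2) / 4, reduces the product rule to the
  chain rule for the square.\<close>

lemma ac_deriv_mult:
  assumes f: "ac_deriv I f g" and f': "ac_deriv I f' g'" and I: "open I"
  shows "ac_deriv I (\<lambda>x. f x * f' x) (\<lambda>x. f x * g' x + f' x * g x)"
proof -
  have sq: "ac_deriv I (\<lambda>x. (h x)\<^sup>2) (\<lambda>x. (2 * h x) * k x)" if "ac_deriv I h k" for h k
    by (rule ac_deriv_chain[OF that I, where T=UNIV and F="\<lambda>t. t\<^sup>2" and F'="\<lambda>t. 2 * t"])
       (auto intro!: derivative_eq_intros continuous_intros)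
  have "ac_deriv I (\<lambda>x. 1/4 * (f x + f' x)\<^sup>2 - 1/4 * (f x - f' x)\<^sup>2)
    (\<lambda>x. 1/4 * ((2 * (f x + f' x)) * (g x + g' x)) - 1/4 * ((2 * (f x - f' x)) * (g x - g' x)))"
    by (intro ac_deriv_diff ac_deriv_cmult sq ac_deriv_add f f')
  then show ?thesis
    by (rule ac_deriv_cong) (simp_all add: power2_eq_square algebra_simps)
qed

text \<open>The chain rule holds for the smooth approximations sqrt (t^2 + 1/(n+1)) of |t|. Their
  derivatives are bounded by 1 and converge to \<open>sgn t\<close> everywhere, also at t = 0 where
  \<open>sgn\<close> is 0, so dominated convergence applies and the zero set of \<open>f\<close>
  needs no case distinction.\<close>

lemma ac_deriv_abs:
  assumes ac: "ac_deriv I f g" and I: "open I"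
  shows "ac_deriv I (\<lambda>x. \<bar>f x\<bar>) (\<lambda>x. sgn (f x) * g x)"
  unfolding ac_deriv_def
proof (intro allI impI)
  fix x y :: real assume xy: "x \<le> y \<and> {x..y} \<subseteq> I"
  define F where "F n t = sqrt (t\<^sup>2 + 1 / real (Suc n))" for n t
  define F' where "F' n t = t / sqrt (t\<^sup>2 + 1 / real (Suc n))" for n t
  have pos: "t\<^sup>2 + 1 / real (Suc n) > 0" for n t
    using zero_le_power2[of t] by (intro add_nonneg_pos) auto
  have ap: "ac_deriv I (\<lambda>x. F n (f x)) (\<lambda>x. F' n (f x) * g x)" for n
  proof (rule ac_deriv_chain[OF ac I, where T=UNIV])
    show "(F n has_real_derivative F' n t) (at t)" for t
      unfolding F_def F'_def using pos[of t n]
      by (auto intro!: derivative_eq_intros simp: inverse_eq_divide)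
    show "continuous_on UNIV (F' n)"
      unfolding F'_def using pos[of _ n] by (intro continuous_intros) (metis less_irrefl real_sqrt_gt_zero)
  qed auto
  have gi: "set_integrable lborel {x<..y} g" using ac_derivD(1)[OF ac] xy by auto
  have lim0: "(\<lambda>n. 1 / real (Suc n)) \<longlonglongrightarrow> 0"
    using LIMSEQ_inverse_real_of_nat by (simp add: inverse_eq_divide)
  have F: "(\<lambda>n. F n t) \<longlonglongrightarrow> \<bar>t\<bar>" for t
  proof -
    have "(\<lambda>n. F n t) \<longlonglongrightarrow> sqrt (t\<^sup>2 + 0)"
      unfolding F_def by (intro tendsto_intros lim0)
    then show ?thesis by simp
  qed
  have F': "(\<lambda>n. F' n t) \<longlonglongrightarrow> sgn t" for t
  proof (cases "t = 0")
    case True then show ?thesis by (simp add: F'_def)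
  next
    case False
    have "(\<lambda>n. F' n t) \<longlonglongrightarrow> t / \<bar>t\<bar>"
      unfolding F'_def using F[of t] False unfolding F_def by (intro tendsto_intros) auto
    moreover have "t / \<bar>t\<bar> = sgn t" using False by (simp add: sgn_if abs_if)
    ultimately show ?thesis by simp
  qed
  have F'le: "\<bar>F' n t\<bar> \<le> 1" for n t
  proof -
    have "\<bar>t\<bar> \<le> sqrt (t\<^sup>2 + 1 / real (Suc n))"
      by (rule real_le_rsqrt) simp
    then show ?thesis unfolding F'_def using pos[of t n] by (simp add: abs_divide divide_le_eq)
  qed
  have cf: "continuous_on {x..y} f"
    using continuous_on_subset[OF ac_deriv_continuous[OF ac I]] xy by blast
  have mf: "set_borel_measurable lborel {x<..y} f"
    by (rule set_borel_measurable_continuous_on[OF cf]) auto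
  have ms: "set_borel_measurable lborel {x<..y} (\<lambda>t. sgn (f t))"
  proof -
    have "(\<lambda>t. sgn (indicator {x<..y} t *\<^sub>R f t)) \<in> borel_measurable lborel"
      using mf unfolding set_borel_measurable_def by measurable
    moreover have "(\<lambda>t. sgn (indicator {x<..y} t *\<^sub>R f t)) = (\<lambda>t. indicator {x<..y} t *\<^sub>R sgn (f t))"
      by (auto simp: indicator_def)
    ultimately show ?thesis unfolding set_borel_measurable_def by simp
  qed
  have int: "set_integrable lborel {x<..y} (\<lambda>t. sgn (f t) * g t)"
    by (rule set_integrable_mult_bounded[OF gi ms, of 1]) (auto simp: sgn_if)
  have "(\<lambda>n. (LBINT t:{x<..y}. F' n (f t) * g t)) \<longlonglongrightarrow> (LBINT t:{x<..y}. sgn (f t) * g t)"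
    unfolding set_lebesgue_integral_def
  proof (rule integral_dominated_convergence)
    show "integrable lborel (\<lambda>t. \<bar>indicator {x<..y} t *\<^sub>R g t\<bar>)"
      using gi unfolding set_integrable_def by auto
    show "(\<lambda>t. indicator {x<..y} t *\<^sub>R (sgn (f t) * g t)) \<in> borel_measurable lborel"
      using int unfolding set_integrable_def by auto
    show "(\<lambda>t. indicator {x<..y} t *\<^sub>R (F' n (f t) * g t)) \<in> borel_measurable lborel" for n
      using ac_derivD(1)[OF ap] xy unfolding set_integrable_def by auto
    show "AE t in lborel. (\<lambda>n. indicator {x<..y} t *\<^sub>R (F' n (f t) * g t))
        \<longlonglongrightarrow> indicator {x<..y} t *\<^sub>R (sgn (f t) * g t)"
      by (intro AE_I2 tendsto_intros F')
    show "AE t in lborel. norm (indicator {x<..y} t *\<^sub>R (F' n (f t) * g t)) \<le> \<bar>indicator {x<..y} t *\<^sub>R g t\<bar>" for n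
      using F'le by (intro AE_I2) (auto simp: indicator_def abs_mult mult_left_le_one_le)
  qed
  moreover have "(\<lambda>n. (LBINT t:{x<..y}. F' n (f t) * g t)) \<longlonglongrightarrow> \<bar>f y\<bar> - \<bar>f x\<bar>"
  proof -
    have "(LBINT t:{x<..y}. F' n (f t) * g t) = F n (f y) - F n (f x)" for n
      using ac_derivD(2)[OF ap] xy by auto
    then show ?thesis by (auto intro!: tendsto_intros F)
  qed
  ultimately have "(LBINT t:{x<..y}. sgn (f t) * g t) = \<bar>f y\<bar> - \<bar>f x\<bar>"
    using LIMSEQ_unique by blast
  with int show "set_integrable lborel {x<..y} (\<lambda>x. sgn (f x) * g x) \<and>
     (LBINT t:{x<..y}. sgn (f t) * g t) = \<bar>f y\<bar> - \<bar>f x\<bar>" by simp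
qed

text \<open>The positive and negative parts of \<open>d\<close> are densities of two finite measures
  that agree on all rays. Rays determine a Borel measure, and densities with respect to
  \<open>lborel\<close> are unique almost everywhere.\<close>

lemma AE_eq_of_indefinite_integral_eq:
  fixes d :: "real \<Rightarrow> real"
  assumes int: "integrable lborel d" and z: "\<And>x. (LBINT t:{x<..}. d t) = 0"
  shows "AE t in lborel. d t = 0"
proof -
  let ?p = "\<lambda>t. max 0 (d t)" and ?n = "\<lambda>t. max 0 (- d t)"
  have ip: "integrable lborel ?p" "integrable lborel ?n" using int by auto
  have si: "set_integrable lborel {x<..} ?p" "set_integrable lborel {x<..} ?n" for x
    unfolding set_integrable_def by (intro integrable_mult_indicator ip; simp)+
  have [measurable]: "d \<in> borel_measurable borel" using int by auto
  have em: "emeasure (density lborel (\<lambda>t. ennreal (h t))) {x<..} = ennreal (LBINT t:{x<..}. h t)"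
    if "integrable lborel h" "\<And>t. h t \<ge> 0" for h :: "real \<Rightarrow> real" and x
  proof -
    have [measurable]: "h \<in> borel_measurable borel" using that by auto
    have "emeasure (density lborel (\<lambda>t. ennreal (h t))) {x<..} = (\<integral>\<^sup>+t. ennreal (indicator {x<..} t * h t) \<partial>lborel)"
      by (subst emeasure_density) (auto intro!: nn_integral_cong simp: indicator_def)
    also have "\<dots> = ennreal (LINT t|lborel. indicator {x<..} t * h t)"
      using that integrable_mult_indicator[of "{x<..}" lborel h]
      by (intro nn_integral_eq_integral) (auto intro!: AE_I2)
    finally show ?thesis by (simp add: set_lebesgue_integral_def)
  qed
  have "density lborel (\<lambda>t. ennreal (?p t)) = density lborel (\<lambda>t. ennreal (?n t))"
  proof (rule measure_eqI_lessThan)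
    fix x :: real
    show "emeasure (density lborel (\<lambda>t. ennreal (?p t))) {x<..} < \<infinity>"
      by (subst em) (use ip in auto)
    have "(LBINT t:{x<..}. ?p t) - (LBINT t:{x<..}. ?n t) = (LBINT t:{x<..}. ?p t - ?n t)"
      using si by simp
    also have "\<dots> = (LBINT t:{x<..}. d t)"
      by (intro set_lebesgue_integral_cong) auto
    finally have "(LBINT t:{x<..}. ?p t) = (LBINT t:{x<..}. ?n t)" using z by simp
    then show "emeasure (density lborel (\<lambda>t. ennreal (?p t))) {x<..} = emeasure (density lborel (\<lambda>t. ennreal (?n t))) {x<..}"
      using ip by (simp add: em)
  qed auto
  then have "AE t in lborel. ennreal (?p t) = ennreal (?n t)"
    by (subst (asm) sigma_finite_measure.density_unique_iff[OF sigma_finite_lborel]) auto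
  then show ?thesis
    by eventually_elim (auto simp: max_def split: if_splits)
qed

text \<open>The difference of the integrands is cut off to \<open>{a<..b}\<close>, which makes it
  integrable on the whole line. Its integral over a ray is then one over
  \<open>{max a x<..b}\<close>, where both integrands produce the same increment of
  \<open>f\<close>.\<close>

lemma ac_deriv_unique:
  assumes g: "ac_deriv I f g" and g': "ac_deriv I f g'" and ab: "{a..b} \<subseteq> I" "a \<le> b"
  shows "AE t in lborel. t \<in> {a<..b} \<longrightarrow> g t = g' t"
proof -
  let ?d = "\<lambda>t. indicator {a<..b} t * (g t - g' t)"
  have i: "set_integrable lborel {a<..b} g" "set_integrable lborel {a<..b} g'"
    using ac_derivD(1)[OF g] ac_derivD(1)[OF g'] ab by auto
  have int: "integrable lborel ?d"
    using set_integral_diff(1)[OF i] unfolding set_integrable_def by simp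
  have "(LBINT t:{x<..}. ?d t) = 0" for x
  proof (cases "x \<le> b")
    case True
    define z where "z = max a x"
    have z: "z \<le> b" "{z..b} \<subseteq> I" using True ab by (auto simp: z_def)
    have "(LBINT t:{x<..}. ?d t) = (LBINT t:{z<..b}. g t - g' t)"
      unfolding set_lebesgue_integral_def z_def
      by (intro Bochner_Integration.integral_cong) (auto simp: indicator_def)
    also have "\<dots> = (LBINT t:{z<..b}. g t) - (LBINT t:{z<..b}. g' t)"
      using ac_derivD(1)[OF g z] ac_derivD(1)[OF g' z] by simp
    also have "\<dots> = 0" using ac_derivD(2)[OF g z] ac_derivD(2)[OF g' z] by simp
    finally show ?thesis .
  next
    case False
    then have "(LBINT t:{x<..}. ?d t) = (LBINT t:{x<..}. 0)"
      by (intro set_lebesgue_integral_cong) (auto simp: indicator_def)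
    then show ?thesis by simp
  qed
  then have "AE t in lborel. ?d t = 0" using AE_eq_of_indefinite_integral_eq[OF int] by blast
  then show ?thesis by eventually_elim (auto simp: indicator_def)
qed

section \<open>Weak derivatives and indefinite integrals\<close>

lemma L2_onD:
  assumes "L2_on I f"
  shows "set_borel_measurable lborel I f" "set_integrable lborel I (\<lambda>x. (f x)\<^sup>2)"
  using assms unfolding L2_on_def by auto

lemma set_borel_measurable_add:
  fixes f g :: "'a \<Rightarrow> real"
  assumes "set_borel_measurable M A f" "set_borel_measurable M A g"
  shows "set_borel_measurable M A (\<lambda>x. f x + g x)"
  using assms unfolding set_borel_measurable_def by (simp add: distrib_left)

lemma set_borel_measurable_cmult:
  fixes f :: "'a \<Rightarrow> real"
  assumes "set_borel_measurable M A f"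
  shows "set_borel_measurable M A (\<lambda>x. c * f x)"
proof -
  have "(\<lambda>x. indicator A x *\<^sub>R (c * f x)) = (\<lambda>x. c * (indicator A x *\<^sub>R f x))" by auto
  then show ?thesis using assms unfolding set_borel_measurable_def by simp
qed

lemma L2_on_mult:
  assumes f: "L2_on I f" and g: "L2_on I g"
  shows "set_integrable lborel I (\<lambda>x. f x * g x)"
proof (rule set_integrable_bound)
  show "set_integrable lborel I (\<lambda>x. (f x)\<^sup>2 + (g x)\<^sup>2)"
    using L2_onD(2)[OF f] L2_onD(2)[OF g] by (rule set_integral_add)
  show "set_borel_measurable lborel I (\<lambda>x. f x * g x)"
    by (intro set_borel_measurable_mult L2_onD(1) f g)
  have "\<bar>a * b\<bar> \<le> a\<^sup>2 + b\<^sup>2" for a b :: real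
    using sum_squares_bound[of a b] sum_squares_bound[of a "-b"] zero_le_power2[of a] zero_le_power2[of b]
    unfolding power2_minus abs_le_iff by linarith
  then show "AE x in lborel. x \<in> I \<longrightarrow> norm (f x * g x) \<le> norm ((f x)\<^sup>2 + (g x)\<^sup>2)"
    by (intro AE_I2) (auto intro: order_trans[OF _ abs_ge_self])
qed

lemma L2_on_add:
  assumes f: "L2_on I f" and g: "L2_on I g"
  shows "L2_on I (\<lambda>x. f x + g x)"
  unfolding L2_on_def
proof
  show "set_borel_measurable lborel I (\<lambda>x. f x + g x)"
    by (intro set_borel_measurable_add L2_onD(1) f g)
  have "set_integrable lborel I (\<lambda>x. (f x)\<^sup>2 + (g x)\<^sup>2 + 2 * (f x * g x))"
    using L2_onD(2)[OF f] L2_onD(2)[OF g] L2_on_mult[OF f g] by (intro set_integral_add) auto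
  then show "set_integrable lborel I (\<lambda>x. (f x + g x)\<^sup>2)"
    by (simp add: power2_sum algebra_simps)
qed

lemma L2_on_cmult:
  assumes f: "L2_on I f"
  shows "L2_on I (\<lambda>x. c * f x)"
  unfolding L2_on_def
  using L2_onD[OF f] set_borel_measurable_cmult[of lborel I f c] by (simp add: power_mult_distrib)

lemma L2_on_bounded_mult:
  assumes f: "L2_on I f" and h: "set_borel_measurable lborel I h" and K: "\<And>x. x \<in> I \<Longrightarrow> \<bar>h x\<bar> \<le> K"
  shows "L2_on I (\<lambda>x. h x * f x)"
  unfolding L2_on_def
proof
  show "set_borel_measurable lborel I (\<lambda>x. h x * f x)"
    by (intro set_borel_measurable_mult h L2_onD(1) f)
  have "set_integrable lborel I (\<lambda>x. (h x * h x) * (f x)\<^sup>2)"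
  proof (rule set_integrable_mult_bounded[OF L2_onD(2)[OF f]])
    show "set_borel_measurable lborel I (\<lambda>x. h x * h x)" by (intro set_borel_measurable_mult h)
    show "\<bar>h t * h t\<bar> \<le> K * K" if "t \<in> I" for t
      unfolding abs_mult using K[OF that] by (intro mult_mono) auto
  qed
  then show "set_integrable lborel I (\<lambda>x. (h x * f x)\<^sup>2)"
    by (simp add: power2_eq_square mult_ac)
qed

lemma L2_on_subset: "L2_on I f \<Longrightarrow> J \<subseteq> I \<Longrightarrow> J \<in> sets borel \<Longrightarrow> I \<in> sets borel \<Longrightarrow> L2_on J f"
  unfolding L2_on_def
  by (auto intro: set_integrable_subset set_borel_measurable_subset)

lemma L2_on_integrable_Ioc:
  assumes g: "L2_on I g" and I: "{x<..y} \<subseteq> I" "I \<in> sets borel"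
  shows "set_integrable lborel {x<..y} g"
proof (rule set_integrable_bound)
  have g': "L2_on {x<..y} g" by (rule L2_on_subset[OF g]) (use I in auto)
  have "set_integrable lborel {x<..y} (\<lambda>t. 1 :: real)"
    by (rule set_integrable_continuous_Ioc) auto
  then show "set_integrable lborel {x<..y} (\<lambda>t. 1 + (g t)\<^sup>2)"
    using L2_onD(2)[OF g'] by (rule set_integral_add)
  show "set_borel_measurable lborel {x<..y} g" using L2_onD(1)[OF g'] .
  have "\<bar>a\<bar> \<le> 1 + a\<^sup>2" for a :: real
    using zero_le_power2[of "\<bar>a\<bar> - 1"] zero_le_power2[of a] unfolding power2_diff by auto
  then show "AE t in lborel. t \<in> {x<..y} \<longrightarrow> norm (g t) \<le> norm (1 + (g t)\<^sup>2)"
    by (intro AE_I2) (auto intro: order_trans[OF _ abs_ge_self])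
qed

section \<open>From indefinite integrals to weak derivatives and back\<close>

lemma is_interval_IccI: "is_interval (I :: real set) \<Longrightarrow> x \<in> I \<Longrightarrow> y \<in> I \<Longrightarrow> {x..y} \<subseteq> I"
  using mem_is_interval_1_I[of I x y] by (meson atLeastAtMost_iff subsetI)

lemma open_real_less_greater:
  fixes I :: "real set"
  assumes "open I" "x \<in> I"
  obtains a b where "a < x" "x < b" "a \<in> I" "b \<in> I"
proof -
  obtain e where "e > 0" "cball x e \<subseteq> I" using assms unfolding open_contains_cball by auto
  then show thesis using that[of "x - e" "x + e"] by (auto simp: cball_eq_atLeastAtMost subset_iff)
qed

text \<open>Integration by parts on an interval [a, b] inside \<open>I\<close> whose interior
  contains the support \<open>K\<close>, so that the boundary terms vanish.\<close>

lemma ac_deriv_imp_weak: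
  assumes ac: "ac_deriv I f g" and I: "open I" "is_interval I"
  shows "has_weak_deriv_on f g I"
  unfolding has_weak_deriv_on_def
proof (intro allI impI)
  fix \<phi> :: "real \<Rightarrow> real" and K assume H: "\<phi> C1_differentiable_on UNIV \<and> compact K \<and> K \<subseteq> I \<and> (\<forall>x. x \<notin> K \<longrightarrow> \<phi> x = 0)"
  obtain \<phi>' where d: "\<And>x. (\<phi> has_real_derivative \<phi>' x) (at x)" and c: "continuous_on UNIV \<phi>'"
    using H unfolding C1_differentiable_on_def has_real_derivative_iff_has_vector_derivative by auto
  have deriv: "deriv \<phi> = \<phi>'" using d DERIV_imp_deriv by blast
  show "(LBINT x:I. f x * deriv \<phi> x) = - (LBINT x:I. g x * \<phi> x)"
  proof (cases "K = {}")
    case True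
    then have "\<phi> = (\<lambda>x. 0)" using H by auto
    then show ?thesis using d by (auto simp: set_lebesgue_integral_def)
  next
    case False
    have bK: "bdd_below K" "bdd_above K" "closed K"
      using H by (auto intro: compact_imp_bounded bounded_imp_bdd_above bounded_imp_bdd_below compact_imp_closed)
    have "Inf K \<in> K" "Sup K \<in> K"
      using closed_contains_Inf[OF False bK(1,3)] closed_contains_Sup[OF False bK(2,3)] by auto
    then have IS: "Inf K \<in> I" "Sup K \<in> I" using H by auto
    obtain a where a: "a < Inf K" "a \<in> I" using open_real_less_greater[OF I(1) IS(1)] by metis
    obtain b where b: "Sup K < b" "b \<in> I" using open_real_less_greater[OF I(1) IS(2)] by metis
    have K: "x \<in> K \<Longrightarrow> a < x \<and> x < b" for x
      using a b cInf_lower[OF _ bK(1), of x] cSup_upper[OF _ bK(2), of x] by auto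
    have ab: "a \<le> b" using K False by force
    have abI: "{a..b} \<subseteq> I" using is_interval_IccI I a b by blast
    \<comment> \<open>Only \<open>\<phi>\<close> is assumed to vanish off \<open>K\<close>; its
      derivative does as well because the complement of \<open>K\<close> is open.\<close>
    have \<phi>'0: "\<phi>' x = 0" if "x \<notin> K" for x
    proof -
      have "\<forall>\<^sub>F y in nhds x. y \<in> - K" using that bK by (intro eventually_nhds_in_open) auto
      then have "\<forall>\<^sub>F y in nhds x. \<phi> y = 0" using H by (auto elim: eventually_mono)
      then have "(\<phi> has_real_derivative 0) (at x)"
        by (subst DERIV_cong_ev[OF HOL.refl _ HOL.refl]) auto
      then show ?thesis using DERIV_unique d by blast
    qed
    have p: "ac_deriv I (\<lambda>x. f x * \<phi> x) (\<lambda>x. f x * \<phi>' x + \<phi> x * g x)"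
      by (rule ac_deriv_mult[OF ac ac_deriv_C1[OF d continuous_on_subset[OF c subset_UNIV]] I(1)])
    have cf: "continuous_on {a..b} f" using ac_deriv_continuous[OF ac I(1)] abI continuous_on_subset by blast
    have c\<phi>: "continuous_on A \<phi>" for A
      using d by (meson DERIV_isCont continuous_at_imp_continuous_on)
    have i1: "set_integrable lborel {a<..b} (\<lambda>x. f x * \<phi>' x)"
      by (intro set_integrable_continuous_Ioc continuous_intros cf continuous_on_subset[OF c]) auto
    have i2: "set_integrable lborel {a<..b} (\<lambda>x. \<phi> x * g x)"
      by (intro set_integrable_mult_continuous c\<phi> ac_derivD[OF ac ab abI])
    have "(LBINT x:{a<..b}. f x * \<phi>' x) + (LBINT x:{a<..b}. \<phi> x * g x) = f b * \<phi> b - f a * \<phi> a"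
      using ac_derivD(2)[OF p ab abI] i1 i2 by simp
    moreover have "\<phi> a = 0" "\<phi> b = 0" using H K by blast+
    moreover have "(LBINT x:I. f x * \<phi>' x) = (LBINT x:{a<..b}. f x * \<phi>' x)"
      unfolding set_lebesgue_integral_def
    proof (intro Bochner_Integration.integral_cong HOL.refl)
      fix t show "indicator I t *\<^sub>R (f t * \<phi>' t) = indicator {a<..b} t *\<^sub>R (f t * \<phi>' t)"
        using K[of t] H \<phi>'0[of t] by (cases "t \<in> K") (auto simp: indicator_def)
    qed
    moreover have "(LBINT x:I. g x * \<phi> x) = (LBINT x:{a<..b}. \<phi> x * g x)"
      unfolding set_lebesgue_integral_def
    proof (intro Bochner_Integration.integral_cong HOL.refl)
      fix t 
      have "\<phi> t = 0" if "t \<notin> K" using H that by blast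
      then show "indicator I t *\<^sub>R (g t * \<phi> t) = indicator {a<..b} t *\<^sub>R (\<phi> t * g t)"
        using K[of t] H by (cases "t \<in> K") (auto simp: indicator_def)
    qed
    ultimately show ?thesis by (simp add: deriv)
  qed
qed

text \<open>
  Du Bois-Reymond: with \<open>k = f - \<integral> g\<close>, the choice \<open>\<phi>' = (t - a) (b - t) (k - c)\<close>, where \<open>c\<close> is the
  weighted mean of \<open>k\<close>, turns the weak formulation into \<open>\<integral> (t - a) (b - t) (k - c)\<^sup>2 = 0\<close>.
\<close>

lemma weak_imp_ac_deriv:
  assumes w: "has_weak_deriv_on f g I" and I: "open I" "is_interval I"
    and cf: "continuous_on I f"
    and gi: "\<And>x y. {x..y} \<subseteq> I \<Longrightarrow> set_integrable lborel {x<..y} g"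
  shows "ac_deriv I f g"
  unfolding ac_deriv_def
proof (intro allI impI)
  fix x y :: real assume xy: "x \<le> y \<and> {x..y} \<subseteq> I"
  then have "x \<in> I" "y \<in> I" by auto
  \<comment> \<open>The working interval is strictly larger than \<open>{x..y}\<close>: the weight
    used below vanishes at its ends, so the conclusion holds only at interior points, and
    \<open>x\<close> and \<open>y\<close> must be among them.\<close>
  obtain a where a: "a < x" "a \<in> I" using open_real_less_greater[OF I(1) \<open>x \<in> I\<close>] by metis
  obtain b where b: "y < b" "b \<in> I" using open_real_less_greater[OF I(1) \<open>y \<in> I\<close>] by metis
  have abI: "{a..b} \<subseteq> I" using is_interval_IccI I a b by blast
  have ab: "a < b" using a b xy by auto
  have gab: "set_integrable lborel {a<..b} g" using gi abI by auto
  define g0 where "g0 t = indicator {a<..b} t * g t" for t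
  define G where "G t = (LBINT s:{..t}. g0 s)" for t
  have g0: "set_integrable lborel A g0" if "A \<in> sets borel" for A
    using gab that integrable_mult_indicator[of A lborel g0]
    unfolding g0_def[abs_def] set_integrable_def by simp
  have acG: "ac_deriv UNIV G g0"
    unfolding ac_deriv_def
  proof (intro allI impI)
    fix u v :: real assume uv: "u \<le> v \<and> {u..v} \<subseteq> UNIV"
    then have "{..v} = {..u} \<union> {u<..v}" by auto
    then have "G v = G u + (LBINT s:{u<..v}. g0 s)"
      unfolding G_def by (simp only:) (rule set_integral_Un; auto intro!: g0)
    then show "set_integrable lborel {u<..v} g0 \<and> set_lebesgue_integral lborel {u<..v} g0 = G v - G u"
      using g0 by simp
  qed
  have cfab: "continuous_on {a..b} f" using cf abI continuous_on_subset by blast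
  have cG: "continuous_on A G" for A
    using ac_deriv_continuous[OF acG open_UNIV] continuous_on_subset by blast
  define k where "k t = f t - G t" for t
  have ck: "continuous_on {a..b} k" unfolding k_def by (intro continuous_intros cfab cG)
  \<comment> \<open>The weight vanishes at \<open>a\<close> and \<open>b\<close>, so multiplying by
    it gives a continuous function supported in \<open>{a..b}\<close>; its antiderivative is then an
    admissible C^1 test function.\<close>
  define \<rho> where "\<rho> t = max 0 ((t - a) * (b - t))" for t
  have c\<rho>: "continuous_on A \<rho>" for A unfolding \<rho>_def by (intro continuous_intros)
  have \<rho>_out: "\<rho> t = 0" if "t \<le> a \<or> b \<le> t" for t
  proof -
    have "(t - a) * (b - t) \<le> 0" using that ab by (auto simp: mult_le_0_iff)
    then show ?thesis by (simp add: \<rho>_def)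
  qed
  have \<rho>_pos: "\<rho> t > 0" if "a < t" "t < b" for t using that by (auto simp: \<rho>_def)
  have \<rho>_nn: "\<rho> t \<ge> 0" for t by (auto simp: \<rho>_def)
  have zero: "\<forall>t\<in>{a..b}. h t = 0"
    if "continuous_on {a..b} h" "\<And>t. t \<in> {a..b} \<Longrightarrow> h t \<ge> 0" "(LBINT t:{a<..b}. h t) = 0" for h :: "real \<Rightarrow> real"
  proof -
    have "set_integrable lborel {a..b} h" by (rule borel_integrable_atLeastAtMost'[OF that(1)])
    then have "integral {a..b} h = 0"
      using that(3) by (simp add: set_integral_Ioc_eq_Icc set_borel_integral_eq_integral)
    then show ?thesis using integral_cbox_eq_0_iff[of a b h] that ab by auto
  qed
  define R where "R = (LBINT t:{a<..b}. \<rho> t)"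
  have R: "R \<noteq> 0"
  proof
    assume "R = 0"
    then have "\<forall>t\<in>{a..b}. \<rho> t = 0" by (intro zero c\<rho> \<rho>_nn) (simp add: R_def)
    moreover have "(a + b) / 2 \<in> {a..b}" using ab by auto
    ultimately show False using \<rho>_pos[of "(a+b)/2"] ab by auto
  qed
  define c where "c = (LBINT t:{a<..b}. \<rho> t * k t) / R"
  \<comment> \<open>Clamping to \<open>{a..b}\<close> extends \<open>k\<close> continuously to the
    line, as the test function has to be C^1 everywhere.\<close>
  define cl where "cl t = max a (min b t)" for t
  have cl: "cl t \<in> {a..b}" for t using ab by (auto simp: cl_def)
  have cl_id: "t \<in> {a..b} \<Longrightarrow> cl t = t" for t by (auto simp: cl_def)
  define \<eta> where "\<eta> t = \<rho> t * (k (cl t) - c)" for t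
  have c\<eta>: "continuous_on A \<eta>" for A
  proof -
    have "continuous_on A cl" unfolding cl_def by (intro continuous_intros)
    then have "continuous_on A (\<lambda>t. k (cl t))"
      using cl by (intro continuous_on_compose2[OF ck]) auto
    then show ?thesis unfolding \<eta>_def by (intro continuous_intros c\<rho>)
  qed
  have \<eta>_ab: "\<eta> t = \<rho> t * (k t - c)" if "t \<in> {a<..b}" for t using that cl_id by (auto simp: \<eta>_def)
  have i\<rho>: "set_integrable lborel {a<..b} \<rho>" "set_integrable lborel {a<..b} (\<lambda>t. \<rho> t * k t)"
    by (intro set_integrable_continuous_Ioc continuous_intros c\<rho> ck)+
  have \<eta>0: "(LBINT t:{a<..b}. \<eta> t) = 0"
  proof -
    have "(LBINT t:{a<..b}. \<eta> t) = (LBINT t:{a<..b}. \<rho> t * k t - c * \<rho> t)"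
      by (intro set_lebesgue_integral_cong) (auto simp: \<eta>_ab algebra_simps)
    also have "\<dots> = c * R - c * R" using i\<rho> R by (simp add: R_def c_def)
    finally show ?thesis by simp
  qed
  obtain \<Phi> where "\<And>t. (\<Phi> has_vector_derivative \<eta> t) (at t)"
    using einterval_antiderivative[of "-\<infinity>" \<infinity> \<eta>] c\<eta>[of UNIV] by (auto simp: continuous_on_eq_continuous_at)
  then have \<Phi>: "(\<Phi> has_real_derivative \<eta> t) (at t)" for t
    unfolding has_real_derivative_iff_has_vector_derivative by simp
  define \<phi> where "\<phi> t = \<Phi> t - \<Phi> a" for t
  have d\<phi>: "(\<phi> has_real_derivative \<eta> t) (at t)" for t
    unfolding \<phi>_def using \<Phi>[of t] by (auto intro!: derivative_eq_intros)
  have ac\<phi>: "ac_deriv A \<phi> \<eta>" for A by (rule ac_deriv_C1[OF d\<phi> c\<eta>])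
  have \<phi>a: "\<phi> a = 0" by (simp add: \<phi>_def)
  have \<phi>b: "\<phi> b = 0" using ac_derivD(2)[OF ac\<phi>[of UNIV], of a b] ab \<eta>0 \<phi>a by simp
  have \<phi>_out: "\<phi> t = 0" if "t \<notin> {a..b}" for t
  proof -
    have z: "(LBINT s:{u<..v}. \<eta> s) = 0" if "v \<le> a \<or> b \<le> u" for u v
    proof -
      have "(LBINT s:{u<..v}. \<eta> s) = (LBINT s:{u<..v}. 0)"
        using that \<rho>_out by (intro set_lebesgue_integral_cong) (auto simp: \<eta>_def)
      then show ?thesis by simp
    qed
    show ?thesis
      using that ac_derivD(2)[OF ac\<phi>[of UNIV], of t a] ac_derivD(2)[OF ac\<phi>[of UNIV], of b t] z[of a t] z[of t b] \<phi>a \<phi>b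
      by (cases "t < a") auto
  qed
  have C1: "\<phi> C1_differentiable_on UNIV"
    unfolding C1_differentiable_on_def has_real_derivative_iff_has_vector_derivative[symmetric]
    using d\<phi> c\<eta> by blast
  have "(LBINT t:I. f t * deriv \<phi> t) = - (LBINT t:I. g t * \<phi> t)"
    using w C1 abI \<phi>_out unfolding has_weak_deriv_on_def by (meson compact_Icc)
  moreover have "deriv \<phi> = \<eta>" using d\<phi> DERIV_imp_deriv by blast
  moreover have "(LBINT t:I. f t * \<eta> t) = (LBINT t:{a<..b}. f t * \<eta> t)"
    unfolding set_lebesgue_integral_def
  proof (intro Bochner_Integration.integral_cong HOL.refl)
    fix t show "indicator I t *\<^sub>R (f t * \<eta> t) = indicator {a<..b} t *\<^sub>R (f t * \<eta> t)"
      using subsetD[OF abI, of t] \<rho>_out[of t] by (cases "a < t \<and> t < b") (auto simp: indicator_def \<eta>_def)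
  qed
  moreover have "(LBINT t:I. g t * \<phi> t) = (LBINT t:{a<..b}. \<phi> t * g t)"
    unfolding set_lebesgue_integral_def
  proof (intro Bochner_Integration.integral_cong HOL.refl)
    fix t show "indicator I t *\<^sub>R (g t * \<phi> t) = indicator {a<..b} t *\<^sub>R (\<phi> t * g t)"
      using subsetD[OF abI, of t] \<phi>_out[of t] \<phi>a by (cases "t = a") (auto simp: indicator_def)
  qed
  ultimately have 1: "(LBINT t:{a<..b}. f t * \<eta> t) + (LBINT t:{a<..b}. \<phi> t * g t) = 0" by simp
  have c\<phi>: "continuous_on A \<phi>" for A
    using d\<phi> by (meson DERIV_isCont continuous_at_imp_continuous_on)
  \<comment> \<open>The identity \<open>1\<close> with the genuine indefinite integral
    \<open>G\<close> in place of \<open>f\<close>; subtracting the two leaves only f - G.\<close>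
  have 2: "(LBINT t:{a<..b}. G t * \<eta> t) + (LBINT t:{a<..b}. \<phi> t * g t) = 0"
  proof -
    have iG: "set_integrable lborel {a<..b} (\<lambda>t. G t * \<eta> t)"
      by (intro set_integrable_continuous_Ioc continuous_intros cG c\<eta>)
    have i\<phi>: "set_integrable lborel {a<..b} (\<lambda>t. \<phi> t * g0 t)"
      by (intro set_integrable_mult_continuous c\<phi> g0) simp
    have "(LBINT t:{a<..b}. G t * \<eta> t + \<phi> t * g0 t) = G b * \<phi> b - G a * \<phi> a"
      using ac_derivD(2)[OF ac_deriv_mult[OF acG ac\<phi> open_UNIV], of a b] ab by simp
    then have "(LBINT t:{a<..b}. G t * \<eta> t) + (LBINT t:{a<..b}. \<phi> t * g0 t) = 0"
      using iG i\<phi> \<phi>a \<phi>b by simp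
    moreover have "(LBINT t:{a<..b}. \<phi> t * g0 t) = (LBINT t:{a<..b}. \<phi> t * g t)"
      by (intro set_lebesgue_integral_cong) (auto simp: g0_def)
    ultimately show ?thesis by simp
  qed
  have "(LBINT t:{a<..b}. \<rho> t * (k t - c)\<^sup>2) = (LBINT t:{a<..b}. (f t * \<eta> t - G t * \<eta> t) - c * \<eta> t)"
    by (intro set_lebesgue_integral_cong) (auto simp: \<eta>_ab k_def power2_eq_square algebra_simps)
  also have "\<dots> = ((LBINT t:{a<..b}. f t * \<eta> t) - (LBINT t:{a<..b}. G t * \<eta> t)) - c * (LBINT t:{a<..b}. \<eta> t)"
  proof -
    have "set_integrable lborel {a<..b} (\<lambda>t. f t * \<eta> t)" "set_integrable lborel {a<..b} (\<lambda>t. G t * \<eta> t)"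
        "set_integrable lborel {a<..b} \<eta>"
      by (intro set_integrable_continuous_Ioc continuous_intros cG cfab c\<eta>)+
    then show ?thesis by simp
  qed
  also have "\<dots> = 0" using 1 2 \<eta>0 by simp
  finally have "\<forall>t\<in>{a..b}. \<rho> t * (k t - c)\<^sup>2 = 0"
    by (intro zero continuous_intros c\<rho> ck) (auto simp: \<rho>_nn)
  then have k: "k t = c" if "a < t" "t < b" for t
    using \<rho>_pos[OF that] that by (auto dest!: bspec[of _ _ t])
  have "f y - f x = G y - G x" using k[of x] k[of y] a b xy by (simp add: k_def)
  moreover have "(LBINT t:{x<..y}. g0 t) = G y - G x"
    using ac_derivD(2)[OF acG, of x y] xy by simp
  moreover have "(LBINT t:{x<..y}. g0 t) = (LBINT t:{x<..y}. g t)"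
    using a b by (intro set_lebesgue_integral_cong) (auto simp: g0_def)
  ultimately show "set_integrable lborel {x<..y} g \<and> (LBINT t:{x<..y}. g t) = f y - f x"
    using gi xy by auto
qed

lemma H1_on_weak_deriv:
  assumes H: "H1_on I f" and I: "open I" "is_interval I" and cf: "continuous_on I f"
  shows "L2_on I f" "L2_on I (weak_deriv I f)" "ac_deriv I f (weak_deriv I f)"
proof -
  have Ib: "I \<in> sets borel" using I by auto
  show "L2_on I f" using H unfolding H1_on_def by auto
  have *: "L2_on I (weak_deriv I f) \<and> has_weak_deriv_on f (weak_deriv I f) I"
    using someI_ex[of "\<lambda>g. L2_on I g \<and> has_weak_deriv_on f g I"] H
    unfolding weak_deriv_def H1_on_def by blast
  then show l: "L2_on I (weak_deriv I f)" by auto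
  show "ac_deriv I f (weak_deriv I f)"
    by (rule weak_imp_ac_deriv[OF _ I cf L2_on_integrable_Ioc[OF l _ Ib]]) (use * in \<open>force+\<close>)
qed

text \<open>The exceptional null set depends on the compact interval, so only the countably many
  intervals with rational ends are used; they still cover the open interval
  \<open>I\<close>.\<close>

lemma ac_deriv_unique_AE:
  assumes g: "ac_deriv I f g" and g': "ac_deriv I f g'" and I: "open I" "is_interval I"
  shows "AE t in lborel. t \<in> I \<longrightarrow> g t = g' t"
proof -
  let ?Q = "{(a, b) \<in> \<rat> \<times> \<rat>. a \<le> b \<and> {a..b} \<subseteq> I}"
  have "countable ?Q"
    by (rule countable_subset[of _ "\<rat> \<times> \<rat>"]) (auto intro: countable_rat)
  then have "AE t in lborel. \<forall>(a, b)\<in>?Q. t \<in> {a<..b} \<longrightarrow> g t = g' t"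
    using ac_deriv_unique[OF g g'] by (subst AE_ball_countable) auto
  then show ?thesis
  proof eventually_elim
    fix t assume t: "\<forall>(a, b)\<in>?Q. t \<in> {a<..b} \<longrightarrow> g t = g' t"
    show "t \<in> I \<longrightarrow> g t = g' t"
    proof
      assume "t \<in> I"
      then obtain a b where ab: "a < t" "t < b" "a \<in> I" "b \<in> I" using open_real_less_greater[OF I(1)] by metis
      obtain p where p: "p \<in> \<rat>" "a < p" "p < t" using Rats_dense_in_real[OF ab(1)] by auto
      obtain q where q: "q \<in> \<rat>" "t < q" "q < b" using Rats_dense_in_real[OF ab(2)] by auto
      have "{p..q} \<subseteq> I" using is_interval_IccI[OF I(2) ab(3,4)] p q by auto
      moreover have "p \<le> q" "t \<in> {p<..q}" using p q by auto
      ultimately show "g t = g' t" using t p q by blast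
    qed
  qed
qed

text \<open>This removes the choice operator from \<open>weak_deriv\<close>: the kinetic integral
  can be computed from any square-integrable representative of the derivative.\<close>

lemma H1_on_ac_deriv:
  assumes f: "L2_on I f" and g: "L2_on I g" and ac: "ac_deriv I f g" and I: "open I" "is_interval I"
  shows "H1_on I f" "(LBINT x:I. \<bar>weak_deriv I f x\<bar>\<^sup>2) = (LBINT x:I. (g x)\<^sup>2)"
proof -
  show H: "H1_on I f"
    unfolding H1_on_def using f g ac_deriv_imp_weak[OF ac I] by auto
  note w = H1_on_weak_deriv[OF H I ac_deriv_continuous[OF ac I(1)]]
  have "AE t in lborel. t \<in> I \<longrightarrow> weak_deriv I f t = g t"
    by (rule ac_deriv_unique_AE[OF w(3) ac I])
  then have ae: "AE t in lborel. indicator I t *\<^sub>R \<bar>weak_deriv I f t\<bar>\<^sup>2 = indicator I t *\<^sub>R (g t)\<^sup>2"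
    by eventually_elim (auto simp: indicator_def)
  show "(LBINT x:I. \<bar>weak_deriv I f x\<bar>\<^sup>2) = (LBINT x:I. (g x)\<^sup>2)"
    unfolding set_lebesgue_integral_def
    by (rule integral_cong_AE[OF _ _ ae])
       (use L2_onD(2)[OF w(2)] L2_onD(2)[OF g] in \<open>auto simp: set_integrable_def\<close>)
qed

text \<open>Derivative information lives on open edges only. Continuity up to the ends carries
  oscillation estimates to the vertices.\<close>

lemma closure_bound_oscillation:
  fixes \<phi> :: "real \<Rightarrow> real"
  assumes xy: "x < y" and c: "continuous_on {x..y} \<phi>"
    and le: "\<And>s t. x < s \<Longrightarrow> s \<le> t \<Longrightarrow> t < y \<Longrightarrow> \<bar>\<phi> t - \<phi> s\<bar> \<le> C"
  shows "\<bar>\<phi> y - \<phi> x\<bar> \<le> C"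
proof -
  have cl: "closure {x<..<y} = {x..y}" using xy by simp
  have le': "\<bar>\<phi> t - \<phi> s\<bar> \<le> C" if "s \<in> {x<..<y}" "t \<in> {x<..<y}" for s t
    using le[of s t] le[of t s] that by (cases "s \<le> t") (auto simp: abs_minus_commute)
  have 1: "\<bar>\<phi> y - \<phi> s\<bar> \<le> C" if s: "s \<in> {x<..<y}" for s
  proof (rule continuous_le_on_closure[of "{x<..<y}" "\<lambda>t. \<bar>\<phi> t - \<phi> s\<bar>"])
    show "continuous_on (closure {x<..<y}) (\<lambda>t. \<bar>\<phi> t - \<phi> s\<bar>)"
      unfolding cl by (intro continuous_intros c)
  qed (use xy le'[OF s] in \<open>auto simp: cl\<close>)
  show ?thesis
  proof (rule continuous_le_on_closure[of "{x<..<y}" "\<lambda>s. \<bar>\<phi> y - \<phi> s\<bar>"])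
    show "continuous_on (closure {x<..<y}) (\<lambda>s. \<bar>\<phi> y - \<phi> s\<bar>)"
      unfolding cl by (intro continuous_intros c)
  qed (use xy 1 in \<open>auto simp: cl\<close>)
qed

lemma set_integral_mono_set:
  fixes q :: "real \<Rightarrow> real"
  assumes "set_integrable lborel B q" "A \<subseteq> B" "A \<in> sets borel" "\<And>t. t \<in> B \<Longrightarrow> 0 \<le> q t"
  shows "(LBINT t:A. q t) \<le> (LBINT t:B. q t)"
proof -
  have "set_integrable lborel A q" using assms by (auto intro: set_integrable_subset)
  then show ?thesis
    using assms unfolding set_lebesgue_integral_def set_integrable_def
    by (intro integral_mono) (auto simp: indicator_def)
qed

lemma set_integral_nonneg_real:
  fixes q :: "real \<Rightarrow> real"
  assumes "\<And>t. t \<in> A \<Longrightarrow> 0 \<le> q t"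
  shows "0 \<le> (LBINT t:A. q t)"
  unfolding set_lebesgue_integral_def using assms
  by (intro Bochner_Integration.integral_nonneg) (auto simp: indicator_def)

text \<open>The derivative 2 f g of f^2 is integrable, so the variation of f^2 beyond x is at most a
  tail that tends to 0. Since f^2 is integrable too, it takes arbitrarily small values beyond x, and
  therefore f^2 at x is itself bounded by the tail.\<close>

lemma H1_half_line_decay:
  assumes ac: "ac_deriv {0<..} f g" and f: "L2_on {0<..} f" and g: "L2_on {0<..} g"
  shows "(f \<longlongrightarrow> 0) at_top"
proof -
  define q where "q t = \<bar>f t * g t + f t * g t\<bar>" for t
  have acq: "ac_deriv {0<..} (\<lambda>t. f t * f t) (\<lambda>t. f t * g t + f t * g t)"
    by (rule ac_deriv_mult[OF ac ac]) auto
  have iq0: "set_integrable lborel {0<..} q"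
    unfolding q_def by (intro set_integrable_abs set_integral_add L2_on_mult f g)
  have iq: "set_integrable lborel {1..} q" by (rule set_integrable_subset[OF iq0]) auto
  define T where "T b = (LBINT t:{1..b}. q t)" for b
  define T0 where "T0 = (LBINT t:{1..}. q t)"
  have T: "(T \<longlongrightarrow> T0) at_top"
    unfolding T_def T0_def by (rule tendsto_set_lebesgue_integral_at_top[OF _ iq]) auto
  define N where "N = (LBINT t:{0<..}. (f t)\<^sup>2)"
  have small: "\<exists>y\<ge>x. (f y)\<^sup>2 < e" if x: "x \<ge> 1" and e: "e > 0" for x e
  proof (rule ccontr)
    assume "\<not> ?thesis"
    then have ge: "e \<le> (f y)\<^sup>2" if "y \<ge> x" for y using that by force
    \<comment> \<open>On an interval of this length a function that is at least \<open>e\<close> has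
      integral at least |N| + 1, more than the total \<open>N\<close>.\<close>
    define n where "n = (\<bar>N\<bar> + 1) / e"
    have n: "n \<ge> 0" using e by (simp add: n_def)
    have "e * n = (LBINT t:{x<..x+n}. e)"
      using n by (simp add: set_lebesgue_integral_def)
    also have "\<dots> \<le> (LBINT t:{x<..x+n}. (f t)\<^sup>2)"
    proof (rule set_integral_mono)
      show "set_integrable lborel {x<..x+n} (\<lambda>t. e)" by (rule set_integrable_continuous_Ioc) auto
      show "set_integrable lborel {x<..x+n} (\<lambda>t. (f t)\<^sup>2)"
        by (rule set_integrable_subset[OF L2_onD(2)[OF f]]) (use x in auto)
    qed (use ge in auto)
    also have "\<dots> \<le> N" unfolding N_def
      by (rule set_integral_mono_set[OF L2_onD(2)[OF f]]) (use x in auto)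
    finally show False using e by (simp add: n_def)
  qed
  have f2: "(f x)\<^sup>2 \<le> T0 - T x" if x: "x \<ge> 1" for x
  proof (rule field_le_epsilon)
    fix e :: real assume "e > 0"
    then obtain y where y: "y \<ge> x" "(f y)\<^sup>2 < e" using small x by blast
    have sub: "{x..y} \<subseteq> {0<..}" using x by auto
    have "(f x)\<^sup>2 - (f y)\<^sup>2 \<le> \<bar>LBINT t:{x<..y}. f t * g t + f t * g t\<bar>"
      using ac_derivD(2)[OF acq y(1) sub] by (simp add: power2_eq_square)
    also have "\<dots> \<le> (LBINT t:{x<..y}. q t)"
      unfolding q_def using set_integral_norm_bound[OF ac_derivD(1)[OF acq y(1) sub]] by simp
    also have "(LBINT t:{x<..y}. q t) = (LBINT t:{1<..y}. q t) - (LBINT t:{1<..x}. q t)"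
      using set_integral_Ioc_split[of 1 x y q] x y
      by (simp add: set_integrable_subset[OF iq0] subset_iff)
    also have "\<dots> = T y - T x" by (simp add: T_def set_integral_Ioc_eq_Icc)
    also have "T y \<le> T0"
      unfolding T_def T0_def by (rule set_integral_mono_set[OF iq]) (auto simp: q_def)
    finally show "(f x)\<^sup>2 \<le> T0 - T x + e" using y by simp
  qed
  have "((\<lambda>x. T0 - T x) \<longlongrightarrow> T0 - T0) at_top" by (intro tendsto_intros T)
  then have lim: "((\<lambda>x. T0 - T x) \<longlongrightarrow> 0) at_top" by simp
  have "((\<lambda>x. (f x)\<^sup>2) \<longlongrightarrow> 0) at_top"
    by (rule tendsto_sandwich[OF _ _ tendsto_const lim])
       (use f2 in \<open>auto simp: eventually_at_top_linorder intro!: exI[of _ 1]\<close>)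
  then have "((\<lambda>x. sqrt ((f x)\<^sup>2)) \<longlongrightarrow> sqrt 0) at_top" by (rule tendsto_real_sqrt)
  then show ?thesis by (simp add: tendsto_rabs_zero_iff)
qed

lemma continuous_half_line_attains_sup:
  fixes f :: "real \<Rightarrow> real"
  assumes c: "continuous_on {0..} f" and lim: "(f \<longlongrightarrow> 0) at_top" and nn: "\<And>x. 0 \<le> x \<Longrightarrow> 0 \<le> f x"
  shows "\<exists>p\<ge>0. \<forall>x\<ge>0. f x \<le> f p"
proof (cases "\<exists>z\<ge>0. f z > 0")
  case False
  then have "f x \<le> f 0" if "x \<ge> 0" for x using nn[of 0] that by force
  then show ?thesis by auto
next
  case True
  then obtain z where z: "z \<ge> 0" "f z > 0" by auto
  obtain N where N: "\<And>x. x \<ge> N \<Longrightarrow> f x < f z"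
    using order_tendstoD(2)[OF lim z(2)] unfolding eventually_at_top_linorder by auto
  define M where "M = max N z"
  have "\<exists>p\<in>{0..M}. \<forall>y\<in>{0..M}. f y \<le> f p"
    by (rule continuous_attains_sup) (use z in \<open>auto simp: M_def intro: continuous_on_subset[OF c]\<close>)
  then obtain p where p: "p \<in> {0..M}" "\<And>y. y \<in> {0..M} \<Longrightarrow> f y \<le> f p" by auto
  have "f x \<le> f p" if x: "x \<ge> 0" for x
  proof (cases "x \<le> M")
    case True then show ?thesis using p x by auto
  next
    case False
    then have "f x < f z" using N by (auto simp: M_def)
    also have "f z \<le> f p" using p(2)[of z] z by (auto simp: M_def)
    finally show ?thesis by simp
  qed
  then show ?thesis using p by auto
qed

section \<open>The calibration\<close>

text \<open>The integral of t sqrt ((h^4 - t^4) / 3) over [0, h] is, with s = t^2, a quarter disc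
  area pi h^4 / 4 divided by 2 sqrt 3. Equating it with h^4 m / 6 gives this value of m.\<close>

definition half_line_mass :: real where
  "half_line_mass = sqrt 3 * pi / 4"

lemma half_line_mass_pos: "half_line_mass > 0"
  by (simp add: half_line_mass_def)

text \<open>Since a^2 (h^4 - a^4) = h^4 a^2 - a^6, this is the energy density plus h^4 / 6 times the
  mass density. The coefficient is the smallest one that makes the density nonnegative for every
  value of \<open>f\<close> up to \<open>h\<close>.\<close>

definition calib_density :: "real \<Rightarrow> (real \<Rightarrow> real) \<Rightarrow> (real \<Rightarrow> real) \<Rightarrow> real \<Rightarrow> real" where
  "calib_density h f g t = (g t)\<^sup>2 / 2 + (f t)\<^sup>2 * (h ^ 4 - f t ^ 4) / 6"

lemma calib_density_nonneg:
  assumes "0 \<le> f t" "f t \<le> h"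
  shows "0 \<le> calib_density h f g t"
proof -
  have "f t ^ 4 \<le> h ^ 4" using assms by (intro power_mono) auto
  then show ?thesis unfolding calib_density_def by auto
qed

text \<open>
  With \<open>s = t\<^sup>2\<close> and \<open>k = h\<^sup>2\<close> the integral of the weight \<open>t \<surd>((h\<^sup>4 - t\<^sup>4) / 3)\<close> becomes the area of
  a quarter of a disc.
\<close>

definition calib :: "real \<Rightarrow> real \<Rightarrow> real" where
  "calib h t = (t\<^sup>2 * sqrt (h ^ 4 - t ^ 4) + h ^ 4 * arcsin (t\<^sup>2 / h\<^sup>2)) / (4 * sqrt 3)"

lemma calib_total: "h > 0 \<Longrightarrow> calib h h - calib h 0 = h ^ 4 * half_line_mass / 6"
proof -
  assume "h > 0"
  then have "calib h h - calib h 0 = h ^ 4 * (pi / 2) / (4 * sqrt 3)" by (simp add: calib_def)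
  also have "\<dots> = h ^ 4 * half_line_mass / 6"
    using real_sqrt_mult_self[of 3] by (simp add: half_line_mass_def field_simps)
  finally show ?thesis .
qed

lemma continuous_on_calib:
  assumes h: "h > 0"
  shows "continuous_on {0..h} (calib h)"
proof -
  have "t\<^sup>2 / h\<^sup>2 \<le> 1" "-1 \<le> t\<^sup>2 / h\<^sup>2" if "t \<in> {0..h}" for t
  proof -
    have "t\<^sup>2 \<le> h\<^sup>2" using that by (intro power_mono) auto
    then show "t\<^sup>2 / h\<^sup>2 \<le> 1" using h by simp
    have "0 \<le> t\<^sup>2 / h\<^sup>2" by simp
    then show "-1 \<le> t\<^sup>2 / h\<^sup>2" by linarith
  qed
  then show ?thesis unfolding calib_def using h by (intro continuous_intros) auto
qed

text \<open>\<open>A k s\<close> is twice the area under the circle of radius k between 0 and s. At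
  s = k the root and the arcsine both have infinite slope; these cancel in the sum but are out of
  reach of the differentiation rules, hence the strict bound t < h.\<close>

lemma DERIV_calib:
  assumes t: "0 < t" "t < h"
  shows "(calib h has_real_derivative t * sqrt ((h ^ 4 - t ^ 4) / 3)) (at t)"
proof -
  define A where "A k s = s * sqrt (k\<^sup>2 - s\<^sup>2) + k\<^sup>2 * arcsin (s / k)" for k s :: real
  have A: "(A k has_real_derivative 2 * sqrt (k\<^sup>2 - s\<^sup>2)) (at s)" if "0 < s" "s < k" for k s
  proof -
    have lt: "s\<^sup>2 < k\<^sup>2" using that by (intro power_strict_mono) auto
    define r where "r = sqrt (k\<^sup>2 - s\<^sup>2)"
    have r: "r > 0" "r * r = k\<^sup>2 - s\<^sup>2" using lt by (auto simp: r_def)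
    have "1 - (s / k)\<^sup>2 = (k\<^sup>2 - s\<^sup>2) / k\<^sup>2" using that by (simp add: field_simps power2_eq_square)
    then have sr: "sqrt (1 - (s / k)\<^sup>2) = r / k" using that by (simp add: real_sqrt_divide r_def)
    have sk: "- 1 < s / k" "s / k < 1" using that by (auto simp: field_simps)
    have d1: "(A k has_real_derivative (1 * r + s * (- (2 * s) * (inverse r / 2)) + k\<^sup>2 * (inverse (r / k) * (1 / k)))) (at s)"
      unfolding A_def r_def sr[unfolded r_def, symmetric]
      using lt sk that by (auto intro!: derivative_eq_intros simp: field_simps)
    have d2: "1 * r + s * (- (2 * s) * (inverse r / 2)) + k\<^sup>2 * (inverse (r / k) * (1 / k)) = 2 * r"
    proof -
      have "1 * r + s * (- (2 * s) * (inverse r / 2)) + k\<^sup>2 * (inverse (r / k) * (1 / k)) = r + (k\<^sup>2 - s\<^sup>2) / r"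
        using r that by (simp add: field_simps power2_eq_square)
      also have "\<dots> = r + r" using r by (simp add: r(2)[symmetric])
      finally show ?thesis by simp
    qed
    show ?thesis using d1 unfolding d2 unfolding r_def .
  qed
  have "0 < t\<^sup>2" "t\<^sup>2 < h\<^sup>2" using t by (auto intro: power_strict_mono)
  from A[OF this] have "((\<lambda>t. A (h\<^sup>2) (t\<^sup>2)) has_real_derivative (2 * sqrt ((h\<^sup>2)\<^sup>2 - (t\<^sup>2)\<^sup>2)) * (2 * t)) (at t)"
    by (rule DERIV_chain2) (auto intro!: derivative_eq_intros)
  then have "((\<lambda>t. A (h\<^sup>2) (t\<^sup>2) / (4 * sqrt 3)) has_real_derivative (2 * sqrt ((h\<^sup>2)\<^sup>2 - (t\<^sup>2)\<^sup>2)) * (2 * t) / (4 * sqrt 3)) (at t)"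
    by (rule DERIV_cdivide)
  moreover have "(\<lambda>t. A (h\<^sup>2) (t\<^sup>2) / (4 * sqrt 3)) = calib h"
    by (auto simp: A_def calib_def power_mult[symmetric])
  moreover have "(2 * sqrt ((h\<^sup>2)\<^sup>2 - (t\<^sup>2)\<^sup>2)) * (2 * t) / (4 * sqrt 3) = t * sqrt ((h ^ 4 - t ^ 4) / 3)"
    by (simp add: real_sqrt_divide power_mult[symmetric])
  ultimately show ?thesis by simp
qed

text \<open>With a the weight at \<open>f\<close> and b = \<open>g\<close>, the density equals (a^2
  + b^2) / 2 and the derivative of \<open>calib h\<close> along \<open>f\<close> is a b.\<close>

lemma calib_segment_open:
  assumes ac: "ac_deriv I f g" and I: "open I" and h: "h > 0"
    and ran: "\<And>x. x \<in> I \<Longrightarrow> f x \<in> {0..h}" and iq: "set_integrable lborel I (calib_density h f g)"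
    and xy: "x \<le> y" "{x..y} \<subseteq> I"
  shows "\<bar>calib h (f y) - calib h (f x)\<bar> \<le> (LBINT t:{x<..y}. calib_density h f g t)"
proof -
  let ?p = "\<lambda>s. s * sqrt ((h ^ 4 - s ^ 4) / 3)"
  have c: "ac_deriv I (\<lambda>x. calib h (f x)) (\<lambda>x. ?p (f x) * g x)"
    by (rule ac_deriv_chain_Icc[OF ac I ran continuous_on_calib[OF h] _ DERIV_calib])
       (auto intro!: continuous_intros)
  have "\<bar>calib h (f y) - calib h (f x)\<bar> \<le> (LBINT t:{x<..y}. \<bar>?p (f t) * g t\<bar>)"
    using set_integral_norm_bound[OF ac_derivD(1)[OF c xy]] ac_derivD(2)[OF c xy] by simp
  also have "\<dots> \<le> (LBINT t:{x<..y}. calib_density h f g t)"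
  proof (rule set_integral_mono)
    show "set_integrable lborel {x<..y} (\<lambda>t. \<bar>?p (f t) * g t\<bar>)"
      by (intro set_integrable_abs ac_derivD(1)[OF c xy])
    show "set_integrable lborel {x<..y} (calib_density h f g)"
      by (rule set_integrable_subset[OF iq]) (use xy in auto)
    fix t assume "t \<in> {x<..y}"
    then have ft: "0 \<le> f t" "f t \<le> h" using ran xy by (auto simp: subset_iff)
    have "f t ^ 4 \<le> h ^ 4" using ft by (intro power_mono) auto
    then have p2: "(?p (f t))\<^sup>2 = (f t)\<^sup>2 * (h ^ 4 - f t ^ 4) / 3" by (simp add: power_mult_distrib)
    have "2 * \<bar>a * b\<bar> \<le> a\<^sup>2 + b\<^sup>2" for a b :: real
      using sum_squares_bound[of "\<bar>a\<bar>" "\<bar>b\<bar>"] by (simp add: abs_mult mult.assoc)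
    from this[of "?p (f t)" "g t"] show "\<bar>?p (f t) * g t\<bar> \<le> calib_density h f g t"
      unfolding p2 calib_density_def by simp
  qed
  finally show ?thesis .
qed

lemma calib_segment:
  assumes ac: "ac_deriv I f g" and I: "open I" and h: "h > 0"
    and ran: "\<And>x. x \<in> I \<Longrightarrow> f x \<in> {0..h}" and iq: "set_integrable lborel I (calib_density h f g)"
    and xy: "x \<le> y" "{x<..<y} \<subseteq> I" and c: "continuous_on {x..y} f"
  shows "\<bar>calib h (f y) - calib h (f x)\<bar> \<le> (LBINT t:{x<..<y}. calib_density h f g t)"
proof (cases "x = y")
  case True then show ?thesis by (simp add: set_lebesgue_integral_def)
next
  case False
  then have xy': "x < y" using xy by simp
  have ran': "f t \<in> {0..h}" if "t \<in> {x..y}" for t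
  proof -
    have "f ` closure {x<..<y} \<subseteq> {0..h}"
      by (rule image_closure_subset) (use c xy xy' ran in auto)
    then show ?thesis using that xy' by (auto simp: image_subset_iff)
  qed
  show ?thesis
  proof (rule closure_bound_oscillation[OF xy'])
    show "continuous_on {x..y} (\<lambda>t. calib h (f t))"
      by (rule continuous_on_compose2[OF continuous_on_calib[OF h] c]) (use ran' in auto)
    fix s t assume st: "x < s" "s \<le> t" "t < y"
    have sub: "{s..t} \<subseteq> I" using st xy by auto
    have "\<bar>calib h (f t) - calib h (f s)\<bar> \<le> (LBINT r:{s<..t}. calib_density h f g r)"
      by (rule calib_segment_open[OF ac I h ran iq st(2) sub])
    also have "\<dots> \<le> (LBINT r:{x<..<y}. calib_density h f g r)"
    proof (rule set_integral_mono_set)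
      show "set_integrable lborel {x<..<y} (calib_density h f g)"
        by (rule set_integrable_subset[OF iq]) (use xy in auto)
      show "0 \<le> calib_density h f g r" if "r \<in> {x<..<y}" for r
        by (rule calib_density_nonneg) (use ran xy that in force)+
    qed (use st in auto)
    finally show "\<bar>calib h (f t) - calib h (f s)\<bar> \<le> (LBINT r:{x<..<y}. calib_density h f g r)" .
  qed
qed

text \<open>As \<open>f\<close> tends to 0, the oscillation bound on [p, y] becomes, for y tending
  to infinity, the full drop from \<open>f p\<close> to 0.\<close>

lemma calib_half_line:
  assumes ac: "ac_deriv {0<..} f g" and h: "h > 0"
    and ran: "\<And>x. 0 \<le> x \<Longrightarrow> f x \<in> {0..h}" and iq: "set_integrable lborel {0<..} (calib_density h f g)"
    and p: "0 \<le> p" and c: "continuous_on {0..} f" and lim: "(f \<longlongrightarrow> 0) at_top"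
  shows "calib h (f p) - calib h 0 \<le> (LBINT t:{0<..}. calib_density h f g t)"
proof (rule tendsto_upperbound)
  show "((\<lambda>y. calib h (f p) - calib h (f y)) \<longlongrightarrow> calib h (f p) - calib h 0) at_top"
  proof (intro tendsto_intros)
    show "((\<lambda>y. calib h (f y)) \<longlongrightarrow> calib h 0) at_top"
      by (rule continuous_on_tendsto_compose[OF continuous_on_calib[OF h] lim])
        (use h ran in \<open>auto simp: eventually_at_top_linorder intro!: exI[of _ 0]\<close>)
  qed
  show "\<forall>\<^sub>F y in at_top. calib h (f p) - calib h (f y) \<le> (LBINT t:{0<..}. calib_density h f g t)"
    unfolding eventually_at_top_linorder
  proof (intro exI[of _ p] allI impI)
    fix y assume y: "p \<le> y"
    have "\<bar>calib h (f y) - calib h (f p)\<bar> \<le> (LBINT t:{p<..<y}. calib_density h f g t)"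
    proof (rule calib_segment[OF ac _ h _ iq y _ continuous_on_subset[OF c]])
      show "f x \<in> {0..h}" if "x \<in> {0<..}" for x using ran[of x] that by simp
    qed (use p in auto)
    also have "\<dots> \<le> (LBINT t:{0<..}. calib_density h f g t)"
    proof (rule set_integral_mono_set[OF iq])
      show "0 \<le> calib_density h f g t" if "t \<in> {0<..}" for t
        using calib_density_nonneg[of f t h g] ran[of t] that by auto
    qed (use p in auto)
    finally show "calib h (f p) - calib h (f y) \<le> (LBINT t:{0<..}. calib_density h f g t)" by simp
  qed
qed simp

section \<open>Functions on metric graphs\<close>

context metric_graph
begin

abbreviation er :: "(('v, 'e) graph_point \<Rightarrow> real) \<Rightarrow> 'e \<Rightarrow> real \<Rightarrow> real" where
  "er u e \<equiv> edge_restrict G L u e"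

abbreviation dr :: "(('v, 'e) graph_point \<Rightarrow> real) \<Rightarrow> 'e \<Rightarrow> real \<Rightarrow> real" where
  "dr u e \<equiv> weak_deriv (edge_interior L e) (er u e)"

abbreviation mass :: "(('v, 'e) graph_point \<Rightarrow> real) \<Rightarrow> real" where
  "mass u \<equiv> graph_power_int G L 2 u"

abbreviation pot :: "(('v, 'e) graph_point \<Rightarrow> real) \<Rightarrow> real" where
  "pot u \<equiv> graph_power_int G L 6 u"

abbreviation kin :: "(('v, 'e) graph_point \<Rightarrow> real) \<Rightarrow> real" where
  "kin u \<equiv> graph_deriv_sq_int G L u"

lemma edge_cases:
  assumes "e \<in> arcs G"
  obtains "L e = \<infinity>" "edge_interior L e = {0<..}" "edge_interval L e = {0..}"
  | l where "l > 0" "L e = ereal l" "edge_interior L e = {0<..<l}" "edge_interval L e = {0..l}"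
proof (cases "L e")
  case (real l)
  show ?thesis
    by (rule that(2)[of l])
      (use real length_pos[OF assms] in \<open>auto simp: edge_interior_def edge_interval_def\<close>)
next
  case PInf
  then show ?thesis using that(1) by (auto simp: edge_interior_def edge_interval_def)
next
  case MInf
  then show ?thesis using length_pos[OF assms] by auto
qed

lemma edge_interior_props:
  assumes "e \<in> arcs G"
  shows "open (edge_interior L e)" "is_interval (edge_interior L e)" "edge_interior L e \<in> sets borel"
    "edge_interior L e \<subseteq> edge_interval L e" "closure (edge_interior L e) = edge_interval L e"
  using assms by (cases rule: edge_cases; auto simp: is_interval_1)+

text \<open>Membership in H^1 together with an explicit family of representatives of the derivative,
  one for each edge; sums, products and compositions then have derivatives given by
  formulas.\<close>

definition has_graph_deriv :: "(('v, 'e) graph_point \<Rightarrow> real) \<Rightarrow> ('e \<Rightarrow> real \<Rightarrow> real) \<Rightarrow> bool" where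
  "has_graph_deriv u g \<longleftrightarrow> (\<forall>e\<in>arcs G. continuous_on (edge_interval L e) (er u e) \<and>
     L2_on (edge_interior L e) (er u e) \<and> L2_on (edge_interior L e) (g e) \<and>
     ac_deriv (edge_interior L e) (er u e) (g e))"

lemma has_graph_derivD:
  assumes "has_graph_deriv u g" "e \<in> arcs G"
  shows "continuous_on (edge_interval L e) (er u e)" "L2_on (edge_interior L e) (er u e)"
    "L2_on (edge_interior L e) (g e)" "ac_deriv (edge_interior L e) (er u e) (g e)"
  using assms unfolding has_graph_deriv_def by auto

lemma H1_graph_has_deriv:
  assumes "u \<in> H1_graph G L"
  shows "has_graph_deriv u (dr u)"
  unfolding has_graph_deriv_def
proof
  fix e assume e: "e \<in> arcs G"
  have u: "continuous_on (edge_interval L e) (er u e)" "H1_on (edge_interior L e) (er u e)"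
    using assms e unfolding H1_graph_def by auto
  note I = edge_interior_props[OF e]
  show "continuous_on (edge_interval L e) (er u e) \<and> L2_on (edge_interior L e) (er u e) \<and>
    L2_on (edge_interior L e) (dr u e) \<and> ac_deriv (edge_interior L e) (er u e) (dr u e)"
    using u H1_on_weak_deriv[OF u(2) I(1,2) continuous_on_subset[OF u(1) I(4)]] by simp
qed

lemma has_graph_deriv_H1:
  assumes "has_graph_deriv u g"
  shows "u \<in> H1_graph G L" "kin u = (\<Sum>e\<in>arcs G. LBINT x:edge_interior L e. (g e x)\<^sup>2)"
proof -
  show "u \<in> H1_graph G L"
    unfolding H1_graph_def
    using has_graph_derivD[OF assms] H1_on_ac_deriv(1) edge_interior_props(1,2) by blast
  show "kin u = (\<Sum>e\<in>arcs G. LBINT x:edge_interior L e. (g e x)\<^sup>2)"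
    unfolding graph_deriv_sq_int_def
    using has_graph_derivD[OF assms] edge_interior_props(1,2) by (intro sum.cong HOL.refl H1_on_ac_deriv(2)) blast+
qed

lemma half_line_decay:
  assumes "has_graph_deriv u g" "e \<in> arcs G" "L e = \<infinity>"
  shows "(er u e \<longlongrightarrow> 0) at_top"
proof -
  have "edge_interior L e = {0<..}" using assms(3) by (auto simp: edge_interior_def)
  then show ?thesis
    using has_graph_derivD[OF assms(1,2)] H1_half_line_decay[of "er u e" "g e"] by metis
qed

lemma er_compose: "er (\<lambda>p. F (u p)) e = (\<lambda>x. F (er u e x))"
  by (simp add: edge_restrict_def fun_eq_iff)

lemma er_compose2: "er (\<lambda>p. F (u p) (w p)) e = (\<lambda>x. F (er u e x) (er w e x))"
  by (simp add: edge_restrict_def fun_eq_iff)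

section \<open>Operations on Sobolev functions on the graph\<close>

lemma has_graph_deriv_abs:
  assumes u: "has_graph_deriv u g"
  shows "has_graph_deriv (\<lambda>p. \<bar>u p\<bar>) (\<lambda>e x. sgn (er u e x) * g e x)"
  unfolding has_graph_deriv_def er_compose[of abs]
proof (intro ballI conjI)
  fix e assume e: "e \<in> arcs G"
  note d = has_graph_derivD[OF u e] and I = edge_interior_props[OF e]
  show "continuous_on (edge_interval L e) (\<lambda>x. \<bar>er u e x\<bar>)" by (intro continuous_intros d)
  have sm: "set_borel_measurable lborel (edge_interior L e) (\<lambda>x. sgn (er u e x))"
  proof -
    have "(\<lambda>x. sgn (indicator (edge_interior L e) x *\<^sub>R er u e x)) \<in> borel_measurable lborel"
      using L2_onD(1)[OF d(2)] unfolding set_borel_measurable_def by measurable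
    moreover have "(\<lambda>x. sgn (indicator (edge_interior L e) x *\<^sub>R er u e x)) = (\<lambda>x. indicator (edge_interior L e) x *\<^sub>R sgn (er u e x))"
      by (auto simp: indicator_def)
    ultimately show ?thesis unfolding set_borel_measurable_def by simp
  qed
  have sg: "\<bar>sgn (er u e x)\<bar> \<le> 1" for x by (simp add: sgn_if)
  have "L2_on (edge_interior L e) (\<lambda>x. sgn (er u e x) * er u e x)"
    by (rule L2_on_bounded_mult[OF d(2) sm sg])
  then show "L2_on (edge_interior L e) (\<lambda>x. \<bar>er u e x\<bar>)" by (simp add: abs_sgn mult.commute)
  show "L2_on (edge_interior L e) (\<lambda>x. sgn (er u e x) * g e x)"
    by (rule L2_on_bounded_mult[OF d(3) sm sg])
  show "ac_deriv (edge_interior L e) (\<lambda>x. \<bar>er u e x\<bar>) (\<lambda>x. sgn (er u e x) * g e x)"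
    by (rule ac_deriv_abs[OF d(4) I(1)])
qed

lemma has_graph_deriv_add:
  assumes u: "has_graph_deriv u g" and w: "has_graph_deriv w k"
  shows "has_graph_deriv (\<lambda>p. u p + w p) (\<lambda>e x. g e x + k e x)"
  unfolding has_graph_deriv_def er_compose2[of "(+)"]
  by (intro ballI conjI continuous_intros L2_on_add ac_deriv_add has_graph_derivD[OF u] has_graph_derivD[OF w])

lemma has_graph_deriv_cmult:
  assumes u: "has_graph_deriv u g"
  shows "has_graph_deriv (\<lambda>p. c * u p) (\<lambda>e x. c * g e x)"
  unfolding has_graph_deriv_def er_compose[of "(*) c"]
  by (intro ballI conjI continuous_intros L2_on_cmult ac_deriv_cmult has_graph_derivD[OF u])

text \<open>Each edge is either compact or a half-line along which the function decays, and there
  are finitely many edges. Boundedness is what makes products stay square integrable.\<close>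

lemma has_graph_deriv_bounded:
  assumes u: "has_graph_deriv u g"
  obtains K where "K \<ge> 0" "\<And>e x. e \<in> arcs G \<Longrightarrow> x \<in> edge_interval L e \<Longrightarrow> \<bar>er u e x\<bar> \<le> K"
proof -
  have "\<exists>K. \<forall>x\<in>edge_interval L e. \<bar>er u e x\<bar> \<le> K" if e: "e \<in> arcs G" for e
    using e
  proof (cases rule: edge_cases)
    case 1
    have c: "continuous_on {0..} (\<lambda>x. \<bar>er u e x\<bar>)"
      using has_graph_derivD(1)[OF u e] 1 by (auto intro: continuous_intros)
    have "((\<lambda>x. \<bar>er u e x\<bar>) \<longlongrightarrow> 0) at_top"
      using half_line_decay[OF u e 1(1)] tendsto_rabs_zero by blast
    then show ?thesis using continuous_half_line_attains_sup[OF c] 1(3) by (metis abs_ge_zero atLeast_iff)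
  next
    case (2 l)
    then have "compact (er u e ` {0..l})"
      using has_graph_derivD(1)[OF u e] by (auto intro: compact_continuous_image)
    then have "bounded (er u e ` {0..l})" by (rule compact_imp_bounded)
    then obtain K where "\<And>y. y \<in> er u e ` {0..l} \<Longrightarrow> norm y \<le> K" unfolding bounded_iff by auto
    then show ?thesis using 2(4) by (intro exI[of _ K]) auto
  qed
  then obtain K where K: "\<And>e x. e \<in> arcs G \<Longrightarrow> x \<in> edge_interval L e \<Longrightarrow> \<bar>er u e x\<bar> \<le> K e" by metis
  show thesis
  proof (rule that[of "\<Sum>e\<in>arcs G. \<bar>K e\<bar>"])
    show "0 \<le> (\<Sum>e\<in>arcs G. \<bar>K e\<bar>)" by (simp add: sum_nonneg)
    fix e x assume ex: "e \<in> arcs G" "x \<in> edge_interval L e"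
    have "\<bar>er u e x\<bar> \<le> \<bar>K e\<bar>" using K[OF ex] by linarith
    also have "\<dots> \<le> (\<Sum>e\<in>arcs G. \<bar>K e\<bar>)" using ex by (intro member_le_sum) auto
    finally show "\<bar>er u e x\<bar> \<le> (\<Sum>e\<in>arcs G. \<bar>K e\<bar>)" .
  qed
qed

lemma has_graph_deriv_mult:
  assumes u: "has_graph_deriv u g" and w: "has_graph_deriv w k"
  shows "has_graph_deriv (\<lambda>p. u p * w p) (\<lambda>e x. er u e x * k e x + er w e x * g e x)"
  unfolding has_graph_deriv_def er_compose2[of "(*)"]
proof (intro ballI conjI)
  fix e assume e: "e \<in> arcs G"
  note du = has_graph_derivD[OF u e] and dw = has_graph_derivD[OF w e] and I = edge_interior_props[OF e]
  obtain K where K: "\<And>e x. e \<in> arcs G \<Longrightarrow> x \<in> edge_interval L e \<Longrightarrow> \<bar>er u e x\<bar> \<le> K"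
    using has_graph_deriv_bounded[OF u] by metis
  obtain K' where K': "\<And>e x. e \<in> arcs G \<Longrightarrow> x \<in> edge_interval L e \<Longrightarrow> \<bar>er w e x\<bar> \<le> K'"
    using has_graph_deriv_bounded[OF w] by metis
  show "continuous_on (edge_interval L e) (\<lambda>x. er u e x * er w e x)" by (intro continuous_intros du dw)
  show "L2_on (edge_interior L e) (\<lambda>x. er u e x * er w e x)"
    by (rule L2_on_bounded_mult[OF dw(2) L2_onD(1)[OF du(2)], of K]) (use K e I in auto)
  show "L2_on (edge_interior L e) (\<lambda>x. er u e x * k e x + er w e x * g e x)"
  proof (rule L2_on_add)
    show "L2_on (edge_interior L e) (\<lambda>x. er u e x * k e x)"
      by (rule L2_on_bounded_mult[OF dw(3) L2_onD(1)[OF du(2)], of K]) (use K e I in auto)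
    show "L2_on (edge_interior L e) (\<lambda>x. er w e x * g e x)"
      by (rule L2_on_bounded_mult[OF du(3) L2_onD(1)[OF dw(2)], of K']) (use K' e I in auto)
  qed
  show "ac_deriv (edge_interior L e) (\<lambda>x. er u e x * er w e x) (\<lambda>x. er u e x * k e x + er w e x * g e x)"
    by (rule ac_deriv_mult[OF du(4) dw(4) I(1)])
qed

text \<open>On half-lines \<open>F\<close> of a decaying function need not be square integrable; the
  factor \<open>u\<close> supplies the integrability. The intended case is F t = 1 / (t +
  \<open>\<epsilon>\<close>) on \<open>{0..}\<close>.\<close>

lemma has_graph_deriv_mult_compose:
  assumes u: "has_graph_deriv u g" and w: "has_graph_deriv w k"
    and T: "is_interval T" "\<And>e x. e \<in> arcs G \<Longrightarrow> x \<in> edge_interval L e \<Longrightarrow> er w e x \<in> T"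
    and F: "\<And>t. t \<in> T \<Longrightarrow> (F has_real_derivative F' t) (at t)" "continuous_on T F'"
    and B: "\<And>t. t \<in> T \<Longrightarrow> \<bar>F t\<bar> \<le> B" "\<And>t. t \<in> T \<Longrightarrow> \<bar>F' t\<bar> \<le> B"
  shows "has_graph_deriv (\<lambda>p. u p * F (w p))
     (\<lambda>e x. er u e x * (F' (er w e x) * k e x) + F (er w e x) * g e x)"
  unfolding has_graph_deriv_def er_compose2[of "\<lambda>a b. a * F b"]
proof (intro ballI conjI)
  fix e assume e: "e \<in> arcs G"
  note du = has_graph_derivD[OF u e] and dw = has_graph_derivD[OF w e] and I = edge_interior_props[OF e]
  obtain K where K: "K \<ge> 0" "\<And>e x. e \<in> arcs G \<Longrightarrow> x \<in> edge_interval L e \<Longrightarrow> \<bar>er u e x\<bar> \<le> K"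
    using has_graph_deriv_bounded[OF u] by metis
  have cF: "continuous_on T F"
    by (rule DERIV_continuous_on) (rule has_field_derivative_at_within[OF F(1)])
  have c1: "continuous_on (edge_interval L e) (\<lambda>x. F (er w e x))"
    by (rule continuous_on_compose2[OF cF dw(1)]) (use T e in auto)
  have c2: "continuous_on (edge_interval L e) (\<lambda>x. F' (er w e x))"
    by (rule continuous_on_compose2[OF F(2) dw(1)]) (use T e in auto)
  have Jb: "edge_interval L e \<in> sets borel" using I(5) closed_closure by (metis borel_closed)
  have m1: "set_borel_measurable lborel (edge_interior L e) (\<lambda>x. F (er w e x))"
    by (rule set_borel_measurable_continuous_on[OF c1 Jb I(3,4)])
  have m2: "set_borel_measurable lborel (edge_interior L e) (\<lambda>x. F' (er w e x))"
    by (rule set_borel_measurable_continuous_on[OF c2 Jb I(3,4)])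
  have inT: "er w e x \<in> T" if "x \<in> edge_interior L e" for x using T(2) e I(4) that by auto
  show "continuous_on (edge_interval L e) (\<lambda>x. er u e x * F (er w e x))"
    by (intro continuous_intros du c1)
  have "L2_on (edge_interior L e) (\<lambda>x. F (er w e x) * er u e x)"
    by (rule L2_on_bounded_mult[OF du(2) m1 B(1)[OF inT]])
  then show "L2_on (edge_interior L e) (\<lambda>x. er u e x * F (er w e x))" by (simp add: mult.commute)
  show "L2_on (edge_interior L e) (\<lambda>x. er u e x * (F' (er w e x) * k e x) + F (er w e x) * g e x)"
  proof (rule L2_on_add)
    have "L2_on (edge_interior L e) (\<lambda>x. F' (er w e x) * k e x)"
      by (rule L2_on_bounded_mult[OF dw(3) m2 B(2)[OF inT]])
    then show "L2_on (edge_interior L e) (\<lambda>x. er u e x * (F' (er w e x) * k e x))"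
      by (rule L2_on_bounded_mult[OF _ L2_onD(1)[OF du(2)], of _ K]) (use K e I in auto)
    show "L2_on (edge_interior L e) (\<lambda>x. F (er w e x) * g e x)"
      by (rule L2_on_bounded_mult[OF du(3) m1 B(1)[OF inT]])
  qed
  show "ac_deriv (edge_interior L e) (\<lambda>x. er u e x * F (er w e x))
     (\<lambda>x. er u e x * (F' (er w e x) * k e x) + F (er w e x) * g e x)"
    by (rule ac_deriv_mult[OF du(4) ac_deriv_chain[OF dw(4) I(1) T(1) inT F] I(1)])
qed

subsection \<open>Mass, kinetic and potential terms\<close>

lemma mass_eq: "mass u = (\<Sum>e\<in>arcs G. LBINT x:edge_interior L e. (er u e x)\<^sup>2)"
  by (simp add: graph_power_int_def)

lemma pot_eq: "pot u = (\<Sum>e\<in>arcs G. LBINT x:edge_interior L e. er u e x ^ 6)"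
  by (simp add: graph_power_int_def power_even_abs)

lemma mass_nonneg: "mass u \<ge> 0" and pot_nonneg: "pot u \<ge> 0" and kin_nonneg: "kin u \<ge> 0"
  unfolding graph_power_int_def graph_deriv_sq_int_def
  by (intro sum_nonneg set_integral_nonneg_real; simp)+

lemma L2_on_power_mult:
  assumes u: "has_graph_deriv u g" and e: "e \<in> arcs G" and w: "L2_on (edge_interior L e) w"
  shows "L2_on (edge_interior L e) (\<lambda>x. er u e x ^ n * w x)"
proof (induction n)
  case 0 then show ?case using w by simp
next
  case (Suc n)
  obtain K where K: "\<And>e x. e \<in> arcs G \<Longrightarrow> x \<in> edge_interval L e \<Longrightarrow> \<bar>er u e x\<bar> \<le> K"
    using has_graph_deriv_bounded[OF u] by metis
  have "L2_on (edge_interior L e) (\<lambda>x. er u e x * (er u e x ^ n * w x))"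
    by (rule L2_on_bounded_mult[OF Suc L2_onD(1)[OF has_graph_derivD(2)[OF u e]], of K])
       (use K e edge_interior_props(4)[OF e] in auto)
  then show ?case by (simp add: mult.assoc)
qed

lemma power6_integrable:
  assumes u: "has_graph_deriv u g" and e: "e \<in> arcs G"
  shows "set_integrable lborel (edge_interior L e) (\<lambda>x. er u e x ^ 6)"
proof -
  have "set_integrable lborel (edge_interior L e) (\<lambda>x. (er u e x ^ 2 * er u e x) * (er u e x ^ 2 * er u e x))"
    by (intro L2_on_mult L2_on_power_mult[OF u e] has_graph_derivD(2)[OF u e])
  then show ?thesis by (simp add: eval_nat_numeral mult_ac)
qed

lemma power5_mult_integrable:
  assumes u: "has_graph_deriv u g" and w: "has_graph_deriv w k" and e: "e \<in> arcs G"
  shows "set_integrable lborel (edge_interior L e) (\<lambda>x. er u e x ^ 5 * er w e x)"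
proof -
  have "set_integrable lborel (edge_interior L e) (\<lambda>x. (er u e x ^ 4 * er u e x) * er w e x)"
    by (intro L2_on_mult L2_on_power_mult[OF u e] has_graph_derivD(2)[OF u e] has_graph_derivD(2)[OF w e])
  then show ?thesis by (simp add: eval_nat_numeral mult_ac)
qed

lemma kin_abs_le:
  assumes u: "has_graph_deriv u g"
  shows "kin (\<lambda>p. \<bar>u p\<bar>) \<le> kin u" "mass (\<lambda>p. \<bar>u p\<bar>) = mass u" "pot (\<lambda>p. \<bar>u p\<bar>) = pot u"
proof -
  show "mass (\<lambda>p. \<bar>u p\<bar>) = mass u" "pot (\<lambda>p. \<bar>u p\<bar>) = pot u"
    by (simp_all add: graph_power_int_def er_compose[of abs])
  note a = has_graph_deriv_abs[OF u]
  show "kin (\<lambda>p. \<bar>u p\<bar>) \<le> kin u"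
    unfolding has_graph_deriv_H1(2)[OF u] has_graph_deriv_H1(2)[OF a]
  proof (intro sum_mono set_integral_mono)
    fix e assume e: "e \<in> arcs G"
    show "set_integrable lborel (edge_interior L e) (\<lambda>x. (sgn (er u e x) * g e x)\<^sup>2)"
      using L2_onD(2)[OF has_graph_derivD(3)[OF a e]] .
    show "set_integrable lborel (edge_interior L e) (\<lambda>x. (g e x)\<^sup>2)"
      using L2_onD(2)[OF has_graph_derivD(3)[OF u e]] .
    fix x show "(sgn (er u e x) * g e x)\<^sup>2 \<le> (g e x)\<^sup>2"
      by (simp add: power_mult_distrib sgn_if)
  qed
qed

lemma scale_functionals:
  assumes u: "has_graph_deriv u g"
  shows "mass (\<lambda>p. c * u p) = c\<^sup>2 * mass u" "pot (\<lambda>p. c * u p) = c ^ 6 * pot u"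
    "kin (\<lambda>p. c * u p) = c\<^sup>2 * kin u"
  unfolding has_graph_deriv_H1(2)[OF u] has_graph_deriv_H1(2)[OF has_graph_deriv_cmult[OF u]]
    mass_eq pot_eq er_compose[of "(*) c"] power_mult_distrib
  by (simp_all add: sum_distrib_left)

section \<open>Expansion of the functionals under perturbations\<close>

definition mass_form :: "(('v, 'e) graph_point \<Rightarrow> real) \<Rightarrow> (('v, 'e) graph_point \<Rightarrow> real) \<Rightarrow> real" where
  "mass_form u w = (\<Sum>e\<in>arcs G. LBINT x:edge_interior L e. er u e x * er w e x)"

definition pot_form :: "(('v, 'e) graph_point \<Rightarrow> real) \<Rightarrow> (('v, 'e) graph_point \<Rightarrow> real) \<Rightarrow> real" where
  "pot_form u w = (\<Sum>e\<in>arcs G. LBINT x:edge_interior L e. er u e x ^ 5 * er w e x)"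

text \<open>The arguments are families of derivatives rather than functions, so that no choice of
  representative is hidden in the form.\<close>

definition kin_form :: "('e \<Rightarrow> real \<Rightarrow> real) \<Rightarrow> ('e \<Rightarrow> real \<Rightarrow> real) \<Rightarrow> real" where
  "kin_form g k = (\<Sum>e\<in>arcs G. LBINT x:edge_interior L e. g e x * k e x)"

lemma set_integral_square_expand:
  assumes f: "L2_on I f" and h: "L2_on I h"
  shows "(LBINT x:I. (f x + c * h x)\<^sup>2) =
    (LBINT x:I. (f x)\<^sup>2) + 2 * c * (LBINT x:I. f x * h x) + c\<^sup>2 * (LBINT x:I. (h x)\<^sup>2)"
proof -
  have "(LBINT x:I. (f x + c * h x)\<^sup>2) = (LBINT x:I. ((f x)\<^sup>2 + 2 * c * (f x * h x)) + c\<^sup>2 * (h x)\<^sup>2)"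
    by (simp add: power2_sum power_mult_distrib mult_ac add_ac)
  also have "\<dots> = (LBINT x:I. (f x)\<^sup>2) + 2 * c * (LBINT x:I. f x * h x) + c\<^sup>2 * (LBINT x:I. (h x)\<^sup>2)"
    using L2_onD(2)[OF f] L2_onD(2)[OF h] L2_on_mult[OF f h] by (simp add: set_integral_add)
  finally show ?thesis .
qed

lemma mass_perturb:
  assumes u: "has_graph_deriv u g" and w: "has_graph_deriv w k"
  shows "mass (\<lambda>p. u p + c * w p) = mass u + 2 * c * mass_form u w + c\<^sup>2 * mass w"
  unfolding mass_eq mass_form_def er_compose2[of "\<lambda>a b. a + c * b"]
  by (simp add: set_integral_square_expand has_graph_derivD(2)[OF u] has_graph_derivD(2)[OF w]
      sum.distrib sum_distrib_left)

lemma kin_perturb: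
  assumes u: "has_graph_deriv u g" and w: "has_graph_deriv w k"
  shows "kin (\<lambda>p. u p + c * w p) = kin u + 2 * c * kin_form g k + c\<^sup>2 * kin w"
  unfolding has_graph_deriv_H1(2)[OF u] has_graph_deriv_H1(2)[OF w] kin_form_def
    has_graph_deriv_H1(2)[OF has_graph_deriv_add[OF u has_graph_deriv_cmult[OF w]]]
  by (simp add: set_integral_square_expand has_graph_derivD(3)[OF u] has_graph_derivD(3)[OF w]
      sum.distrib sum_distrib_left)

text \<open>Convexity of the sixth power with an explicit remainder: (x - a)^2 times x^4 + 2 x^3 a +
  3 x^2 a^2 + 4 x a^3 + 5 a^4, the latter written as a sum of squares.\<close>

lemma power6_tangent: "(a::real) ^ 6 + 6 * a ^ 5 * d \<le> (a + d) ^ 6"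
proof -
  define x where "x = a + d"
  have d: "d = x - a" by (simp add: x_def)
  have "x ^ 6 - (a ^ 6 + 6 * a ^ 5 * d) = (x - a)\<^sup>2 * ((x\<^sup>2 + x * a)\<^sup>2 + 2 * (x * a + a\<^sup>2)\<^sup>2 + 3 * (a\<^sup>2)\<^sup>2)"
    unfolding d by algebra
  also have "\<dots> \<ge> 0" by (intro mult_nonneg_nonneg add_nonneg_nonneg) auto
  finally show ?thesis by (simp add: x_def)
qed

lemma pot_perturb:
  assumes u: "has_graph_deriv u g" and w: "has_graph_deriv w k"
  shows "pot u + 6 * c * pot_form u w \<le> pot (\<lambda>p. u p + c * w p)"
proof -
  note uw = has_graph_deriv_add[OF u has_graph_deriv_cmult[OF w, of c]]
  have "pot u + 6 * c * pot_form u w =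
     (\<Sum>e\<in>arcs G. LBINT x:edge_interior L e. er u e x ^ 6 + (6 * c) * (er u e x ^ 5 * er w e x))"
    using power6_integrable[OF u] power5_mult_integrable[OF u w]
    by (simp add: pot_eq pot_form_def set_integral_add sum.distrib sum_distrib_left)
  also have "\<dots> \<le> pot (\<lambda>p. u p + c * w p)"
    unfolding pot_eq
  proof (intro sum_mono set_integral_mono)
    fix e assume e: "e \<in> arcs G"
    show "set_integrable lborel (edge_interior L e) (\<lambda>x. er u e x ^ 6 + (6 * c) * (er u e x ^ 5 * er w e x))"
      using power6_integrable[OF u e] power5_mult_integrable[OF u w e] by (intro set_integral_add) auto
    show "set_integrable lborel (edge_interior L e) (\<lambda>x. er (\<lambda>p. u p + c * w p) e x ^ 6)"
      by (rule power6_integrable[OF uw e])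
    fix x show "er u e x ^ 6 + (6 * c) * (er u e x ^ 5 * er w e x) \<le> er (\<lambda>p. u p + c * w p) e x ^ 6"
      using power6_tangent[of "er u e x" "c * er w e x"] by (simp add: er_compose2[of "\<lambda>a b. a + c * b"] mult_ac)
  qed
  finally show ?thesis .
qed

end

section \<open>Connectedness\<close>

text \<open>Connectedness is stated as a cut condition: applications only have to exhibit a set of
  vertices closed under arcs, and the condition passes to the graph without a half-line without any
  handling of walks.\<close>

locale noncompact_graph = metric_graph +
  assumes conn: "\<lbrakk>S \<subseteq> verts G; S \<noteq> {}; \<And>e. e \<in> arcs G \<Longrightarrow> tail G e \<in> S \<longleftrightarrow> head G e \<in> S\<rbrakk> \<Longrightarrow> S = verts G"
    and half_line_exists: "half_lines G L \<noteq> {}"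

lemma noncompact_graphI:
  assumes "metric_graph G L" "Digraph_Component.connected G" "noncompact G L"
  shows "noncompact_graph G L"
proof -
  interpret metric_graph G L by fact
  show ?thesis
  proof
    show "half_lines G L \<noteq> {}" using assms(3) unfolding noncompact_def .
    fix S assume S: "S \<subseteq> verts G" "S \<noteq> {}" "\<And>e. e \<in> arcs G \<Longrightarrow> tail G e \<in> S \<longleftrightarrow> head G e \<in> S"
    obtain s where s: "s \<in> S" using S by auto
    have "w \<in> S" if w: "w \<in> verts G" for w
    proof -
      have "s \<rightarrow>\<^sup>*\<^bsub>with_proj (mk_symmetric G)\<^esub> w"
        using assms(2) s w S(1) unfolding Digraph_Component.connected_def strongly_connected_def by auto
      then have "(s, w) \<in> (arcs_ends (with_proj (mk_symmetric G)))\<^sup>*"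
        unfolding reachable_def by (rule rtrancl_on_rtranclI)
      then show "w \<in> S"
      proof (induction rule: rtrancl_induct)
        case base then show ?case using s .
      next
        case (step y z)
        then have "(y, z) \<in> parcs (mk_symmetric G)" by (auto simp: arcs_ends_def arc_to_ends_def)
        then show ?case using step.IH S(3) by (auto simp: parcs_mk_symmetric)
      qed
    qed
    then show "S = verts G" using S(1) by auto
  qed
qed

lemma remove_half_line_simps:
  assumes "metric_graph G L" "l \<in> half_lines G L"
  shows "arcs (remove_half_line G l) = arcs G - {l}" "verts (remove_half_line G l) = verts G - {head G l}"
    "tail (remove_half_line G l) = tail G" "head (remove_half_line G l) = head G"
proof -
  interpret metric_graph G L by fact
  have l: "l \<in> arcs G" "L l = \<infinity>" using assms(2) by (auto simp: half_lines_def)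
  show "arcs (remove_half_line G l) = arcs G - {l}"
    unfolding remove_half_line_def
    using infinity_not_tail[OF l] infinity_head_unique[OF l]
    by (auto simp: pre_digraph.del_arc_def pre_digraph.del_vert_def)
  show "verts (remove_half_line G l) = verts G - {head G l}"
    "tail (remove_half_line G l) = tail G" "head (remove_half_line G l) = head G"
    unfolding remove_half_line_def by (simp_all add: pre_digraph.del_vert_def pre_digraph.del_arc_def)
qed

text \<open>A set closed under the arcs of the smaller graph becomes closed in \<open>G\<close> by
  adding the vertex at infinity of \<open>l\<close> exactly when it contains the start of
  \<open>l\<close>. The second half-line \<open>l'\<close> keeps the graph non-compact.\<close>

lemma noncompact_graph_remove_half_line:
  assumes "noncompact_graph G L" "l \<in> half_lines G L" "l' \<in> half_lines G L" "l' \<noteq> l"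
  shows "noncompact_graph (remove_half_line G l) L"
proof -
  interpret noncompact_graph G L by fact
  note s = remove_half_line_simps[OF metric_graph_axioms assms(2)]
  have l: "l \<in> arcs G" "L l = \<infinity>" using assms(2) by (auto simp: half_lines_def)
  have ne: "tail G e \<noteq> head G l" "head G e = head G l \<Longrightarrow> e = l" if "e \<in> arcs G" for e
    using infinity_not_tail[OF l that] infinity_head_unique[OF l that] by auto
  show ?thesis
  proof (unfold_locales, unfold s)
    show "tail G e \<in> verts G - {head G l}" if "e \<in> arcs G - {l}" for e using that ne by auto
    show "head G e \<in> verts G - {head G l}" if "e \<in> arcs G - {l}" for e using that ne by auto
    show "0 < L e" if "e \<in> arcs G - {l}" for e using that length_pos by auto
    show "tail G e' \<noteq> head G e" if "e \<in> arcs G - {l}" "L e = \<infinity>" "e' \<in> arcs G - {l}" for e e'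
      using that infinity_not_tail by auto
    show "e' = e" if "e \<in> arcs G - {l}" "L e = \<infinity>" "e' \<in> arcs G - {l}" "head G e' = head G e" for e e'
      using that infinity_head_unique by auto
    show "half_lines (remove_half_line G l) L \<noteq> {}"
      using assms(3,4) by (auto simp: half_lines_def s)
    fix S assume S: "S \<subseteq> verts G - {head G l}" "S \<noteq> {}"
      and cl: "\<And>e. e \<in> arcs G - {l} \<Longrightarrow> (tail G e \<in> S) = (head G e \<in> S)"
    define S' where "S' = (if tail G l \<in> S then insert (head G l) S else S)"
    have "S' = verts G"
    proof (rule conn)
      show "S' \<subseteq> verts G" "S' \<noteq> {}" using S l by (auto simp: S'_def)
      show "(tail G e \<in> S') = (head G e \<in> S')" if "e \<in> arcs G" for e
        using that cl[of e] ne[of e] S by (cases "e = l") (auto simp: S'_def)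
    qed
    then show "S = verts G - {head G l}" using S l unfolding S'_def by (auto split: if_splits)
  qed auto
qed

context noncompact_graph
begin

definition bounded_arcs :: "'b set" where
  "bounded_arcs = arcs G - half_lines G L"

definition core :: "'a set" where
  "core = verts G - head G ` half_lines G L"

definition adj :: "('a \<times> 'a) set" where
  "adj = {(a, b). \<exists>e\<in>bounded_arcs. tail G e = a \<and> head G e = b \<or> tail G e = b \<and> head G e = a}"

lemma tail_core: "e \<in> arcs G \<Longrightarrow> tail G e \<in> core"
  using infinity_not_tail by (auto simp: core_def half_lines_def)

lemma head_core: "e \<in> bounded_arcs \<Longrightarrow> head G e \<in> core"
  using infinity_head_unique by (fastforce simp: core_def half_lines_def bounded_arcs_def)

lemma bounded_arcsD: "e \<in> bounded_arcs \<Longrightarrow> e \<in> arcs G" by (simp add: bounded_arcs_def)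

text \<open>Half-lines are dead ends for walks. For the cut condition, the set of finite vertices
  reachable through bounded arcs is completed by the infinite ends of the half-lines starting there;
  a vertex at infinity meets no other arc, so this set is closed.\<close>

lemma core_reachable:
  assumes v: "v \<in> core" and w: "w \<in> core"
  shows "(v, w) \<in> adj\<^sup>*"
proof -
  have rc: "(v, w) \<in> adj\<^sup>* \<Longrightarrow> w \<in> core" for w
    by (induction rule: rtrancl_induct) (use v tail_core head_core bounded_arcsD in \<open>auto simp: adj_def\<close>)
  define S where "S = {w. (v, w) \<in> adj\<^sup>*} \<union> {head G e | e. e \<in> half_lines G L \<and> (v, tail G e) \<in> adj\<^sup>*}"
  have "S = verts G"
  proof (rule conn)
    show "S \<subseteq> verts G" using rc by (auto simp: S_def core_def half_lines_def)
    show "S \<noteq> {}" by (auto simp: S_def)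
    fix e assume e: "e \<in> arcs G"
    have t: "tail G e \<in> S \<longleftrightarrow> (v, tail G e) \<in> adj\<^sup>*"
      using infinity_not_tail[OF _ _ e] by (auto simp: S_def half_lines_def)
    show "tail G e \<in> S \<longleftrightarrow> head G e \<in> S"
    proof (cases "e \<in> half_lines G L")
      case True
      then have "head G e \<notin> core" by (auto simp: core_def)
      then have "head G e \<in> S \<longleftrightarrow> (\<exists>e'. head G e = head G e' \<and> e' \<in> half_lines G L \<and> (v, tail G e') \<in> adj\<^sup>*)"
        using rc by (auto simp: S_def)
      also have "\<dots> \<longleftrightarrow> (v, tail G e) \<in> adj\<^sup>*"
        using True infinity_head_unique[of e] by (auto simp: half_lines_def)
      finally show ?thesis using t by simp
    next
      case False
      then have b: "e \<in> bounded_arcs" using e by (simp add: bounded_arcs_def)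
      then have "(tail G e, head G e) \<in> adj" "(head G e, tail G e) \<in> adj" by (auto simp: adj_def)
      then have 1: "(v, tail G e) \<in> adj\<^sup>* \<longleftrightarrow> (v, head G e) \<in> adj\<^sup>*"
        by (meson rtrancl.rtrancl_into_rtrancl)
      have "head G e \<in> S \<longleftrightarrow> (v, head G e) \<in> adj\<^sup>*"
        using head_core[OF b] by (auto simp: S_def core_def)
      then show ?thesis using t 1 by simp
    qed
  qed
  then have "w \<in> S" using w by (auto simp: core_def)
  then show ?thesis using w by (auto simp: S_def core_def)
qed

section \<open>Shortest paths through bounded arcs\<close>

definition level :: "'a \<Rightarrow> 'a \<Rightarrow> nat" where
  "level v w = (LEAST n. (v, w) \<in> adj ^^ n)"

definition arc_level :: "'a \<Rightarrow> 'b \<Rightarrow> nat" where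
  "arc_level v e = max (level v (tail G e)) (level v (head G e))"

lemma level_path:
  assumes "v \<in> core" "w \<in> core"
  shows "(v, w) \<in> adj ^^ level v w"
proof -
  obtain n where "(v, w) \<in> adj ^^ n" using core_reachable[OF assms] rtrancl_imp_relpow by blast
  then show ?thesis unfolding level_def by (rule LeastI)
qed

lemma level_le: "(v, w) \<in> adj ^^ n \<Longrightarrow> level v w \<le> n"
  unfolding level_def by (rule Least_le)

lemma level_adj:
  assumes "v \<in> core" "w \<in> core" "(w, w') \<in> adj"
  shows "level v w' \<le> Suc (level v w)"
  using level_path[OF assms(1,2)] assms(3) by (intro level_le) auto

text \<open>
  A shortest path from \<open>v\<close> to \<open>w\<close> uses one arc between consecutive levels, so its arcs are distinct
  and at most one of them is incident with \<open>v\<close>.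
\<close>

lemma shortest_path_arcs:
  assumes v: "v \<in> core" and w: "w \<in> core"
  shows "\<exists>F \<subseteq> bounded_arcs.
     (\<forall>(\<psi> :: 'a \<Rightarrow> real) c. (\<forall>e\<in>bounded_arcs. \<bar>\<psi> (head G e) - \<psi> (tail G e)\<bar> \<le> c e) \<longrightarrow> \<bar>\<psi> w - \<psi> v\<bar> \<le> sum c F) \<and>
     (\<forall>e\<in>F. level v (tail G e) \<noteq> level v (head G e) \<and> arc_level v e \<le> level v w) \<and>
     inj_on (arc_level v) F"
  using w
proof (induction "level v w" arbitrary: w)
  case 0
  then have "v = w" using level_path[OF v, of w] by simp
  then show ?case by (intro exI[of _ "{}"]) auto
next
  case (Suc n)
  from Suc(2) have lw: "level v w = Suc n" by simp
  then obtain w' where w': "(v, w') \<in> adj ^^ n" "(w', w) \<in> adj"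
    using level_path[OF v Suc(3)] by auto
  have w'c: "w' \<in> core"
    using w'(2) tail_core head_core bounded_arcsD by (auto simp: adj_def)
  have lw': "level v w' = n"
    using level_le[OF w'(1)] level_adj[OF v w'c w'(2)] lw by simp
  obtain F where F: "F \<subseteq> bounded_arcs"
    "\<And>(\<psi> :: 'a \<Rightarrow> real) c. (\<forall>e\<in>bounded_arcs. \<bar>\<psi> (head G e) - \<psi> (tail G e)\<bar> \<le> c e) \<Longrightarrow> \<bar>\<psi> w' - \<psi> v\<bar> \<le> sum c F"
    "\<And>e. e \<in> F \<Longrightarrow> level v (tail G e) \<noteq> level v (head G e) \<and> arc_level v e \<le> n" "inj_on (arc_level v) F"
    using Suc(1)[of w'] lw' w'c by metis
  obtain e where e: "e \<in> bounded_arcs" "tail G e = w' \<and> head G e = w \<or> tail G e = w \<and> head G e = w'"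
    using w'(2) by (auto simp: adj_def)
  \<comment> \<open>The last arc climbs to level n + 1 while the earlier ones stay at levels up to
    n; this gives both \<open>e \<notin> F\<close> and injectivity.\<close>
  have le: "arc_level v e = Suc n" using e(2) lw lw' by (auto simp: arc_level_def)
  have eF: "e \<notin> F" using F(3)[of e] le by auto
  have fF: "finite F" using F(1) finite_subset[of F "arcs G"] by (auto simp: bounded_arcs_def)
  show ?case
  proof (intro exI[of _ "insert e F"] conjI allI impI ballI)
    show "insert e F \<subseteq> bounded_arcs" using e F by auto
    fix \<psi> :: "'a \<Rightarrow> real" and c assume c: "\<forall>e\<in>bounded_arcs. \<bar>\<psi> (head G e) - \<psi> (tail G e)\<bar> \<le> c e"
    have "\<bar>\<psi> w - \<psi> w'\<bar> \<le> c e" using c e by (auto simp: abs_minus_commute dest!: bspec[of _ _ e])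
    then show "\<bar>\<psi> w - \<psi> v\<bar> \<le> sum c (insert e F)" using F(2)[OF c] eF fF by simp
  next
    fix f assume "f \<in> insert e F"
    moreover have "level v (tail G e) \<noteq> level v (head G e)" "arc_level v e \<le> level v w"
      using le lw lw' e(2) by (elim disjE conjE; simp)+
    moreover have "arc_level v f \<le> level v w" if "f \<in> F" using F(3)[OF that] lw by simp
    ultimately show "level v (tail G f) \<noteq> level v (head G f)" "arc_level v f \<le> level v w"
      using F(3) by blast+
  next
    show "inj_on (arc_level v) (insert e F)"
      using F(3,4) le by (fastforce simp: inj_on_insert)
  qed
qed

text \<open>At least two ends of bounded arcs meet at \<open>v\<close>, a loop counting twice. A
  shortest path from \<open>v\<close> uses at most one of them.\<close>

definition spare :: "'a \<Rightarrow> bool" where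
  "spare v \<longleftrightarrow> (\<exists>e\<in>bounded_arcs. \<exists>f\<in>bounded_arcs. (tail G e = v \<or> head G e = v) \<and>
     (tail G f = v \<or> head G f = v) \<and> (e \<noteq> f \<or> tail G e = head G e))"

text \<open>If \<open>F\<close> contained all bounded arcs, every one of them incident with
  \<open>v\<close> would have level 1, so injectivity would leave a single one. It would have to be
  a loop, but a loop does not join different levels.\<close>

lemma spare_arc:
  assumes v: "v \<in> core" and sp: "spare v"
    and F: "\<And>e. e \<in> F \<Longrightarrow> level v (tail G e) \<noteq> level v (head G e)" "inj_on (arc_level v) F"
  shows "\<exists>f\<in>bounded_arcs. f \<notin> F"
proof (rule ccontr)
  assume no: "\<not> ?thesis"
  obtain e f where ef: "e \<in> bounded_arcs" "f \<in> bounded_arcs" "tail G e = v \<or> head G e = v"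
     "tail G f = v \<or> head G f = v" "e \<noteq> f \<or> tail G e = head G e"
    using sp unfolding spare_def by blast
  have lv: "level v v = 0" using level_le[of v v 0] by simp
  have l1: "arc_level v d = 1" if d: "d \<in> bounded_arcs" "tail G d = v \<or> head G d = v" for d
  proof -
    have "(tail G d, head G d) \<in> adj" "(head G d, tail G d) \<in> adj" using d by (auto simp: adj_def)
    then have "level v (head G d) \<le> 1" if "tail G d = v" using level_adj[OF v v] that lv by force
    moreover have "level v (tail G d) \<le> 1" if "head G d = v"
      using level_adj[OF v v] that lv \<open>(head G d, tail G d) \<in> adj\<close> by force
    moreover have "level v (tail G d) \<noteq> level v (head G d)" using no d F(1) by blast
    ultimately show ?thesis using d lv by (auto simp: arc_level_def)
  qed
  have "e \<in> F" "f \<in> F" using no ef by auto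
  then have "e = f" using inj_onD[OF F(2)] l1 ef by metis
  then show False using ef(5) F(1)[OF \<open>e \<in> F\<close>] by auto
qed

section \<open>Calibration on the graph\<close>

lemma calib_density_integral:
  assumes u: "has_graph_deriv u g" and e: "e \<in> arcs G"
  shows "set_integrable lborel (edge_interior L e) (calib_density h (er u e) (g e))"
    "(LBINT t:edge_interior L e. calib_density h (er u e) (g e) t) =
       (LBINT t:edge_interior L e. (g e t)\<^sup>2) / 2 +
       h ^ 4 * (LBINT t:edge_interior L e. (er u e t)\<^sup>2) / 6 -
       (LBINT t:edge_interior L e. er u e t ^ 6) / 6"
proof -
  note d = has_graph_derivD[OF u e]
  have i: "set_integrable lborel (edge_interior L e) (\<lambda>t. (1/2) * (g e t)\<^sup>2)"
    "set_integrable lborel (edge_interior L e) (\<lambda>t. (h ^ 4 / 6) * (er u e t)\<^sup>2)"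
    "set_integrable lborel (edge_interior L e) (\<lambda>t. (1/6) * er u e t ^ 6)"
    using L2_onD(2)[OF d(2)] L2_onD(2)[OF d(3)] power6_integrable[OF u e] by auto
  have eq: "calib_density h (er u e) (g e) = (\<lambda>t. ((1/2) * (g e t)\<^sup>2 + (h ^ 4 / 6) * (er u e t)\<^sup>2) - (1/6) * er u e t ^ 6)"
  proof -
    have "a\<^sup>2 * (h ^ 4 - a ^ 4) = h ^ 4 * a\<^sup>2 - a ^ 6" for a :: real
      by (simp add: right_diff_distrib mult.commute flip: power_add)
    then show ?thesis by (simp add: calib_density_def fun_eq_iff diff_divide_distrib)
  qed
  show "set_integrable lborel (edge_interior L e) (calib_density h (er u e) (g e))"
    unfolding eq by (intro set_integral_diff set_integral_add i)
  show "(LBINT t:edge_interior L e. calib_density h (er u e) (g e) t) =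
       (LBINT t:edge_interior L e. (g e t)\<^sup>2) / 2 +
       h ^ 4 * (LBINT t:edge_interior L e. (er u e t)\<^sup>2) / 6 -
       (LBINT t:edge_interior L e. er u e t ^ 6) / 6"
    unfolding eq
    by (subst set_integral_diff(2)[OF set_integral_add(1)[OF i(1,2)] i(3)],
        subst set_integral_add(2)[OF i(1,2)]) simp
qed

context
  fixes u g h
  assumes u: "has_graph_deriv u g" and h: "h > 0"
    and ran: "\<And>e x. e \<in> arcs G \<Longrightarrow> x \<in> edge_interval L e \<Longrightarrow> 0 \<le> er u e x \<and> er u e x \<le> h"
begin

definition dens :: "'b \<Rightarrow> real \<Rightarrow> real" where
  "dens e = calib_density h (er u e) (g e)"

definition cost :: "'b \<Rightarrow> real" where
  "cost e = (LBINT t:edge_interior L e. dens e t)"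

lemma dens_nonneg: "e \<in> arcs G \<Longrightarrow> x \<in> edge_interval L e \<Longrightarrow> 0 \<le> dens e x"
  unfolding dens_def using ran by (intro calib_density_nonneg) auto

lemmas dens_integrable = calib_density_integral(1)[OF u, of _ h, folded dens_def]

lemma cost_eq:
  assumes "e \<in> arcs G"
  shows "cost e = (LBINT t:edge_interior L e. (g e t)\<^sup>2) / 2 +
       h ^ 4 * (LBINT t:edge_interior L e. (er u e t)\<^sup>2) / 6 -
       (LBINT t:edge_interior L e. er u e t ^ 6) / 6"
  unfolding cost_def dens_def by (rule calib_density_integral(2)[OF u assms])

text \<open>The total cost is the energy plus h^4 / 6 times the mass, so lower bounds on the cost of
  disjoint pieces are lower bounds on the energy.\<close>

lemma total_cost: "sum cost (arcs G) = kin u / 2 + h ^ 4 * mass u / 6 - pot u / 6"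
  unfolding has_graph_deriv_H1(2)[OF u] mass_eq pot_eq
  by (simp add: cost_eq sum.distrib sum_subtractf sum_divide_distrib sum_distrib_left)

lemma cost_nonneg: "e \<in> arcs G \<Longrightarrow> 0 \<le> cost e"
  unfolding cost_def using dens_nonneg edge_interior_props(4) by (intro set_integral_nonneg_real) blast

lemma sum_cost_le: "F \<subseteq> arcs G \<Longrightarrow> sum cost F \<le> sum cost (arcs G)"
  using cost_nonneg by (intro sum_mono2) auto

lemma segment_cost:
  assumes e: "e \<in> arcs G" and xy: "x \<le> y" "x \<in> edge_interval L e" "y \<in> edge_interval L e"
  shows "{x<..<y} \<subseteq> edge_interior L e"
    "\<bar>calib h (er u e y) - calib h (er u e x)\<bar> \<le> (LBINT t:{x<..<y}. dens e t)"
proof -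
  note I = edge_interior_props[OF e] and d = has_graph_derivD[OF u e]
  have 1: "{x<..<y} \<subseteq> edge_interior L e" "{x..y} \<subseteq> edge_interval L e"
    using e xy by (cases rule: edge_cases; auto)+
  then show "{x<..<y} \<subseteq> edge_interior L e" by simp
  show "\<bar>calib h (er u e y) - calib h (er u e x)\<bar> \<le> (LBINT t:{x<..<y}. dens e t)"
    unfolding dens_def
    by (rule calib_segment[OF d(4) I(1) h _ _ xy(1) 1(1) continuous_on_subset[OF d(1) 1(2)]])
      (use ran[OF e] I(4) dens_integrable[OF e] in \<open>auto simp: dens_def[abs_def]\<close>)
qed

lemma bounded_arc_ends:
  assumes e: "e \<in> bounded_arcs"
  obtains l where "l > 0" "L e = ereal l" "edge_interior L e = {0<..<l}" "edge_interval L e = {0..l}"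
    "\<And>w. er w e 0 = w (Vertex (tail G e))" "\<And>w. er w e l = w (Vertex (head G e))"
proof -
  have "e \<in> arcs G" "L e \<noteq> \<infinity>" using e by (auto simp: bounded_arcs_def half_lines_def)
  then show thesis
    by (cases rule: edge_cases) (auto intro!: that simp: edge_restrict_def edge_point_def)
qed

lemma bounded_arc_cost:
  assumes e: "e \<in> bounded_arcs"
  shows "\<bar>calib h (u (Vertex (head G e))) - calib h (u (Vertex (tail G e)))\<bar> \<le> cost e"
proof -
  obtain l where l: "l > 0" "L e = ereal l" "edge_interior L e = {0<..<l}" "edge_interval L e = {0..l}"
    "er u e 0 = u (Vertex (tail G e))" "er u e l = u (Vertex (head G e))"
    using bounded_arc_ends[OF e] by metis
  show ?thesis using segment_cost(2)[OF bounded_arcsD[OF e], of 0 l] l by (simp add: cost_def)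
qed

lemma half_line_cost:
  assumes e: "e \<in> half_lines G L" and p: "0 \<le> p"
  shows "calib h (er u e p) - calib h 0 \<le> cost e"
proof -
  have e': "e \<in> arcs G" "L e = \<infinity>" using e by (auto simp: half_lines_def)
  then have I: "edge_interior L e = {0<..}" "edge_interval L e = {0..}" 
    by (auto simp: edge_interior_def edge_interval_def)
  note d = has_graph_derivD[OF u e'(1), unfolded I]
  show ?thesis
    unfolding cost_def I dens_def
    by (rule calib_half_line[OF d(4) h _ _ p d(1) half_line_decay[OF u e']])
      (use ran[OF e'(1)] I dens_integrable[OF e'(1)] in \<open>auto simp: dens_def[abs_def]\<close>)
qed

text \<open>Walking from the maximum point to infinity, \<open>calib h\<close> falls from its value
  at \<open>h\<close> to its value at 0, and each piece of the way costs at least its share of the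
  fall. The pieces are disjoint because the path is shortest; whatever the path omits can be added
  to the left side as well.\<close>

lemma calibration:
  assumes e0: "e0 \<in> arcs G" "x0 \<in> edge_interval L e0" "er u e0 x0 = h" and l: "l \<in> half_lines G L"
  shows "h ^ 4 * half_line_mass / 6 \<le> sum cost (arcs G)" (is ?A)
    and "spare (tail G l) \<Longrightarrow> \<exists>f\<in>arcs G. \<exists>x y. x < y \<and> {x<..<y} \<subseteq> edge_interior L f \<and>
        h ^ 4 * half_line_mass / 6 + (LBINT t:{x<..<y}. dens f t) \<le> sum cost (arcs G)" (is "_ \<Longrightarrow> ?B")
proof -
  define v where "v = tail G l"
  have la: "l \<in> arcs G" "L l = \<infinity>" using l by (auto simp: half_lines_def)
  have v: "v \<in> core" using tail_core la by (simp add: v_def)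
  let ?V = "\<lambda>w. calib h (u (Vertex w))"
  have lb: "l \<notin> bounded_arcs" using l by (simp add: bounded_arcs_def)
  have costv: "?V v - calib h 0 \<le> cost l"
    using half_line_cost[OF l, of 0] by (simp add: edge_restrict_def edge_point_def v_def)
  have path: "\<exists>F\<subseteq>bounded_arcs. finite F \<and> ?V w - calib h 0 \<le> cost l + sum cost F \<and>
     (\<forall>e\<in>F. level v (tail G e) \<noteq> level v (head G e) \<and> arc_level v e \<le> level v w) \<and> inj_on (arc_level v) F"
    if w: "w \<in> core" for w
  proof -
    obtain F where F: "F \<subseteq> bounded_arcs" 
       "\<And>(\<psi> :: 'a \<Rightarrow> real) c. (\<forall>e\<in>bounded_arcs. \<bar>\<psi> (head G e) - \<psi> (tail G e)\<bar> \<le> c e) \<Longrightarrow> \<bar>\<psi> w - \<psi> v\<bar> \<le> sum c F"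
       "\<forall>e\<in>F. level v (tail G e) \<noteq> level v (head G e) \<and> arc_level v e \<le> level v w" "inj_on (arc_level v) F"
      using shortest_path_arcs[OF v w] by metis
    have "\<bar>?V w - ?V v\<bar> \<le> sum cost F" by (rule F(2)) (use bounded_arc_cost in auto)
    moreover have "finite F" using F(1) finite_subset[of F "arcs G"] by (auto simp: bounded_arcs_def)
    ultimately show ?thesis using F costv by (intro exI[of _ F]) auto
  qed
  have ct: "h ^ 4 * half_line_mass / 6 = calib h h - calib h 0" using calib_total[OF h] by simp
  have whole: "\<exists>x y. x < y \<and> {x<..<y} \<subseteq> edge_interior L f \<and> cost f = (LBINT t:{x<..<y}. dens f t)"
    if f: "f \<in> bounded_arcs" for f
  proof -
    obtain m where m: "m > 0" "edge_interior L f = {0<..<m}" using bounded_arc_ends[OF f] by metis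
    then show ?thesis by (intro exI[of _ 0] exI[of _ m]) (auto simp: cost_def)
  qed
  have "?A \<and> (spare v \<longrightarrow> ?B)"
  proof (cases "e0 \<in> half_lines G L")
    case True
    then have "edge_interval L e0 = {0..}" by (auto simp: half_lines_def edge_interval_def)
    then have c0: "calib h h - calib h 0 \<le> cost e0" using half_line_cost[OF True, of x0] e0 by simp
    have A: ?A using c0 ct sum_cost_le[of "{e0}"] e0 by simp
    have ?B if sp: "spare v"
    proof -
      \<comment> \<open>The maximum lies on a half-line, which leads to infinity by itself, so any
        bounded arc is omitted.\<close>
      obtain f where f: "f \<in> bounded_arcs" using sp by (auto simp: spare_def)
      have "sum cost {e0, f} \<le> sum cost (arcs G)"
        by (rule sum_cost_le) (use f e0(1) bounded_arcsD in auto)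
      moreover have "e0 \<noteq> f" using True f by (auto simp: bounded_arcs_def)
      ultimately have "h ^ 4 * half_line_mass / 6 + cost f \<le> sum cost (arcs G)" using c0 unfolding ct by simp
      then show ?thesis using whole[OF f] bounded_arcsD[OF f] by metis
    qed
    with A show ?thesis by simp
  next
    case False
    then have b0: "e0 \<in> bounded_arcs" using e0 by (simp add: bounded_arcs_def)
    obtain m where m: "m > 0" "L e0 = ereal m" "edge_interior L e0 = {0<..<m}" "edge_interval L e0 = {0..m}"
      "er u e0 0 = u (Vertex (tail G e0))" "er u e0 m = u (Vertex (head G e0))"
      using bounded_arc_ends[OF b0] by metis
    have x0: "0 \<le> x0" "x0 \<le> m" using e0 m by auto
    have vertex: ?thesis if w: "w \<in> core" "u (Vertex w) = h" for w
    proof -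
      obtain F where F: "F \<subseteq> bounded_arcs" "finite F" "?V w - calib h 0 \<le> cost l + sum cost F"
        "\<forall>e\<in>F. level v (tail G e) \<noteq> level v (head G e) \<and> arc_level v e \<le> level v w" "inj_on (arc_level v) F"
        using path[OF w(1)] by blast
      have lF: "l \<notin> F" using F lb by auto
      have "sum cost (insert l F) \<le> sum cost (arcs G)"
        using F(1) la bounded_arcsD by (intro sum_cost_le) auto
      then have A: ?A using F(2,3) lF w ct by simp
      have ?B if sp: "spare v"
      proof -
        obtain f where f: "f \<in> bounded_arcs" "f \<notin> F" using spare_arc[OF v sp _ F(5)] F(4) by blast
        have "sum cost (insert f (insert l F)) \<le> sum cost (arcs G)"
          using F(1) la bounded_arcsD f by (intro sum_cost_le) auto
        then have "cost f + (cost l + sum cost F) \<le> sum cost (arcs G)"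
          using F(2) lF f lb by (auto simp: sum.insert_if split: if_splits)
        then have "h ^ 4 * half_line_mass / 6 + cost f \<le> sum cost (arcs G)"
          using F(3) unfolding w(2) ct by linarith
        then show ?thesis using whole[OF f(1)] bounded_arcsD[OF f(1)] by metis
      qed
      with A show ?thesis by simp
    qed
    \<comment> \<open>The maximum lies inside the bounded arc \<open>e0\<close>. The walk leaves it
      through {a<..<b} towards the end \<open>w\<close> of lower level, and {c<..<d} is the other
      part of \<open>e0\<close>, which the walk omits.\<close>
    have inner: ?thesis
      if w: "w \<in> core" "level v w = level v (tail G e0) \<or> level v w = level v (head G e0)"
        "level v w \<le> level v (tail G e0)" "level v w \<le> level v (head G e0)"
        and xy: "\<bar>h' - ?V w\<bar> \<le> (LBINT t:{a<..<b}. dens e0 t)" "h' = calib h h"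
        and ab: "{a<..<b} \<subseteq> {0<..<m}" "{c<..<d} \<subseteq> {0<..<m}" "{a<..<b} \<inter> {c<..<d} = {}" "c < d"
      for w h' a b c d
    proof -
      obtain F where F: "F \<subseteq> bounded_arcs" "finite F" "?V w - calib h 0 \<le> cost l + sum cost F"
        "\<forall>e\<in>F. level v (tail G e) \<noteq> level v (head G e) \<and> arc_level v e \<le> level v w" "inj_on (arc_level v) F"
        using path[OF w(1)] by blast
      have lF: "l \<notin> F" using F lb by auto
      \<comment> \<open>An arc of \<open>F\<close> joins two different levels, the larger one at
        most \<open>level v w\<close>; but \<open>w\<close> is an end of \<open>e0\<close> of least
        level.\<close>
      have eF: "e0 \<notin> F"
      proof
        assume "e0 \<in> F"
        then have "level v (tail G e0) \<noteq> level v (head G e0)" "arc_level v e0 \<le> level v w" using F(4) by auto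
        then show False using w by (auto simp: arc_level_def)
      qed
      note di = dens_integrable[OF e0(1), unfolded m(3)]
      have "(LBINT t:{a<..<b}. dens e0 t) + (LBINT t:{c<..<d}. dens e0 t)
         = (LBINT t:{a<..<b}\<union>{c<..<d}. dens e0 t)"
        by (rule set_integral_Un[symmetric, OF ab(3)])
          (rule set_integrable_subset[OF di]; use ab in auto)+
      also have "\<dots> \<le> cost e0"
        unfolding cost_def m(3)
        by (rule set_integral_mono_set[OF di]) (use ab dens_nonneg[OF e0(1)] m(4) in auto)
      finally have s: "(LBINT t:{a<..<b}. dens e0 t) + (LBINT t:{c<..<d}. dens e0 t) \<le> cost e0" .
      have "sum cost (insert e0 (insert l F)) \<le> sum cost (arcs G)"
        using F(1) la bounded_arcsD e0 by (intro sum_cost_le) auto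
      then have tot: "cost e0 + (cost l + sum cost F) \<le> sum cost (arcs G)"
        using F(2) lF eF b0 lb by (auto simp: sum.insert_if split: if_splits)
      have B: "h ^ 4 * half_line_mass / 6 + (LBINT t:{c<..<d}. dens e0 t) \<le> sum cost (arcs G)"
        using tot s F(3) xy ct by linarith
      moreover have "0 \<le> (LBINT t:{c<..<d}. dens e0 t)"
        by (rule set_integral_nonneg_real) (use ab dens_nonneg[OF e0(1)] m(4) in auto)
      ultimately have A: ?A by linarith
      have "{c<..<d} \<subseteq> edge_interior L e0" using ab(2) m(3) by simp
      then have ?B using B ab(4) e0(1) by blast
      with A show ?thesis by simp
    qed
    consider "x0 = 0" | "x0 = m" | "0 < x0" "x0 < m" using x0 by linarith
    then show ?thesis
    proof cases
      case 1 then show ?thesis using vertex[of "tail G e0"] m e0 tail_core by simp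
    next
      case 2 then show ?thesis using vertex[of "head G e0"] m e0 head_core[OF b0] by simp
    next
      case 3
      show ?thesis
      proof (cases "level v (tail G e0) \<le> level v (head G e0)")
        case True
        show ?thesis
          by (rule inner[of "tail G e0" "calib h h" 0 x0 x0 m])
            (use True 3 tail_core[OF e0(1)] segment_cost(2)[OF e0(1), of 0 x0] m(4,5) e0(3) in \<open>auto simp del: greaterThanLessThan_subseteq_greaterThanLessThan\<close>)
      next
        case False
        show ?thesis
          by (rule inner[of "head G e0" "calib h h" x0 m 0 x0])
            (use False 3 head_core[OF b0] segment_cost(2)[OF e0(1), of x0 m] m(4,6) e0(3) in \<open>auto simp: abs_minus_commute\<close>)
      qed
    qed
  qed
  then show ?A "spare (tail G l) \<Longrightarrow> ?B" by (auto simp: v_def)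
qed

end

end

section \<open>Soliton profiles\<close>

lemma half_line_FTC:
  fixes f F :: "real \<Rightarrow> real"
  assumes c: "continuous_on UNIV f" and d: "\<And>x. (F has_real_derivative f x) (at x)"
    and nn: "\<And>x. 0 \<le> f x" and lim: "(F \<longlongrightarrow> T) at_top"
  shows "set_integrable lborel {0<..} f" "(LBINT x:{0<..}. f x) = T - F 0"
proof -
  have m: "f \<in> borel_measurable borel" using c by (rule borel_measurable_continuous_onI)
  have mono: "F 0 \<le> T"
  proof (rule tendsto_lowerbound[OF lim])
    show "\<forall>\<^sub>F x in at_top. F 0 \<le> F x"
      unfolding eventually_at_top_linorder
    proof (intro exI[of _ 0] allI impI)
      fix x :: real assume x: "0 \<le> x"
      show "F 0 \<le> F x"
        by (rule DERIV_nonneg_imp_nondecreasing[OF x]) (intro exI conjI, rule d, rule nn)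
    qed
  qed simp
  have nn_int: "(\<integral>\<^sup>+x. ennreal (indicator {0..} x * f x) \<partial>lborel) = ennreal (T - F 0)"
    using nn_integral_FTC_atLeast[OF m, of 0 F T] d nn lim
    by (simp add: ennreal_mult'' mult.commute flip: ennreal_indicator)
  have hb: "has_bochner_integral lborel (\<lambda>x. indicator {0..} x * f x) (T - F 0)"
    by (rule has_bochner_integral_nn_integral[OF _ _ _ nn_int]) (use m nn mono in auto)
  have "set_integrable lborel {0..} f"
    using hb unfolding set_integrable_def has_bochner_integral_iff by simp
  then show "set_integrable lborel {0<..} f" by (rule set_integrable_subset) auto
  have "(LBINT x:{0<..}. f x) = (LBINT x:{0..}. f x)"
    by (rule set_integral_discrete_difference[where X="{0}"]) auto
  then show "(LBINT x:{0<..}. f x) = T - F 0"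
    using hb unfolding set_lebesgue_integral_def has_bochner_integral_iff by simp
qed

text \<open>The optimizer on the real line, up to scaling: u'^2 = (u^2 - u^6) / 4, which after a
  dilation is the equality case of the calibration with h = 1.\<close>

definition soliton :: "real \<Rightarrow> real" where
  "soliton x = 1 / sqrt (cosh x)"

definition soliton' :: "real \<Rightarrow> real" where
  "soliton' x = - sinh x / (2 * cosh x * sqrt (cosh x))"

lemma soliton_pos: "soliton x > 0" by (simp add: soliton_def)

lemma soliton_even: "soliton (- x) = soliton x" by (simp add: soliton_def)

lemma soliton_power2: "(soliton x)\<^sup>2 = 1 / cosh x"
  by (simp add: soliton_def power_divide)

lemma soliton_power6: "soliton x ^ 6 = 1 / cosh x ^ 3"
proof -
  have "soliton x ^ 6 = ((soliton x)\<^sup>2) ^ 3" by (simp flip: power_mult)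
  then show ?thesis by (simp add: soliton_power2 power_divide)
qed

lemma soliton'_power2: "(soliton' x)\<^sup>2 = (sinh x)\<^sup>2 / (4 * cosh x ^ 3)"
  by (simp add: soliton'_def power_divide power_mult_distrib power3_eq_cube power2_eq_square)

lemma DERIV_soliton: "(soliton has_real_derivative soliton' x) (at x)"
proof -
  have c: "cosh x > 0" by simp
  have "(soliton has_real_derivative - (sinh x * (inverse (sqrt (cosh x)) / 2)) / (sqrt (cosh x) * sqrt (cosh x))) (at x)"
    unfolding soliton_def[abs_def] using c
    by (auto intro!: derivative_eq_intros dest: order.strict_trans[OF cosh_real_pos])
  moreover have "- (sinh x * (inverse (sqrt (cosh x)) / 2)) / (sqrt (cosh x) * sqrt (cosh x)) = soliton' x"
    using c by (simp add: soliton'_def field_simps)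
  ultimately show ?thesis by simp
qed

lemma continuous_on_soliton: "continuous_on A soliton"
  unfolding soliton_def[abs_def] by (intro continuous_intros) auto

lemma continuous_on_soliton': "continuous_on A soliton'"
  unfolding soliton'_def[abs_def] by (intro continuous_intros) auto

text \<open>The Gudermannian function, an antiderivative of 1 / cosh, that is, of the squared
  soliton.\<close>

definition gd :: "real \<Rightarrow> real" where "gd x = arctan (sinh x)"

lemma DERIV_gd: "(gd has_real_derivative 1 / cosh x) (at x)"
proof -
  have "1 + (sinh x)\<^sup>2 = (cosh x)\<^sup>2" by (simp add: cosh_square_eq)
  then have "inverse (1 + (sinh x)\<^sup>2) * cosh x = 1 / cosh x" by (simp add: power2_eq_square field_simps)
  moreover have "(gd has_real_derivative inverse (1 + (sinh x)\<^sup>2) * cosh x) (at x)"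
    unfolding gd_def[abs_def] by (auto intro!: derivative_eq_intros)
  ultimately show ?thesis by simp
qed

lemma gd_at_top: "(gd \<longlongrightarrow> pi / 2) at_top"
  unfolding gd_def[abs_def]
  by (rule filterlim_compose[OF tendsto_arctan_at_top sinh_real_at_top])

lemma gd_minus: "gd (- x) = - gd x" by (simp add: gd_def arctan_minus)

text \<open>The function tanh / cosh. Its derivative makes (gd + sc2) / 2 an antiderivative of 1 /
  cosh^3, the sixth power of the soliton.\<close>

definition sc2 :: "real \<Rightarrow> real" where "sc2 x = sinh x / (cosh x)\<^sup>2"

lemma DERIV_sc2: "(sc2 has_real_derivative 2 / cosh x ^ 3 - 1 / cosh x) (at x)"
proof -
  have c: "cosh x > 0" by simp
  have "(sc2 has_real_derivative (cosh x * (cosh x)\<^sup>2 - sinh x * (2 * cosh x * sinh x)) / ((cosh x)\<^sup>2 * (cosh x)\<^sup>2)) (at x)"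
    unfolding sc2_def[abs_def] by (auto intro!: derivative_eq_intros)
  moreover have "(cosh x * (cosh x)\<^sup>2 - sinh x * (2 * cosh x * sinh x)) / ((cosh x)\<^sup>2 * (cosh x)\<^sup>2) = 2 / cosh x ^ 3 - 1 / cosh x"
  proof -
    have "cosh x * (cosh x)\<^sup>2 - sinh x * (2 * cosh x * sinh x) = cosh x * (2 - (cosh x)\<^sup>2)"
      using cosh_square_eq[of x] by algebra
    then show ?thesis using c by (simp add: field_simps power2_eq_square power3_eq_cube)
  qed
  ultimately show ?thesis by simp
qed

lemma sc2_at_top: "(sc2 \<longlongrightarrow> 0) at_top"
proof (rule Lim_null_comparison)
  show "\<forall>\<^sub>F x in at_top. norm (sc2 x) \<le> 1 / cosh x"
  proof (intro always_eventually allI)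
    fix x :: real
    have "\<bar>sinh x\<bar> \<le> cosh x" using sinh_less_cosh_real[of x] sinh_less_cosh_real[of "-x"] by simp
    then show "norm (sc2 x) \<le> 1 / cosh x" by (simp add: sc2_def abs_divide power2_eq_square field_simps)
  qed
  show "((\<lambda>x::real. 1 / cosh x) \<longlongrightarrow> 0) at_top"
    by (rule tendsto_divide_0[OF tendsto_const]) (rule filterlim_at_top_imp_at_infinity[OF cosh_real_at_top])
qed

lemma sc2_minus: "sc2 (- x) = - sc2 x" by (simp add: sc2_def)

section \<open>Integrals over a half-line of a dilated and shifted soliton\<close>

context
  fixes k s :: real
  assumes k: "k > 0"
begin

lemma affine_at_top: "filterlim (\<lambda>x. k * x + s) at_top at_top"
proof -
  have "filterlim (\<lambda>x. s + k * x) at_top at_top"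
    by (intro filterlim_tendsto_add_at_top[OF tendsto_const]
        filterlim_tendsto_pos_mult_at_top[OF tendsto_const k] filterlim_ident)
  then show ?thesis by (simp add: add.commute)
qed

lemma soliton_mass_half_line:
  "set_integrable lborel {0<..} (\<lambda>x. (soliton (k * x + s))\<^sup>2)"
  "(LBINT x:{0<..}. (soliton (k * x + s))\<^sup>2) = (pi / 2 - gd s) / k"
proof -
  let ?F = "\<lambda>x. gd (k * x + s) / k"
  have d: "(?F has_real_derivative (soliton (k * x + s))\<^sup>2) (at x)" for x
    unfolding soliton_power2 using k
    by (auto intro!: derivative_eq_intros DERIV_chain2[OF DERIV_gd])
  have lim: "(?F \<longlongrightarrow> (pi / 2) / k) at_top"
    using k by (intro tendsto_intros filterlim_compose[OF gd_at_top affine_at_top]) auto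
  have c: "continuous_on UNIV (\<lambda>x. (soliton (k * x + s))\<^sup>2)"
    unfolding soliton_power2 by (intro continuous_intros) auto
  show "set_integrable lborel {0<..} (\<lambda>x. (soliton (k * x + s))\<^sup>2)"
    using half_line_FTC(1)[OF c d _ lim] by simp
  show "(LBINT x:{0<..}. (soliton (k * x + s))\<^sup>2) = (pi / 2 - gd s) / k"
    using half_line_FTC(2)[OF c d _ lim] by (simp add: diff_divide_distrib)
qed

lemma soliton_pot_half_line:
  "(LBINT x:{0<..}. soliton (k * x + s) ^ 6) = (pi / 2 - gd s - sc2 s) / (2 * k)"
proof -
  let ?F = "\<lambda>x. (gd (k * x + s) + sc2 (k * x + s)) / (2 * k)"
  have d: "(?F has_real_derivative soliton (k * x + s) ^ 6) (at x)" for x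
    unfolding soliton_power6 using k
    by (auto intro!: derivative_eq_intros DERIV_chain2[OF DERIV_gd] DERIV_chain2[OF DERIV_sc2] simp: field_simps)
  have lim: "(?F \<longlongrightarrow> (pi / 2 + 0) / (2 * k)) at_top"
    using k by (intro tendsto_intros filterlim_compose[OF gd_at_top affine_at_top]
        filterlim_compose[OF sc2_at_top affine_at_top]) auto
  have c: "continuous_on UNIV (\<lambda>x. soliton (k * x + s) ^ 6)"
    unfolding soliton_power6 by (intro continuous_intros) auto
  show ?thesis
    using half_line_FTC(2)[OF c d _ lim] by (simp add: diff_divide_distrib add_divide_distrib)
qed

lemma soliton_kin_half_line:
  "set_integrable lborel {0<..} (\<lambda>x. (k * soliton' (k * x + s))\<^sup>2)"
  "(LBINT x:{0<..}. (k * soliton' (k * x + s))\<^sup>2) = k * (pi / 2 - gd s + sc2 s) / 8"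
proof -
  let ?F = "\<lambda>x. k * (gd (k * x + s) - sc2 (k * x + s)) / 8"
  \<comment> \<open>In terms of 1 / cosh and 1 / cosh^3 the squared derivative is a quarter of their
    difference, which is the derivative of (gd - sc2) / 8.\<close>
  have sq: "(soliton' y)\<^sup>2 = (1 / cosh y - 1 / cosh y ^ 3) / 4" for y
  proof -
    have "(sinh y)\<^sup>2 = (cosh y)\<^sup>2 - 1" using cosh_square_eq[of y] by simp
    then show ?thesis
      unfolding soliton'_power2 by (simp add: field_simps power3_eq_cube power2_eq_square)
  qed
  have d: "(?F has_real_derivative (k * soliton' (k * x + s))\<^sup>2) (at x)" for x
    unfolding power_mult_distrib sq using k
    by (auto intro!: derivative_eq_intros DERIV_chain2[OF DERIV_gd] DERIV_chain2[OF DERIV_sc2]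
        simp: field_simps power2_eq_square)
  have lim: "(?F \<longlongrightarrow> k * (pi / 2 - 0) / 8) at_top"
    using k by (intro tendsto_intros filterlim_compose[OF gd_at_top affine_at_top]
        filterlim_compose[OF sc2_at_top affine_at_top]) auto
  have c: "continuous_on UNIV (\<lambda>x. (k * soliton' (k * x + s))\<^sup>2)"
    by (intro continuous_intros continuous_on_compose2[OF continuous_on_soliton'[of UNIV]]) auto
  show "set_integrable lborel {0<..} (\<lambda>x. (k * soliton' (k * x + s))\<^sup>2)"
    using half_line_FTC(1)[OF c d _ lim] by simp
  show "(LBINT x:{0<..}. (k * soliton' (k * x + s))\<^sup>2) = k * (pi / 2 - gd s + sc2 s) / 8"
    using half_line_FTC(2)[OF c d _ lim] by (simp add: field_simps)
qed

lemma soliton_ac_deriv: "ac_deriv I (\<lambda>x. soliton (k * x + s)) (\<lambda>x. k * soliton' (k * x + s))"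
proof (rule ac_deriv_C1)
  show "((\<lambda>x. soliton (k * x + s)) has_real_derivative k * soliton' (k * x + s)) (at x)" for x
  proof -
    have "((\<lambda>x. k * x + s) has_real_derivative k) (at x)" by (auto intro!: derivative_eq_intros)
    from DERIV_chain2[OF DERIV_soliton this] show ?thesis by (simp add: mult.commute)
  qed
  show "continuous_on I (\<lambda>x. k * soliton' (k * x + s))"
    by (intro continuous_intros continuous_on_compose2[OF continuous_on_soliton'[of UNIV]]) auto
qed

end

section \<open>Competitors on the graph built from solitons\<close>

context noncompact_graph
begin

text \<open>
  A soliton centred at distance \<open>T / k\<close> from the vertex on \<open>l\<close>. Cutting the solitons of the other
  half-lines at the same distance from their centres makes all vertex values equal, so that no cut-off
  is needed: with \<open>T = 0\<close>, \<open>k \<rightarrow> 0\<close> it spreads half-solitons, with \<open>T \<rightarrow> \<infinity>\<close> it moves one soliton to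
  infinity.
\<close>

definition soliton_fun :: "'b \<Rightarrow> real \<Rightarrow> real \<Rightarrow> ('a, 'b) graph_point \<Rightarrow> real" where
  "soliton_fun l k T p = (case p of Vertex v \<Rightarrow> soliton T
     | Inner e x \<Rightarrow> if L e = \<infinity> then soliton (k * x + (if e = l then - T else T)) else soliton T)"

definition total_length :: real where
  "total_length = (\<Sum>e\<in>bounded_arcs. real_of_ereal (L e))"

text \<open>Evenness of the soliton makes the shifts \<open>T\<close> and \<open>- T\<close> agree
  at x = 0, so one formula covers each half-line including its start.\<close>

lemma er_soliton_fun:
  "L e = \<infinity> \<Longrightarrow> er (soliton_fun l k T) e x = soliton (k * x + (if e = l then - T else T))"
  "L e \<noteq> \<infinity> \<Longrightarrow> er (soliton_fun l k T) e x = soliton T"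
  by (auto simp: edge_restrict_def edge_point_def soliton_fun_def soliton_even)

definition soliton_fun_deriv :: "'b \<Rightarrow> real \<Rightarrow> real \<Rightarrow> 'b \<Rightarrow> real \<Rightarrow> real" where
  "soliton_fun_deriv l k T e x = (if L e = \<infinity> then k * soliton' (k * x + (if e = l then - T else T)) else 0)"

lemma arcs_split: "arcs G = half_lines G L \<union> bounded_arcs" "half_lines G L \<inter> bounded_arcs = {}"
  "finite (half_lines G L)" "finite bounded_arcs"
  by (auto simp: half_lines_def bounded_arcs_def)

lemma half_linesD:
  assumes "e \<in> half_lines G L"
  shows "e \<in> arcs G" "L e = \<infinity>" "edge_interior L e = {0<..}" "edge_interval L e = {0..}"
  using assms by (auto simp: half_lines_def edge_interior_def edge_interval_def)

lemma L2_on_const_bounded: "L2_on {0<..<m} (\<lambda>x. c)"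
proof -
  have "set_integrable lborel {0..m} (\<lambda>x. c\<^sup>2)" by (rule borel_integrable_atLeastAtMost') auto
  then have "set_integrable lborel {0<..<m} (\<lambda>x. c\<^sup>2)" by (rule set_integrable_subset) auto
  then show ?thesis unfolding L2_on_def set_borel_measurable_def by simp
qed

lemma has_graph_deriv_soliton:
  assumes k: "k > 0"
  shows "has_graph_deriv (soliton_fun l k T) (soliton_fun_deriv l k T)"
  unfolding has_graph_deriv_def
proof
  fix e assume e: "e \<in> arcs G"
  show "continuous_on (edge_interval L e) (er (soliton_fun l k T) e) \<and>
         L2_on (edge_interior L e) (er (soliton_fun l k T) e) \<and>
         L2_on (edge_interior L e) (soliton_fun_deriv l k T e) \<and>
         ac_deriv (edge_interior L e) (er (soliton_fun l k T) e) (soliton_fun_deriv l k T e)"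
    using e
  proof (cases rule: edge_cases)
    case 1
    define s where "s = (if e = l then - T else T)"
    have eq: "er (soliton_fun l k T) e = (\<lambda>x. soliton (k * x + s))"
      "soliton_fun_deriv l k T e = (\<lambda>x. k * soliton' (k * x + s))"
      using 1 by (auto simp: er_soliton_fun soliton_fun_deriv_def s_def fun_eq_iff)
    have c: "continuous_on A (\<lambda>x. soliton (k * x + s))" "continuous_on A (\<lambda>x. k * soliton' (k * x + s))" for A
      by (intro continuous_intros continuous_on_compose2[OF continuous_on_soliton'[of UNIV]]
          continuous_on_compose2[OF continuous_on_soliton[of UNIV]]; simp)+
    show ?thesis
      unfolding eq 1 L2_on_def
      using soliton_mass_half_line(1)[OF k] soliton_kin_half_line(1)[OF k] soliton_ac_deriv[OF k] c
      by (auto intro: set_borel_measurable_continuous_on)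
  next
    case (2 m)
    have eq: "er (soliton_fun l k T) e = (\<lambda>x. soliton T)" "soliton_fun_deriv l k T e = (\<lambda>x. 0)"
      using 2 by (auto simp: er_soliton_fun soliton_fun_deriv_def fun_eq_iff)
    show ?thesis
      unfolding eq 2 using L2_on_const_bounded by (auto intro!: ac_deriv_C1 derivative_eq_intros)
  qed
qed

lemma soliton_fun_mass:
  assumes k: "k > 0"
  shows "mass (soliton_fun l k T) =
    (\<Sum>e\<in>half_lines G L. (pi / 2 - gd (if e = l then - T else T)) / k) + total_length / cosh T"
proof -
  have 1: "(LBINT x:edge_interior L e. (er (soliton_fun l k T) e x)\<^sup>2) = (pi / 2 - gd (if e = l then - T else T)) / k"
    if "e \<in> half_lines G L" for e
    using soliton_mass_half_line(2)[OF k] half_linesD[OF that] by (simp add: er_soliton_fun)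
  have 2: "(LBINT x:edge_interior L e. (er (soliton_fun l k T) e x)\<^sup>2) = real_of_ereal (L e) / cosh T"
    if e: "e \<in> bounded_arcs" for e
  proof -
    have "L e \<noteq> \<infinity>" using e by (auto simp: bounded_arcs_def half_lines_def)
    then obtain m where m: "m > 0" "L e = ereal m" "edge_interior L e = {0<..<m}"
      using edge_cases[OF bounded_arcsD[OF e]] by metis
    then show ?thesis by (simp add: er_soliton_fun soliton_power2 set_integral_const)
  qed
  show ?thesis
    unfolding mass_eq arcs_split(1)
    by (subst sum.union_disjoint[OF arcs_split(3,4,2)])
      (simp add: 1 2 total_length_def sum_divide_distrib)
qed

lemma soliton_fun_kin:
  assumes k: "k > 0"
  shows "kin (soliton_fun l k T) =
    (\<Sum>e\<in>half_lines G L. k * (pi / 2 - gd (if e = l then - T else T) + sc2 (if e = l then - T else T)) / 8)"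
proof -
  have 1: "(LBINT x:edge_interior L e. (soliton_fun_deriv l k T e x)\<^sup>2) =
      k * (pi / 2 - gd (if e = l then - T else T) + sc2 (if e = l then - T else T)) / 8"
    if "e \<in> half_lines G L" for e
    using soliton_kin_half_line(2)[OF k] half_linesD[OF that] by (simp add: soliton_fun_deriv_def)
  have 2: "(LBINT x:edge_interior L e. (soliton_fun_deriv l k T e x)\<^sup>2) = 0"
    if "e \<in> bounded_arcs" for e
    using that by (simp add: soliton_fun_deriv_def bounded_arcs_def half_lines_def)
  show ?thesis
    unfolding has_graph_deriv_H1(2)[OF has_graph_deriv_soliton[OF k]] arcs_split(1)
    by (subst sum.union_disjoint[OF arcs_split(3,4,2)]) (simp add: 1 2)
qed

text \<open>Only the contribution of \<open>l\<close> is kept. It is asymptotically all of the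
  potential both for k = 1, T tending to infinity, and for a single half-line with T = 0, k tending
  to 0.\<close>

lemma soliton_fun_pot:
  assumes k: "k > 0" and l: "l \<in> half_lines G L"
  shows "(pi / 2 + gd T + sc2 T) / (2 * k) \<le> pot (soliton_fun l k T)"
proof -
  have "(LBINT x:edge_interior L l. er (soliton_fun l k T) l x ^ 6) \<le> pot (soliton_fun l k T)"
    unfolding pot_eq
    by (rule member_le_sum) (use half_linesD[OF l] in \<open>auto intro!: set_integral_nonneg_real\<close>)
  then show ?thesis
    using soliton_pot_half_line[OF k, of "- T"] half_linesD[OF l] by (simp add: er_soliton_fun gd_minus sc2_minus)
qed

end

section \<open>The critical mass\<close>

lemma set_integral_continuous_pos:
  fixes f :: "real \<Rightarrow> real"
  assumes I: "open I" and c: "continuous_on I f" and nn: "\<And>x. x \<in> I \<Longrightarrow> 0 \<le> f x"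
    and i: "set_integrable lborel I f" and x0: "x0 \<in> I" "f x0 > 0"
  shows "0 < (LBINT x:I. f x)"
proof -
  obtain r where r: "r > 0" "cball x0 r \<subseteq> I" using I x0(1) unfolding open_contains_cball by auto
  define a b where "a = x0 - r" and "b = x0 + r"
  have ab: "a < x0" "x0 < b" "{a..b} \<subseteq> I" using r by (auto simp: a_def b_def cball_eq_atLeastAtMost)
  have iab: "set_integrable lborel {a..b} f" by (rule set_integrable_subset[OF i]) (use ab in auto)
  have "integral {a..b} f \<noteq> 0"
  proof
    assume "integral {a..b} f = 0"
    moreover have "continuous_on (cbox a b) f" "box a b \<noteq> {}"
      using continuous_on_subset[OF c ab(3)] ab by auto
    moreover have "f x \<ge> 0" if "x \<in> cbox a b" for x using nn ab(3) that by auto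
    ultimately have "\<forall>x\<in>cbox a b. f x = 0" using integral_cbox_eq_0_iff[of a b f] by simp
    then show False using ab x0 by auto
  qed
  moreover have "(LBINT x:{a..b}. f x) = integral {a..b} f"
    by (rule set_borel_integral_eq_integral(2)[OF iab])
  moreover have "0 \<le> (LBINT x:{a..b}. f x)"
    by (rule set_integral_nonneg_real) (use ab nn in auto)
  moreover have "(LBINT x:{a..b}. f x) \<le> (LBINT x:I. f x)"
    by (rule set_integral_mono_set[OF i ab(3)]) (use nn in auto)
  ultimately show ?thesis by linarith
qed

context noncompact_graph
begin

definition nonneg_fun :: "(('a, 'b) graph_point \<Rightarrow> real) \<Rightarrow> bool" where
  "nonneg_fun u \<longleftrightarrow> (\<forall>e\<in>arcs G. \<forall>x\<in>edge_interval L e. 0 \<le> er u e x)"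

lemma attains_sup:
  assumes u: "has_graph_deriv u g" and nn: "nonneg_fun u"
  obtains e x where "e \<in> arcs G" "x \<in> edge_interval L e"
    "\<And>e' x'. e' \<in> arcs G \<Longrightarrow> x' \<in> edge_interval L e' \<Longrightarrow> er u e' x' \<le> er u e x"
proof -
  have "\<exists>p\<in>edge_interval L e. \<forall>x\<in>edge_interval L e. er u e x \<le> er u e p" if e: "e \<in> arcs G" for e
    using e
  proof (cases rule: edge_cases)
    case 1
    then show ?thesis
      using continuous_half_line_attains_sup[OF _ half_line_decay[OF u e 1(1)]]
        has_graph_derivD(1)[OF u e] nn e unfolding nonneg_fun_def by auto
  next
    case (2 l)
    then show ?thesis
      using continuous_attains_sup[of "{0..l}" "er u e"] has_graph_derivD(1)[OF u e] by auto
  qed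
  then obtain p where p: "\<And>e. e \<in> arcs G \<Longrightarrow> p e \<in> edge_interval L e \<and> (\<forall>x\<in>edge_interval L e. er u e x \<le> er u e (p e))"
    by metis
  have "arcs G \<noteq> {}" using half_line_exists by (auto simp: half_lines_def)
  then have "Max ((\<lambda>e. er u e (p e)) ` arcs G) \<in> (\<lambda>e. er u e (p e)) ` arcs G" by (intro Max_in) auto
  then obtain e where e: "e \<in> arcs G" "Max ((\<lambda>e. er u e (p e)) ` arcs G) = er u e (p e)" by auto
  show thesis
  proof (rule that[OF e(1), of "p e"])
    show "p e \<in> edge_interval L e" using p e by auto
    fix e' x' assume a: "e' \<in> arcs G" "x' \<in> edge_interval L e'"
    have "er u e' x' \<le> er u e' (p e')" using p a by auto
    also have "\<dots> \<le> er u e (p e)" unfolding e(2)[symmetric] using a by (intro Max_ge) auto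
    finally show "er u e' x' \<le> er u e (p e)" .
  qed
qed

lemma pot_le_sup:
  assumes u: "has_graph_deriv u g"
    and ran: "\<And>e x. e \<in> arcs G \<Longrightarrow> x \<in> edge_interval L e \<Longrightarrow> 0 \<le> er u e x \<and> er u e x \<le> h"
  shows "pot u \<le> h ^ 4 * mass u"
  unfolding pot_eq mass_eq sum_distrib_left
proof (intro sum_mono)
  fix e assume e: "e \<in> arcs G"
  have "(LBINT x:edge_interior L e. er u e x ^ 6) \<le> (LBINT x:edge_interior L e. h ^ 4 * (er u e x)\<^sup>2)"
  proof (rule set_integral_mono)
    show "set_integrable lborel (edge_interior L e) (\<lambda>x. er u e x ^ 6)" by (rule power6_integrable[OF u e])
    show "set_integrable lborel (edge_interior L e) (\<lambda>x. h ^ 4 * (er u e x)\<^sup>2)"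
      using L2_onD(2)[OF has_graph_derivD(2)[OF u e]] by simp
    fix x assume "x \<in> edge_interior L e"
    then have r: "0 \<le> er u e x" "er u e x \<le> h" using ran[OF e] edge_interior_props(4)[OF e] by auto
    have "er u e x ^ 6 = er u e x ^ 4 * (er u e x)\<^sup>2" by (simp flip: power_add)
    also have "\<dots> \<le> h ^ 4 * (er u e x)\<^sup>2" using r by (intro mult_right_mono power_mono) auto
    finally show "er u e x ^ 6 \<le> h ^ 4 * (er u e x)\<^sup>2" .
  qed
  then show "(LBINT x:edge_interior L e. er u e x ^ 6) \<le> h ^ 4 * (LBINT x:edge_interior L e. (er u e x)\<^sup>2)"
    by simp
qed

text \<open>The calibration is applied to c u, whose maximum is c h. The factor c stays free so that
  the mass can later be normalized; h = 0 is separate because the calibration divides by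
  h^2.\<close>

lemma energy_lower_bound:
  assumes u: "has_graph_deriv u g" and nn: "nonneg_fun u"
  obtains h where "h \<ge> 0"
    "\<And>e x. e \<in> arcs G \<Longrightarrow> x \<in> edge_interval L e \<Longrightarrow> 0 \<le> er u e x \<and> er u e x \<le> h"
    "\<exists>e\<in>arcs G. \<exists>x\<in>edge_interval L e. er u e x = h"
    "\<And>c. c > 0 \<Longrightarrow> (c * h) ^ 4 * (half_line_mass - c\<^sup>2 * mass u) / 6 \<le> c\<^sup>2 * kin u / 2 - c ^ 6 * pot u / 6"
proof -
  obtain e x where e: "e \<in> arcs G" "x \<in> edge_interval L e"
    "\<And>e' x'. e' \<in> arcs G \<Longrightarrow> x' \<in> edge_interval L e' \<Longrightarrow> er u e' x' \<le> er u e x"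
    using attains_sup[OF u nn] by metis
  define h where "h = er u e x"
  have h: "h \<ge> 0" using nn e by (auto simp: nonneg_fun_def h_def)
  have ran: "0 \<le> er u e x \<and> er u e x \<le> h" if "e \<in> arcs G" "x \<in> edge_interval L e" for e x
    using e(3) nn that by (auto simp: nonneg_fun_def h_def)
  have low: "(c * h) ^ 4 * (half_line_mass - c\<^sup>2 * mass u) / 6 \<le> c\<^sup>2 * kin u / 2 - c ^ 6 * pot u / 6" if c: "c > 0" for c
  proof (cases "h = 0")
    case True
    then have "pot u \<le> 0" using pot_le_sup[OF u ran] by simp
    then have "pot u = 0" using pot_nonneg[of u] by simp
    then show ?thesis using True kin_nonneg[of u] by simp
  next
    case False
    then have ch: "c * h > 0" using h c by auto
    obtain l where l: "l \<in> half_lines G L" using half_line_exists by auto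
    note cu = has_graph_deriv_cmult[OF u, of c]
    have ran': "0 \<le> er (\<lambda>p. c * u p) e x \<and> er (\<lambda>p. c * u p) e x \<le> c * h"
      if "e \<in> arcs G" "x \<in> edge_interval L e" for e x
      unfolding er_compose[of "(*) c"] using ran[OF that] c by auto
    have "er (\<lambda>p. c * u p) e x = c * h" by (simp add: er_compose[of "(*) c"] h_def)
    then have "(c * h) ^ 4 * half_line_mass / 6 \<le> kin (\<lambda>p. c * u p) / 2 + (c * h) ^ 4 * mass (\<lambda>p. c * u p) / 6 - pot (\<lambda>p. c * u p) / 6"
      using calibration(1)[OF cu ch ran' e(1,2) _ l] total_cost[OF cu ch ran'] by simp
    then show ?thesis unfolding scale_functionals[OF u] by (simp add: field_simps)
  qed
  show thesis using that[OF h ran _ low] e h_def by blast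
qed

text \<open>Scaling |u| to mass \<open>half_line_mass\<close> makes the left side of the energy
  bound vanish, so the scaled energy is nonnegative; undoing the scaling gives the homogeneous
  inequality. In particular the supremum defining the critical mass is finite.\<close>

lemma GN_half_line:
  assumes "u \<in> H1_graph G L"
  shows "half_line_mass\<^sup>2 * pot u \<le> 3 * (mass u)\<^sup>2 * kin u"
proof -
  note u = H1_graph_has_deriv[OF assms]
  let ?v = "\<lambda>p. \<bar>u p\<bar>"
  note v = has_graph_deriv_abs[OF u]
  have nn: "nonneg_fun ?v" by (simp add: nonneg_fun_def er_compose[of abs])
  obtain h where h: "h \<ge> 0"
    "\<And>e x. e \<in> arcs G \<Longrightarrow> x \<in> edge_interval L e \<Longrightarrow> 0 \<le> er ?v e x \<and> er ?v e x \<le> h"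
    "\<And>c. c > 0 \<Longrightarrow> (c * h) ^ 4 * (half_line_mass - c\<^sup>2 * mass ?v) / 6 \<le> c\<^sup>2 * kin ?v / 2 - c ^ 6 * pot ?v / 6"
    using energy_lower_bound[OF v nn] by metis
  have "half_line_mass\<^sup>2 * pot ?v \<le> 3 * (mass ?v)\<^sup>2 * kin ?v"
  proof (cases "mass ?v = 0")
    case True
    then have "pot ?v \<le> 0" using pot_le_sup[OF v h(2)] by simp
    then show ?thesis using True pot_nonneg[of ?v] by simp
  next
    case False
    then have M: "mass ?v > 0" using mass_nonneg[of ?v] by simp
    \<comment> \<open>Chosen such that c^2 times the mass is \<open>half_line_mass\<close>.\<close>
    define c where "c = sqrt (half_line_mass / mass ?v)"
    have c: "c > 0" "c\<^sup>2 = half_line_mass / mass ?v"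
      using M half_line_mass_pos by (auto simp: c_def)
    have "0 \<le> c\<^sup>2 * kin ?v / 2 - c ^ 6 * pot ?v / 6" using h(3)[OF c(1)] c(2) M by simp
    also have "c ^ 6 = c\<^sup>2 * (c\<^sup>2)\<^sup>2" by (simp flip: power_mult power_add)
    finally have "0 \<le> c\<^sup>2 * (3 * kin ?v - (c\<^sup>2)\<^sup>2 * pot ?v)" by (simp add: algebra_simps)
    then have "(c\<^sup>2)\<^sup>2 * pot ?v \<le> 3 * kin ?v" using c(1) by (simp add: zero_le_mult_iff)
    then show ?thesis unfolding c(2) using M by (simp add: power_divide field_simps)
  qed
  then show ?thesis
    using kin_abs_le[OF u] mult_left_mono[of "kin ?v" "kin u" "3 * (mass u)\<^sup>2"] by simp
qed

section \<open>The critical mass is well defined; upper bounds from solitons\<close>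

lemma nonzero_soliton: "nonzero_on_graph G L (soliton_fun l k T)"
proof -
  obtain l' where l': "l' \<in> half_lines G L" using half_line_exists by auto
  then have "Vertex (tail G l') \<in> graph_points G L"
    using tail_core half_linesD(1) by (auto simp: graph_points_def core_def)
  moreover have "soliton_fun l k T (Vertex (tail G l')) \<noteq> 0"
    using soliton_pos[of T] by (simp add: soliton_fun_def)
  ultimately show ?thesis unfolding nonzero_on_graph_def by blast
qed

lemma card_half_lines_pos: "real (card (half_lines G L)) > 0"
  using half_line_exists arcs_split(3) by (simp add: card_gt_0_iff)

lemma total_length_nonneg: "total_length \<ge> 0"
  unfolding total_length_def
proof (rule sum_nonneg)
  fix e assume "e \<in> bounded_arcs"
  then show "0 \<le> real_of_ereal (L e)"
    using length_pos[of e] by (simp add: bounded_arcs_def real_of_ereal_pos)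
qed

lemma centred_soliton:
  assumes k: "k > 0" and l: "l \<in> half_lines G L"
  defines "N \<equiv> real (card (half_lines G L))"
  shows "mass (soliton_fun l k 0) = N * pi / (2 * k) + total_length"
    "kin (soliton_fun l k 0) = N * k * pi / 16" "pi / (4 * k) \<le> pot (soliton_fun l k 0)"
proof -
  have z: "(if e = l then - 0 else 0) = (0 :: real)" for e by simp
  show "mass (soliton_fun l k 0) = N * pi / (2 * k) + total_length"
    "kin (soliton_fun l k 0) = N * k * pi / 16" "pi / (4 * k) \<le> pot (soliton_fun l k 0)"
    using soliton_fun_mass[OF k, of l 0] soliton_fun_kin[OF k, of l 0] soliton_fun_pot[OF k l, of 0]
    unfolding z by (simp_all add: gd_def sc2_def N_def)
qed

text \<open>The supremum \<open>S\<close> is finite by the half-line inequality and positive because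
  of a soliton, so the equation in the definite description has the single positive solution sqrt (3
  / S). The inequality also has to be shown for functions whose quotient says nothing.\<close>

lemma critical_mass:
  shows "critical_mass G L > 0"
    and "u \<in> H1_graph G L \<Longrightarrow> (critical_mass G L)\<^sup>2 * pot u \<le> 3 * (mass u)\<^sup>2 * kin u"
proof -
  define X where "X = {u \<in> H1_graph G L. nonzero_on_graph G L u}"
  define S where "S = (SUP u\<in>X. ereal (GN_quotient G L u))"
  obtain l where l: "l \<in> half_lines G L" using half_line_exists by auto
  let ?w = "soliton_fun l 1 0"
  have w: "?w \<in> X"
    using has_graph_deriv_H1(1)[OF has_graph_deriv_soliton[of 1 l 0]] nonzero_soliton by (simp add: X_def)
  note cs = centred_soliton[of 1 l, OF zero_less_one l]
  have "mass ?w > 0" "kin ?w > 0" "pot ?w > 0"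
    unfolding cs(1,2) using card_half_lines_pos total_length_nonneg cs(3)
    by (auto intro!: add_pos_nonneg mult_pos_pos divide_pos_pos intro: less_le_trans[of 0 "pi/4"])
  then have Qw: "GN_quotient G L ?w > 0" by (simp add: GN_quotient_def)
  have "S \<ge> ereal (GN_quotient G L ?w)" unfolding S_def by (rule SUP_upper[OF w])
  moreover have "S \<le> ereal (3 / half_line_mass\<^sup>2)"
    unfolding S_def
  proof (rule SUP_least)
    fix u assume "u \<in> X"
    then have gn: "half_line_mass\<^sup>2 * pot u \<le> 3 * (mass u)\<^sup>2 * kin u" using GN_half_line by (auto simp: X_def)
    have "GN_quotient G L u \<le> 3 / half_line_mass\<^sup>2"
    proof (cases "(mass u)\<^sup>2 * kin u = 0")
      case True
      show ?thesis unfolding GN_quotient_def True by simp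
    next
      case False
      then have "(mass u)\<^sup>2 * kin u > 0" using kin_nonneg[of u] by (simp add: zero_less_mult_iff)
      then show ?thesis using gn half_line_mass_pos unfolding GN_quotient_def by (simp add: field_simps)
    qed
    then show "ereal (GN_quotient G L u) \<le> ereal (3 / half_line_mass\<^sup>2)" by simp
  qed
  ultimately obtain s where s: "S = ereal s" "s > 0" using Qw by (cases S) auto
  have eq: "(0 < \<mu> \<and> ereal (3 / \<mu>\<^sup>2) = S) \<longleftrightarrow> \<mu> = sqrt (3 / s)" for \<mu>
  proof
    assume a: "0 < \<mu> \<and> ereal (3 / \<mu>\<^sup>2) = S"
    then have "3 / \<mu>\<^sup>2 = s" using s by simp
    then have "\<mu>\<^sup>2 = 3 / s" using a s by (auto simp: field_simps)
    then show "\<mu> = sqrt (3 / s)" using a by (metis less_imp_le real_sqrt_unique)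
  next
    assume "\<mu> = sqrt (3 / s)"
    then show "0 < \<mu> \<and> ereal (3 / \<mu>\<^sup>2) = S" using s by simp
  qed
  have cm: "critical_mass G L = sqrt (3 / s)"
    unfolding critical_mass_def X_def[symmetric] S_def[symmetric] eq by simp
  show "critical_mass G L > 0" using cm s by simp
  assume u: "u \<in> H1_graph G L"
  show "(critical_mass G L)\<^sup>2 * pot u \<le> 3 * (mass u)\<^sup>2 * kin u"
  \<comment> \<open>With zero denominator the quotient is 0 by convention and carries no
    information; the half-line inequality shows that \<open>pot u\<close> vanishes as well.\<close>
  proof (cases "(mass u)\<^sup>2 * kin u = 0")
    case True
    have "half_line_mass\<^sup>2 * pot u \<le> 0" using GN_half_line[OF u] unfolding mult.assoc True by simp
    then have "pot u = 0" using half_line_mass_pos pot_nonneg[of u] by (simp add: mult_le_0_iff)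
    then show ?thesis using kin_nonneg[of u] by simp
  next
    case False
    then have p: "(mass u)\<^sup>2 * kin u > 0" using kin_nonneg[of u] by (simp add: zero_less_mult_iff)
    show ?thesis
    proof (cases "nonzero_on_graph G L u")
      case True
      then have "ereal (GN_quotient G L u) \<le> S" unfolding S_def using u by (intro SUP_upper) (simp add: X_def)
      then have "pot u \<le> s * ((mass u)\<^sup>2 * kin u)"
        using p s by (simp add: GN_quotient_def pos_divide_le_eq)
      then show ?thesis using s cm by (simp add: field_simps)
    next
      \<comment> \<open>A function that vanishes on all points of the graph is outside the range of
        the supremum, and its potential is computed directly.\<close>
      case False
      have "er u e x = 0" if e: "e \<in> arcs G" and x: "x \<in> edge_interior L e" for e x
      proof -
        have "Inner e x \<in> graph_points G L" using e x by (auto simp: graph_points_def)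
        moreover have "er u e x = u (Inner e x)"
          using x by (auto simp: edge_restrict_def edge_point_def edge_interior_def)
        ultimately show ?thesis using False by (auto simp: nonzero_on_graph_def)
      qed
      then have "pot u = (\<Sum>e\<in>arcs G. LBINT x:edge_interior L e. 0)"
        unfolding pot_eq using edge_interior_props(3)
        by (intro sum.cong HOL.refl set_lebesgue_integral_cong) auto
      then show ?thesis using kin_nonneg[of u] by simp
    qed
  qed
qed

lemma critical_mass_less:
  assumes "u \<in> H1_graph G L" "\<nu> > 0" "3 * (mass u)\<^sup>2 * kin u < \<nu>\<^sup>2 * pot u"
  shows "critical_mass G L < \<nu>"
proof (rule ccontr)
  assume "\<not> ?thesis"
  then have "\<nu>\<^sup>2 \<le> (critical_mass G L)\<^sup>2" using assms(2) by (intro power_mono) auto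
  then have "\<nu>\<^sup>2 * pot u \<le> (critical_mass G L)\<^sup>2 * pot u" by (rule mult_right_mono) (rule pot_nonneg)
  then show False using critical_mass(2)[OF assms(1)] assms(3) by simp
qed

text \<open>For half-solitons of width 1 / k both sides of the inequality are of order 1 / k. After
  division the bounded part enters only through k \<open>total_length\<close>, which disappears as k
  tends to 0.\<close>

lemma critical_mass_le_half_line:
  assumes one: "half_lines G L = {l}"
  shows "critical_mass G L \<le> half_line_mass"
proof -
  let ?\<mu> = "critical_mass G L"
  have bound: "?\<mu>\<^sup>2 \<le> 3 / 4 * (pi / 2 + k * total_length)\<^sup>2" if k: "k > 0" for k
  proof -
    have l: "l \<in> half_lines G L" using one by simp
    note cs = centred_soliton[OF k l, unfolded one]
    have "?\<mu>\<^sup>2 * (pi / (4 * k)) \<le> ?\<mu>\<^sup>2 * pot (soliton_fun l k 0)"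
      using cs(3) by (intro mult_left_mono) auto
    also have "\<dots> \<le> 3 * (mass (soliton_fun l k 0))\<^sup>2 * kin (soliton_fun l k 0)"
      by (intro critical_mass(2) has_graph_deriv_H1(1)[OF has_graph_deriv_soliton[OF k]])
    also have "\<dots> = 3 * (pi / (2 * k) + total_length)\<^sup>2 * (k * pi / 16)" unfolding cs(1,2) by simp
    also have "\<dots> = (3 / 4 * (pi / 2 + k * total_length)\<^sup>2) * (pi / (4 * k))"
    proof -
      have "pi / (2 * k) + total_length = (pi / 2 + k * total_length) / k" using k by (simp add: field_simps)
      then show ?thesis using k by (simp add: power_divide field_simps power2_eq_square)
    qed
    finally show ?thesis by (rule mult_right_le_imp_le) (use k in simp)
  qed
  have "((\<lambda>k. 3 / 4 * (pi / 2 + k * total_length)\<^sup>2) \<longlongrightarrow> 3 / 4 * (pi / 2 + 0 * total_length)\<^sup>2) (at_right 0)"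
    by (intro tendsto_intros)
  then have "?\<mu>\<^sup>2 \<le> 3 / 4 * (pi / 2 + 0 * total_length)\<^sup>2"
    by (rule tendsto_lowerbound) (use bound in \<open>auto simp: eventually_at_right_less intro!: eventually_at_rightI[of 0 1]\<close>)
  also have "\<dots> = half_line_mass\<^sup>2" by (simp add: half_line_mass_def power_divide power_mult_distrib)
  finally show ?thesis by (rule power2_le_imp_le) (use half_line_mass_pos in simp)
qed

text \<open>As T tends to infinity with k = 1, mass and kin tend to the whole-line values pi and pi
  / 8, and the lower bound for pot tends to pi / 2. The inequality becomes \<open>\<mu>\<close>^2 pi
  / 2 <= 3 pi^3 / 8.\<close>

lemma critical_mass_le_line: "critical_mass G L \<le> 2 * half_line_mass"
proof -
  let ?\<mu> = "critical_mass G L"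
  obtain l where l: "l \<in> half_lines G L" using half_line_exists by auto
  let ?u = "\<lambda>T. soliton_fun l 1 T" and ?s = "\<lambda>e T. if e = l then - T else T :: real"
  have bound: "?\<mu>\<^sup>2 * ((pi / 2 + gd T + sc2 T) / 2) \<le> 3 * (mass (?u T))\<^sup>2 * kin (?u T)" for T
  proof -
    have "?\<mu>\<^sup>2 * ((pi / 2 + gd T + sc2 T) / 2) \<le> ?\<mu>\<^sup>2 * pot (?u T)"
      using soliton_fun_pot[of 1 l T] l by (intro mult_left_mono) auto
    also have "\<dots> \<le> 3 * (mass (?u T))\<^sup>2 * kin (?u T)"
      by (intro critical_mass(2) has_graph_deriv_H1(1)[OF has_graph_deriv_soliton]) simp
    finally show ?thesis .
  qed
  have gdm: "((\<lambda>T. gd (?s e T)) \<longlongrightarrow> (if e = l then - (pi / 2) else pi / 2)) at_top" for e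
    by (cases "e = l") (auto simp: gd_minus intro!: tendsto_intros gd_at_top)
  have scm: "((\<lambda>T. sc2 (?s e T)) \<longlongrightarrow> 0) at_top" for e
    using tendsto_minus[OF sc2_at_top] by (cases "e = l") (auto simp: sc2_minus sc2_at_top)
  have ch: "((\<lambda>T::real. total_length / cosh T) \<longlongrightarrow> 0) at_top"
    by (rule tendsto_divide_0[OF tendsto_const]) (rule filterlim_at_top_imp_at_infinity[OF cosh_real_at_top])
  have "((\<lambda>T. mass (?u T)) \<longlongrightarrow> (\<Sum>e\<in>half_lines G L. (pi / 2 - (if e = l then - (pi / 2) else pi / 2)) / 1) + 0) at_top"
    unfolding soliton_fun_mass[of 1, OF zero_less_one] by (intro tendsto_intros gdm ch) simp
  moreover have "(\<Sum>e\<in>half_lines G L. (pi / 2 - (if e = l then - (pi / 2) else pi / 2)) / 1) + 0 = pi"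
  proof -
    have "(\<Sum>e\<in>half_lines G L. (pi / 2 - (if e = l then - (pi / 2) else pi / 2)) / 1) = (\<Sum>e\<in>half_lines G L. if e = l then pi else 0)"
      by (intro sum.cong) auto
    then show ?thesis using l arcs_split(3) by simp
  qed
  ultimately have M: "((\<lambda>T. mass (?u T)) \<longlongrightarrow> pi) at_top" by simp
  have K0: "((\<lambda>T. kin (?u T)) \<longlongrightarrow> (\<Sum>e\<in>half_lines G L. 1 * (pi / 2 - (if e = l then - (pi / 2) else pi / 2) + 0) / 8)) at_top"
    unfolding soliton_fun_kin[of 1, OF zero_less_one] by (intro tendsto_intros gdm scm) simp
  have K1: "(\<Sum>e\<in>half_lines G L. 1 * (pi / 2 - (if e = l then - (pi / 2) else pi / 2) + 0) / 8) = pi / 8"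
  proof -
    have "(\<Sum>e\<in>half_lines G L. 1 * (pi / 2 - (if e = l then - (pi / 2) else pi / 2) + 0) / 8) = (\<Sum>e\<in>half_lines G L. if e = l then pi / 8 else 0)"
      by (intro sum.cong) auto
    then show ?thesis using l arcs_split(3) by simp
  qed
  have K: "((\<lambda>T. kin (?u T)) \<longlongrightarrow> pi / 8) at_top" using K0 unfolding K1 .
  have "?\<mu>\<^sup>2 * ((pi / 2 + pi / 2 + 0) / 2) \<le> 3 * pi\<^sup>2 * (pi / 8)"
  proof (rule tendsto_le)
    show "((\<lambda>T. 3 * (mass (?u T))\<^sup>2 * kin (?u T)) \<longlongrightarrow> 3 * pi\<^sup>2 * (pi / 8)) at_top"
      by (intro tendsto_intros M K)
    show "((\<lambda>T. ?\<mu>\<^sup>2 * ((pi / 2 + gd T + sc2 T) / 2)) \<longlongrightarrow> ?\<mu>\<^sup>2 * ((pi / 2 + pi / 2 + 0) / 2)) at_top"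
      by (intro tendsto_intros gd_at_top sc2_at_top) simp
  qed (use bound in auto)
  then have "?\<mu>\<^sup>2 * (pi / 2) \<le> 3 / 4 * pi\<^sup>2 * (pi / 2)" by simp
  then have "?\<mu>\<^sup>2 \<le> 3 / 4 * pi\<^sup>2" by (rule mult_right_le_imp_le) simp
  also have "\<dots> = (2 * half_line_mass)\<^sup>2" by (simp add: half_line_mass_def power_divide power_mult_distrib)
  finally show ?thesis by (rule power2_le_imp_le) (use half_line_mass_pos in simp)
qed

end

section \<open>Optimizers of the Gagliardo-Nirenberg inequality\<close>

lemma set_integrable_compact_support:
  fixes r :: "real \<Rightarrow> real"
  assumes m: "set_borel_measurable lborel I r" and B: "\<And>t. t \<in> I \<Longrightarrow> \<bar>r t\<bar> \<le> B"
    and out: "\<And>t. t \<in> I \<Longrightarrow> t \<notin> {x..y} \<Longrightarrow> r t = 0" and I: "I \<in> sets borel"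
  shows "set_integrable lborel I r"
proof (rule set_integrable_bound[OF _ m])
  have "set_integrable lborel {x..y} (\<lambda>t. B)" by (rule borel_integrable_atLeastAtMost') auto
  then have "integrable lborel (\<lambda>t. indicator I t *\<^sub>R (indicator {x..y} t *\<^sub>R B))"
    unfolding set_integrable_def by (rule integrable_mult_indicator[rotated]) (use I in simp)
  then show "set_integrable lborel I (\<lambda>t. indicator {x..y} t * B)"
    unfolding set_integrable_def by simp
  show "AE t in lborel. t \<in> I \<longrightarrow> norm (r t) \<le> norm (indicator {x..y} t * B)"
    using B out by (intro AE_I2) (force simp: indicator_def)
qed

lemma L2_on_compact_support:
  assumes m: "set_borel_measurable lborel I r" and B: "\<And>t. t \<in> I \<Longrightarrow> \<bar>r t\<bar> \<le> B"
    and out: "\<And>t. t \<in> I \<Longrightarrow> t \<notin> {x..y} \<Longrightarrow> r t = 0" and I: "I \<in> sets borel"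
  shows "L2_on I r"
  unfolding L2_on_def power2_eq_square
proof
  show "set_integrable lborel I (\<lambda>t. r t * r t)"
  proof (rule set_integrable_compact_support[OF _ _ _ I])
    show "set_borel_measurable lborel I (\<lambda>t. r t * r t)" by (intro set_borel_measurable_mult m)
    show "\<bar>r t * r t\<bar> \<le> B * B" if "t \<in> I" for t
      unfolding abs_mult using B[OF that] by (intro mult_mono) auto
    show "r t * r t = 0" if "t \<in> I" "t \<notin> {x..y}" for t using out[OF that] by simp
  qed
qed (rule m)

context noncompact_graph
begin

section \<open>Test functions supported inside one edge\<close>

definition bump :: "'b \<Rightarrow> real \<Rightarrow> real \<Rightarrow> ('a, 'b) graph_point \<Rightarrow> real" where
  "bump f x y p = (case p of Vertex v \<Rightarrow> 0 | Inner e t \<Rightarrow> if e = f then max 0 ((t - x) * (y - t)) else 0)"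

text \<open>The positive part of p is (p + |p|) / 2, so its derivative is (1 + sgn p) p' / 2. At
  \<open>x\<close> and \<open>y\<close> themselves this yields half the slope, on a null
  set.\<close>

definition bump_deriv :: "'b \<Rightarrow> real \<Rightarrow> real \<Rightarrow> 'b \<Rightarrow> real \<Rightarrow> real" where
  "bump_deriv f x y e t = (if e = f then (1 + sgn ((t - x) * (y - t))) * (x + y - 2 * t) / 2 else 0)"

lemma interval_of_interior:
  assumes "f \<in> arcs G" "x < y" "{x<..<y} \<subseteq> edge_interior L f"
  shows "0 \<le> x" "{x..y} \<subseteq> edge_interval L f"
proof -
  show "{x..y} \<subseteq> edge_interval L f"
    using closure_mono[OF assms(3)] assms(2) edge_interior_props(5)[OF assms(1)] by simp
  then have "x \<in> edge_interval L f" using assms(2) by auto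
  then show "0 \<le> x" by (simp add: edge_interval_def)
qed

lemma er_bump:
  assumes f: "f \<in> arcs G" and xy: "x < y" "{x<..<y} \<subseteq> edge_interior L f" and t: "t \<in> edge_interval L e"
  shows "er (bump f x y) e t = (if e = f then max 0 ((t - x) * (y - t)) else 0)"
proof (cases "e = f \<and> (t = 0 \<or> ereal t = L e)")
  case True
  \<comment> \<open>An end of the edge is a vertex, where \<open>bump\<close> is 0; the formula
    agrees because {x<..<y} lies in the interior.\<close>
  have "(t - x) * (y - t) \<le> 0"
  proof (cases "t = 0")
    case True then show ?thesis using interval_of_interior[OF f xy] xy(1) by (auto simp: mult_le_0_iff)
  next
    case False
    have "y \<in> edge_interval L f" using interval_of_interior(2)[OF f xy] xy(1) by auto
    then have "y \<le> t" using True False by (auto simp: edge_interval_def) (metis ereal_less_eq(3))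
    then show ?thesis using xy(1) by (auto simp: mult_le_0_iff)
  qed
  then show ?thesis using True by (auto simp: edge_restrict_def edge_point_def bump_def)
next
  case False
  then show ?thesis by (auto simp: edge_restrict_def edge_point_def bump_def)
qed

lemma has_graph_deriv_bump:
  assumes f: "f \<in> arcs G" and xy: "x < y" "{x<..<y} \<subseteq> edge_interior L f"
  shows "has_graph_deriv (bump f x y) (bump_deriv f x y)"
  unfolding has_graph_deriv_def
proof
  fix e assume e: "e \<in> arcs G"
  note I = edge_interior_props[OF e]
  show "continuous_on (edge_interval L e) (er (bump f x y) e) \<and>
         L2_on (edge_interior L e) (er (bump f x y) e) \<and>
         L2_on (edge_interior L e) (bump_deriv f x y e) \<and>
         ac_deriv (edge_interior L e) (er (bump f x y) e) (bump_deriv f x y e)"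
  proof (cases "e = f")
    case False
    then have eq: "er (bump f x y) e = (\<lambda>t. 0)"
      by (auto simp: edge_restrict_def edge_point_def bump_def fun_eq_iff)
    show ?thesis
      unfolding eq using False
      by (auto simp: bump_deriv_def L2_on_def set_borel_measurable_def set_integrable_def ac_deriv_def)
  next
    case True
    let ?p = "\<lambda>t. (t - x) * (y - t)" and ?r = "\<lambda>t. max 0 ((t - x) * (y - t))"
    let ?I = "edge_interior L e" and ?J = "edge_interval L e"
    have eq: "t \<in> ?J \<Longrightarrow> ?r t = er (bump f x y) e t" for t using er_bump[OF f xy] True by simp
    have eqI: "t \<in> ?I \<Longrightarrow> ?r t = er (bump f x y) e t" for t using eq I(4) by auto
    have neg: "?p t < 0" if "t \<notin> {x..y}" for t using that xy(1) by (auto simp: mult_less_0_iff)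
    have cr: "continuous_on A ?r" for A by (intro continuous_intros)
    have cJ: "continuous_on ?J (er (bump f x y) e)" by (rule continuous_on_eq[OF cr eq])
    have Jb: "?J \<in> sets borel" using I(5) closed_closure by (metis borel_closed)
    have bd: "\<bar>?r t\<bar> \<le> (y - x) * (y - x)" for t
    proof (cases "t \<in> {x..y}")
      case True
      then have "?p t \<le> (y - x) * (y - x)" "0 \<le> ?p t" by (auto intro: mult_mono)
      then show ?thesis by simp
    next
      case False then show ?thesis using neg[OF False] by simp
    qed
    have L2r: "L2_on ?I (er (bump f x y) e)"
    proof (rule L2_on_compact_support[OF _ _ _ I(3)])
      show "set_borel_measurable lborel ?I (er (bump f x y) e)"
        by (rule set_borel_measurable_continuous_on[OF cJ Jb I(3,4)])
      show "\<bar>er (bump f x y) e t\<bar> \<le> (y - x) * (y - x)" if "t \<in> ?I" for t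
        using bd[of t] eqI[OF that] by simp
      show "er (bump f x y) e t = 0" if "t \<in> ?I" "t \<notin> {x..y}" for t
        using neg[OF that(2)] eqI[OF that(1)] by simp
    qed
    have L2d: "L2_on ?I (bump_deriv f x y e)"
    proof (rule L2_on_compact_support[OF _ _ _ I(3)])
      have "bump_deriv f x y e \<in> borel_measurable borel"
        unfolding bump_deriv_def using True by simp
      then show "set_borel_measurable lborel ?I (bump_deriv f x y e)"
        unfolding set_borel_measurable_def using I(3) by simp
      show out: "bump_deriv f x y e t = 0" if "t \<notin> {x..y}" for t
        using neg[OF that] by (simp add: bump_deriv_def)
      show "\<bar>bump_deriv f x y e t\<bar> \<le> y - x" for t
      proof (cases "t \<in> {x..y}")
        case t: True
        have "\<bar>1 + sgn (?p t)\<bar> * \<bar>x + y - 2 * t\<bar> \<le> 2 * (y - x)"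
          using t by (intro mult_mono) (auto simp: sgn_if)
        then show ?thesis using True by (simp add: bump_deriv_def abs_mult)
      next
        case False then show ?thesis using out xy(1) by simp
      qed
    qed
    have acp: "ac_deriv ?I ?p (\<lambda>t. x + y - 2 * t)"
      by (rule ac_deriv_C1) (auto intro!: derivative_eq_intros continuous_intros)
    have "ac_deriv ?I (\<lambda>t. 1/2 * (?p t + \<bar>?p t\<bar>)) (\<lambda>t. 1/2 * ((x + y - 2 * t) + sgn (?p t) * (x + y - 2 * t)))"
      by (intro ac_deriv_cmult ac_deriv_add acp ac_deriv_abs I(1))
    then have "ac_deriv ?I (er (bump f x y) e) (bump_deriv f x y e)"
    proof (rule ac_deriv_cong)
      show "1/2 * (?p t + \<bar>?p t\<bar>) = er (bump f x y) e t" if "t \<in> ?I" for t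
        unfolding eqI[OF that, symmetric] by simp
      show "1/2 * ((x + y - 2 * t) + sgn (?p t) * (x + y - 2 * t)) = bump_deriv f x y e t" for t
        using True by (simp add: bump_deriv_def algebra_simps)
    qed
    then show ?thesis using cJ L2r L2d by simp
  qed
qed

text \<open>
  The quantity \<open>3 mass\<^sup>2 kin - \<mu>\<^sup>2 pot\<close> is nonnegative and vanishes at an optimizer; by convexity of
  the sixth power only the linear part of \<open>pot\<close> is needed for the first variation.
\<close>

lemma euler_lagrange:
  assumes u: "has_graph_deriv u g" and w: "has_graph_deriv w k"
    and \<mu>: "\<mu> > 0" and GN: "\<And>v. v \<in> H1_graph G L \<Longrightarrow> \<mu>\<^sup>2 * pot v \<le> 3 * (mass v)\<^sup>2 * kin v"
    and m: "mass u = \<mu>" and p: "pot u = 3 * kin u"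
  shows "kin_form g k = pot_form u w - 2 * kin u / \<mu> * mass_form u w"
proof -
  define P where "P c = 3 * (mass u + 2 * c * mass_form u w + c\<^sup>2 * mass w)\<^sup>2 *
      (kin u + 2 * c * kin_form g k + c\<^sup>2 * kin w) - \<mu>\<^sup>2 * (pot u + 6 * c * pot_form u w)" for c
  have nn: "0 \<le> P c" for c
  proof -
    have "(\<lambda>q. u q + c * w q) \<in> H1_graph G L"
      by (rule has_graph_deriv_H1(1)[OF has_graph_deriv_add[OF u has_graph_deriv_cmult[OF w]]])
    from GN[OF this] have "\<mu>\<^sup>2 * pot (\<lambda>q. u q + c * w q) \<le> 3 * (mass u + 2 * c * mass_form u w + c\<^sup>2 * mass w)\<^sup>2 *
      (kin u + 2 * c * kin_form g k + c\<^sup>2 * kin w)"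
      unfolding mass_perturb[OF u w] kin_perturb[OF u w] .
    moreover have "\<mu>\<^sup>2 * (pot u + 6 * c * pot_form u w) \<le> \<mu>\<^sup>2 * pot (\<lambda>q. u q + c * w q)"
      by (intro mult_left_mono pot_perturb[OF u w]) simp
    ultimately show ?thesis by (simp add: P_def)
  qed
  have P0: "P 0 = 0" using m p by (simp add: P_def)
  have "(P has_real_derivative 3 * (2 * \<mu> * (2 * mass_form u w)) * kin u + 3 * \<mu>\<^sup>2 * (2 * kin_form g k) - \<mu>\<^sup>2 * (6 * pot_form u w)) (at 0)"
    unfolding P_def by (auto intro!: derivative_eq_intros simp: m)
  then have "3 * (2 * \<mu> * (2 * mass_form u w)) * kin u + 3 * \<mu>\<^sup>2 * (2 * kin_form g k) - \<mu>\<^sup>2 * (6 * pot_form u w) = 0"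
    by (rule DERIV_local_min[where d=1]) (use nn P0 in auto)
  then have "\<mu> * (2 * mass_form u w * kin u + \<mu> * kin_form g k - \<mu> * pot_form u w) = 0"
    by (simp add: power2_eq_square algebra_simps)
  then have "2 * mass_form u w * kin u + \<mu> * kin_form g k - \<mu> * pot_form u w = 0" using \<mu> by simp
  then show ?thesis using \<mu> by (simp add: field_simps)
qed

text \<open>
  A function that equals its maximum \<open>h\<close> on an interval would have Lagrange multiplier \<open>h\<^sup>4\<close>, but the
  multiplier is at most \<open>2 h\<^sup>4 / 3\<close>.
\<close>

lemma optimizer_not_locally_max:
  assumes u: "has_graph_deriv u g"
    and \<mu>: "\<mu> > 0" and GN: "\<And>v. v \<in> H1_graph G L \<Longrightarrow> \<mu>\<^sup>2 * pot v \<le> 3 * (mass v)\<^sup>2 * kin v"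
    and m: "mass u = \<mu>" and p: "pot u = 3 * kin u" and h: "h > 0"
    and ran: "\<And>e x. e \<in> arcs G \<Longrightarrow> x \<in> edge_interval L e \<Longrightarrow> 0 \<le> er u e x \<and> er u e x \<le> h"
    and f: "f \<in> arcs G" and xy: "x < y" "{x<..<y} \<subseteq> edge_interior L f"
    and ae: "AE t in lborel. t \<in> {x<..<y} \<longrightarrow> g f t = 0 \<and> er u f t = h"
  shows False
proof -
  note w = has_graph_deriv_bump[OF f xy]
  let ?w = "bump f x y" and ?k = "bump_deriv f x y"
  note EL = euler_lagrange[OF u w \<mu> GN m p]
  have I: "edge_interior L f \<in> sets borel" "edge_interior L f \<subseteq> edge_interval L f" using edge_interior_props[OF f] by auto
  have wf: "er ?w e t = 0" if "t \<in> edge_interval L e" "e \<noteq> f \<or> t \<notin> {x<..<y}" for e t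
  proof (cases "e = f")
    case True
    then have "(t - x) * (y - t) \<le> 0" using that(2) xy(1) by (auto simp: mult_le_0_iff)
    then show ?thesis using er_bump[OF f xy that(1)] by simp
  qed (use er_bump[OF f xy that(1)] in simp)
  \<comment> \<open>The points \<open>x\<close> and \<open>y\<close> are excluded because
    \<open>bump_deriv\<close> takes half the slope there; they are discarded later as a null
    set.\<close>
  have kf: "?k e t = 0" if "e \<noteq> f \<or> t \<notin> {x<..<y} \<and> t \<noteq> x \<and> t \<noteq> y" for e t
  proof (cases "e = f")
    case True
    then have "(t - x) * (y - t) < 0" using that xy(1) by (auto simp: mult_less_0_iff)
    then show ?thesis by (simp add: bump_deriv_def)
  qed (simp add: bump_deriv_def)
  have zero: "(LBINT t:edge_interior L e. F t) = 0" if "\<And>t. t \<in> edge_interior L e \<Longrightarrow> F t = 0" "e \<in> arcs G" for e F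
  proof -
    have "(LBINT t:edge_interior L e. F t) = (LBINT t:edge_interior L e. 0)"
      using that edge_interior_props(3) by (intro set_lebesgue_integral_cong) auto
    then show ?thesis by simp
  qed
  have "kin_form g ?k = (\<Sum>e\<in>arcs G. if e = f then (LBINT t:edge_interior L f. g f t * ?k f t) else 0)"
    unfolding kin_form_def by (intro sum.cong HOL.refl) (auto intro!: zero simp: kf)
  also have "\<dots> = (LBINT t:edge_interior L f. g f t * ?k f t)" using f by simp
  also have "\<dots> = 0"
    unfolding set_lebesgue_integral_def
  proof (rule integral_eq_zero_AE)
    have "AE t in lborel. t \<noteq> x" "AE t in lborel. t \<noteq> y" by (rule AE_lborel_singleton)+
    with ae show "AE t in lborel. indicator (edge_interior L f) t *\<^sub>R (g f t * ?k f t) = 0"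
      by eventually_elim (use kf in \<open>auto simp: indicator_def\<close>)
  qed
  finally have K: "kin_form g ?k = 0" .
  define W where "W = (LBINT t:edge_interior L f. er ?w f t)"
  have wL2: "L2_on (edge_interior L f) (er ?w f)"
    using has_graph_derivD[OF w f] by auto
  have wm: "set_borel_measurable lborel (edge_interior L f) (er ?w f)" using L2_onD(1)[OF wL2] .
  have wi: "set_integrable lborel (edge_interior L f) (er ?w f)"
  proof -
    obtain B where "\<And>e t. e \<in> arcs G \<Longrightarrow> t \<in> edge_interval L e \<Longrightarrow> \<bar>er ?w e t\<bar> \<le> B"
      using has_graph_deriv_bounded[OF w] by metis
    then show ?thesis
      using f I wf by (intro set_integrable_compact_support[OF wm, of B x y]) (auto simp: subset_iff)
  qed
  have um: "set_borel_measurable lborel (edge_interior L f) (er u f)" using L2_onD(1)[OF has_graph_derivD(2)[OF u f]] .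
  have pow: "(LBINT t:edge_interior L f. er u f t ^ n * er ?w f t) = h ^ n * W"
    if i: "set_borel_measurable lborel (edge_interior L f) (\<lambda>t. er u f t ^ n * er ?w f t)" for n
  proof -
    have "(LBINT t:edge_interior L f. er u f t ^ n * er ?w f t) = (LBINT t:edge_interior L f. h ^ n * er ?w f t)"
      unfolding set_lebesgue_integral_def
    proof (rule integral_cong_AE)
      show "(\<lambda>t. indicator (edge_interior L f) t *\<^sub>R (er u f t ^ n * er ?w f t)) \<in> borel_measurable lborel"
        using i unfolding set_borel_measurable_def .
      show "(\<lambda>t. indicator (edge_interior L f) t *\<^sub>R (h ^ n * er ?w f t)) \<in> borel_measurable lborel"
        using set_borel_measurable_cmult[OF wm] unfolding set_borel_measurable_def .
      show "AE t in lborel. indicator (edge_interior L f) t *\<^sub>R (er u f t ^ n * er ?w f t) =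
          indicator (edge_interior L f) t *\<^sub>R (h ^ n * er ?w f t)"
        using ae
      proof eventually_elim
        case (elim t)
        then show ?case using wf[of t f] I(2) by (cases "t \<in> {x<..<y}") (auto simp: indicator_def)
      qed
    qed
    then show ?thesis by (simp add: W_def)
  qed
  have X: "pot_form u ?w = h ^ 5 * W"
  proof -
    have "pot_form u ?w = (\<Sum>e\<in>arcs G. if e = f then (LBINT t:edge_interior L f. er u f t ^ 5 * er ?w f t) else 0)"
      unfolding pot_form_def using edge_interior_props(4)
      by (intro sum.cong HOL.refl) (auto intro!: zero simp: wf subset_iff)
    also have "\<dots> = h ^ 5 * W"
      using f pow[OF set_integrable_imp_measurable[OF power5_mult_integrable[OF u w f]]] by simp
    finally show ?thesis .
  qed
  have B: "mass_form u ?w = h * W"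
  proof -
    have "mass_form u ?w = (\<Sum>e\<in>arcs G. if e = f then (LBINT t:edge_interior L f. er u f t * er ?w f t) else 0)"
      unfolding mass_form_def using edge_interior_props(4)
      by (intro sum.cong HOL.refl) (auto intro!: zero simp: wf subset_iff)
    also have "\<dots> = h * W" using f pow[of 1] set_borel_measurable_mult[OF um wm] by simp
    finally show ?thesis .
  qed
  have W: "W > 0"
    unfolding W_def
  proof (rule set_integral_continuous_pos[OF edge_interior_props(1)[OF f] _ _ wi])
    show "continuous_on (edge_interior L f) (er ?w f)"
      using has_graph_derivD(1)[OF w f] I(2) continuous_on_subset by blast
    have er: "er ?w f t = max 0 ((t - x) * (y - t))" if "t \<in> edge_interior L f" for t
      using er_bump[OF f xy, of t f] I(2) that by auto
    show "0 \<le> er ?w f t" if "t \<in> edge_interior L f" for t using er[OF that] by simp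
    show mid: "(x + y) / 2 \<in> edge_interior L f" using xy by auto
    have "((x + y) / 2 - x) * (y - (x + y) / 2) > 0" using xy(1) by (intro mult_pos_pos) (simp_all add: field_simps)
    then show "0 < er ?w f ((x + y) / 2)" using er[OF mid] by simp
  qed
  have "0 = (h ^ 4 - 2 * kin u / \<mu>) * (h * W)"
    using EL unfolding K X B by (simp add: algebra_simps eval_nat_numeral)
  then have "h ^ 4 = 2 * kin u / \<mu>" using h W by simp
  then have "3 * h ^ 4 * \<mu> = 2 * pot u" using \<mu> p by (simp add: field_simps)
  moreover have "pot u \<le> h ^ 4 * \<mu>" using pot_le_sup[OF u ran] m by simp
  moreover have "0 < h ^ 4 * \<mu>" using h \<mu> by simp
  ultimately show False by linarith
qed

end

section \<open>Strict positivity of nonnegative solutions\<close>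

context noncompact_graph
begin

lemma er_soliton_pos: "er (soliton_fun l k T) e x > 0"
  by (cases "L e = \<infinity>") (simp_all add: er_soliton_fun soliton_pos)

context
  fixes u g \<kappa>
  assumes u: "has_graph_deriv u g" and nn: "nonneg_fun u" and \<kappa>: "\<kappa> \<ge> 0"
    and EL: "\<And>w k. has_graph_deriv w k \<Longrightarrow> kin_form g k = pot_form u w - \<kappa> * mass_form u w"
begin

lemma u_nonneg: "e \<in> arcs G \<Longrightarrow> x \<in> edge_interval L e \<Longrightarrow> 0 \<le> er u e x"
  using nn by (auto simp: nonneg_fun_def)

text \<open>
  Testing the Euler-Lagrange equation with \<open>\<eta>\<^sup>2 / (u + \<epsilon>)\<close> bounds \<open>\<integral> \<eta>\<^sup>2 \<bar>(ln (u + \<epsilon>))'\<bar>\<^sup>2\<close>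
  uniformly in \<open>\<epsilon>\<close>, so \<open>ln (u + \<epsilon>)\<close> has bounded oscillation and \<open>u\<close> cannot vanish anywhere.
\<close>

lemma log_gradient_bound:
  fixes l :: 'b
  defines "\<eta> \<equiv> soliton_fun l 1 0"
  shows "\<exists>C. \<forall>\<epsilon>>0. \<forall>e\<in>arcs G.
     set_integrable lborel (edge_interior L e) (\<lambda>t. (er \<eta> e t * (g e t / (er u e t + \<epsilon>)))\<^sup>2) \<and>
     (LBINT t:edge_interior L e. (er \<eta> e t * (g e t / (er u e t + \<epsilon>)))\<^sup>2) \<le> C"
proof (intro exI allI impI)
  fix \<epsilon> :: real assume \<epsilon>: "\<epsilon> > 0"
  define \<zeta> where "\<zeta> = soliton_fun_deriv l 1 0"
  have h\<eta>: "has_graph_deriv \<eta> \<zeta>" unfolding \<eta>_def \<zeta>_def by (rule has_graph_deriv_soliton) simp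
  define F where "F t = 1 / (t + \<epsilon>)" for t :: real
  define F' where "F' t = - (1 / (t + \<epsilon>)\<^sup>2)" for t :: real
  define B where "B = 1 / \<epsilon> + 1 / \<epsilon>\<^sup>2"
  have FB: "\<bar>F t\<bar> \<le> B" "\<bar>F' t\<bar> \<le> B" if "t \<in> {0..}" for t
  proof -
    have "1 / (t + \<epsilon>) \<le> 1 / \<epsilon>" "0 \<le> 1 / (t + \<epsilon>)" "1 / (t + \<epsilon>)\<^sup>2 \<le> 1 / \<epsilon>\<^sup>2"
      using that \<epsilon> by (auto intro!: divide_left_mono power_mono)
    moreover have "0 \<le> 1 / \<epsilon>\<^sup>2" "0 \<le> 1 / \<epsilon>" using \<epsilon> by auto
    moreover have "0 \<le> 1 / (t + \<epsilon>)\<^sup>2" by simp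
    ultimately show "\<bar>F t\<bar> \<le> B" "\<bar>F' t\<bar> \<le> B" unfolding F_def F'_def B_def by linarith+
  qed
  have dF: "(F has_real_derivative F' t) (at t)" if "t \<in> {0..}" for t
    unfolding F_def F'_def using that \<epsilon>
    by (auto intro!: derivative_eq_intros simp: power2_eq_square)
  have cF: "continuous_on {0..} F" "continuous_on {0..} F'"
    unfolding F_def F'_def using \<epsilon> by (auto intro!: continuous_intros)
  \<comment> \<open>The factor \<open>\<eta>\<close>^2 makes 1 / (u + \<open>\<epsilon>\<close>)
    admissible on half-lines. It is a square so that the cross term in the derivative can be
    absorbed by completing a square.\<close>
  define w where "w p = (\<eta> p * \<eta> p) * F (u p)" for p
  define k where "k e x = er (\<lambda>p. \<eta> p * \<eta> p) e x * (F' (er u e x) * g e x) +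
      F (er u e x) * (er \<eta> e x * \<zeta> e x + er \<eta> e x * \<zeta> e x)" for e x
  have hw: "has_graph_deriv w k"
    unfolding w_def k_def
    by (rule has_graph_deriv_mult_compose[OF has_graph_deriv_mult[OF h\<eta> h\<eta>] u, where T="{0..}" and B=B])
      (use u_nonneg dF cF FB in \<open>auto simp: is_interval_ci\<close>)
  define a where "a e t = er \<eta> e t * (g e t / (er u e t + \<epsilon>))" for e t
  have er\<eta>: "er (\<lambda>p. \<eta> p * \<eta> p) e x = er \<eta> e x * er \<eta> e x" for e x
    by (simp add: edge_restrict_def)
  have erw: "er w e x = (er \<eta> e x)\<^sup>2 / (er u e x + \<epsilon>)" for e x
    by (simp add: edge_restrict_def w_def F_def power2_eq_square)
  have L2a: "L2_on (edge_interior L e) (a e)" if e: "e \<in> arcs G" for e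
  proof -
    note I = edge_interior_props[OF e]
    have Jb: "edge_interval L e \<in> sets borel" using I(5) closed_closure by (metis borel_closed)
    obtain K where K: "K \<ge> 0" "\<And>e x. e \<in> arcs G \<Longrightarrow> x \<in> edge_interval L e \<Longrightarrow> \<bar>er \<eta> e x\<bar> \<le> K"
      using has_graph_deriv_bounded[OF h\<eta>] by metis
    have c: "continuous_on (edge_interval L e) (\<lambda>t. er \<eta> e t * F (er u e t))"
      by (intro continuous_intros has_graph_derivD[OF h\<eta> e] continuous_on_compose2[OF cF(1) has_graph_derivD(1)[OF u e]])
        (use u_nonneg e in auto)
    have "L2_on (edge_interior L e) (\<lambda>t. (er \<eta> e t * F (er u e t)) * g e t)"
    proof (rule L2_on_bounded_mult[OF has_graph_derivD(3)[OF u e]])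
      show "set_borel_measurable lborel (edge_interior L e) (\<lambda>t. er \<eta> e t * F (er u e t))"
        by (rule set_borel_measurable_continuous_on[OF c Jb I(3,4)])
      show "\<bar>er \<eta> e t * F (er u e t)\<bar> \<le> K * B" if "t \<in> edge_interior L e" for t
        unfolding abs_mult using K FB u_nonneg[OF e] I(4) e that by (intro mult_mono) auto
    qed
    then show ?thesis by (simp add: a_def[abs_def] F_def)
  qed
  \<comment> \<open>Here g k = - a^2 + 2 a \<open>\<zeta>\<close>, and 2 a \<open>\<zeta>\<close> <=
    a^2 / 2 + 2 \<open>\<zeta>\<close>^2.\<close>
  have point: "g e t * k e t \<le> - (1/2) * (a e t)\<^sup>2 + 2 * (\<zeta> e t)\<^sup>2"
    if e: "e \<in> arcs G" "t \<in> edge_interior L e" for e t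
  proof -
    have p: "er u e t + \<epsilon> > 0" using u_nonneg[OF e(1)] e(2) edge_interior_props(4)[OF e(1)] \<epsilon> by (auto intro: add_nonneg_pos)
    have "g e t * k e t = - (a e t)\<^sup>2 + 2 * a e t * \<zeta> e t"
      unfolding k_def er\<eta> a_def F_def F'_def using p by (simp add: field_simps power2_eq_square)
    moreover have "0 \<le> (a e t - 2 * \<zeta> e t)\<^sup>2" by simp
    ultimately show ?thesis by (simp add: power2_eq_square algebra_simps)
  qed
  have "kin_form g k \<le> (\<Sum>e\<in>arcs G. - (1/2) * (LBINT t:edge_interior L e. (a e t)\<^sup>2) + 2 * (LBINT t:edge_interior L e. (\<zeta> e t)\<^sup>2))"
    unfolding kin_form_def
  proof (intro sum_mono)
    fix e assume e: "e \<in> arcs G"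
    have ia: "set_integrable lborel (edge_interior L e) (\<lambda>t. - (1/2) * (a e t)\<^sup>2)"
      "set_integrable lborel (edge_interior L e) (\<lambda>t. 2 * (\<zeta> e t)\<^sup>2)"
      by (intro set_integrable_mult_right L2_onD(2) L2a[OF e] has_graph_derivD(3)[OF h\<eta> e])+
    have "(LBINT t:edge_interior L e. g e t * k e t) \<le> (LBINT t:edge_interior L e. - (1/2) * (a e t)\<^sup>2 + 2 * (\<zeta> e t)\<^sup>2)"
      by (intro set_integral_mono L2_on_mult has_graph_derivD(3)[OF u e] has_graph_derivD(3)[OF hw e]
          set_integral_add(1) ia point[OF e])
    also have "\<dots> = - (1/2) * (LBINT t:edge_interior L e. (a e t)\<^sup>2) + 2 * (LBINT t:edge_interior L e. (\<zeta> e t)\<^sup>2)"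
      by (subst set_integral_add(2)[OF ia]) (simp only: set_integral_mult_right)
    finally show "(LBINT t:edge_interior L e. g e t * k e t) \<le> - (1/2) * (LBINT t:edge_interior L e. (a e t)\<^sup>2) + 2 * (LBINT t:edge_interior L e. (\<zeta> e t)\<^sup>2)" .
  qed
  also have "\<dots> = - (1/2) * (\<Sum>e\<in>arcs G. LBINT t:edge_interior L e. (a e t)\<^sup>2) + 2 * kin \<eta>"
    unfolding has_graph_deriv_H1(2)[OF h\<eta>] by (simp only: sum.distrib sum_distrib_left)
  finally have 1: "kin_form g k \<le> - (1/2) * (\<Sum>e\<in>arcs G. LBINT t:edge_interior L e. (a e t)\<^sup>2) + 2 * kin \<eta>" .
  \<comment> \<open>Since u / (u + \<open>\<epsilon>\<close>) <= 1, the mass term is bounded by the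
    mass of \<open>\<eta>\<close>, uniformly in \<open>\<epsilon>\<close>; the potential term has
    the favourable sign.\<close>
  have erw_nn: "0 \<le> er w e t" "er u e t * er w e t \<le> (er \<eta> e t)\<^sup>2" "0 \<le> er u e t" if e: "e \<in> arcs G" "t \<in> edge_interior L e" for e t
  proof -
    show un: "0 \<le> er u e t" using u_nonneg[OF e(1)] e(2) edge_interior_props(4)[OF e(1)] by auto
    then show "0 \<le> er w e t" unfolding erw using \<epsilon> by (intro divide_nonneg_pos) auto
    have "er u e t * (er \<eta> e t)\<^sup>2 \<le> (er u e t + \<epsilon>) * (er \<eta> e t)\<^sup>2" using \<epsilon> by (intro mult_right_mono) auto
    then have "er u e t * (er \<eta> e t)\<^sup>2 \<le> (er \<eta> e t)\<^sup>2 * (er u e t + \<epsilon>)" by (simp only: mult.commute)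
    then show "er u e t * er w e t \<le> (er \<eta> e t)\<^sup>2"
      unfolding erw using un \<epsilon> by (simp add: pos_divide_le_eq add_nonneg_pos)
  qed
  have 2: "0 \<le> pot_form u w"
    unfolding pot_form_def
    by (intro sum_nonneg set_integral_nonneg_real mult_nonneg_nonneg zero_le_power) (use erw_nn in auto)
  have 3: "mass_form u w \<le> mass \<eta>"
    unfolding mass_form_def mass_eq
    by (intro sum_mono set_integral_mono L2_on_mult has_graph_derivD(2)[OF u] has_graph_derivD(2)[OF hw]
        L2_onD(2)[OF has_graph_derivD(2)[OF h\<eta>]] erw_nn)
  have "\<kappa> * mass_form u w \<le> \<kappa> * mass \<eta>" using 3 \<kappa> by (rule mult_left_mono)
  then have tot: "(\<Sum>e\<in>arcs G. LBINT t:edge_interior L e. (a e t)\<^sup>2) \<le> 4 * kin \<eta> + 2 * \<kappa> * mass \<eta>"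
    using 1 2 EL[OF hw] by linarith
  show "\<forall>e\<in>arcs G.
     set_integrable lborel (edge_interior L e) (\<lambda>t. (er \<eta> e t * (g e t / (er u e t + \<epsilon>)))\<^sup>2) \<and>
     (LBINT t:edge_interior L e. (er \<eta> e t * (g e t / (er u e t + \<epsilon>)))\<^sup>2) \<le> 4 * kin \<eta> + 2 * \<kappa> * mass \<eta>"
  proof
    fix e assume e: "e \<in> arcs G"
    have "(LBINT t:edge_interior L e. (a e t)\<^sup>2) \<le> (\<Sum>e\<in>arcs G. LBINT t:edge_interior L e. (a e t)\<^sup>2)"
      using e by (intro member_le_sum) (auto intro!: set_integral_nonneg_real)
    then show "set_integrable lborel (edge_interior L e) (\<lambda>t. (er \<eta> e t * (g e t / (er u e t + \<epsilon>)))\<^sup>2) \<and>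
     (LBINT t:edge_interior L e. (er \<eta> e t * (g e t / (er u e t + \<epsilon>)))\<^sup>2) \<le> 4 * kin \<eta> + 2 * \<kappa> * mass \<eta>"
      using tot L2_onD(2)[OF L2a[OF e]] unfolding a_def by simp
  qed
qed

text \<open>On the compact segment \<open>\<eta>\<close> is bounded below by some c > 0, so the
  weighted bound controls the integral of V^2 for V = (ln (u + \<open>\<epsilon>\<close>))'. Then
  2|V| <= 1 + V^2 bounds the oscillation by a constant that does not involve
  \<open>\<epsilon>\<close>.\<close>

lemma log_oscillation_edge:
  assumes e: "e \<in> arcs G" and xy: "x \<in> edge_interval L e" "y \<in> edge_interval L e"
  shows "\<exists>K. \<forall>\<epsilon>>0. \<bar>ln (er u e y + \<epsilon>) - ln (er u e x + \<epsilon>)\<bar> \<le> K"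
proof -
  have less: "\<exists>K. \<forall>\<epsilon>>0. \<bar>ln (er u e y + \<epsilon>) - ln (er u e x + \<epsilon>)\<bar> \<le> K"
    if xy: "x \<in> edge_interval L e" "y \<in> edge_interval L e" "x < y" for x y
  proof -
    \<comment> \<open>With offset 0 the function is the same for every distinguished edge, so an
      arbitrary one can be named.\<close>
    define \<eta> where "\<eta> = soliton_fun undefined 1 0"
    have h\<eta>: "has_graph_deriv \<eta> (soliton_fun_deriv undefined 1 0)" unfolding \<eta>_def by (rule has_graph_deriv_soliton) simp
    obtain C where "\<forall>\<epsilon>>0. \<forall>e\<in>arcs G.
       set_integrable lborel (edge_interior L e) (\<lambda>t. (er \<eta> e t * (g e t / (er u e t + \<epsilon>)))\<^sup>2) \<and>
       (LBINT t:edge_interior L e. (er \<eta> e t * (g e t / (er u e t + \<epsilon>)))\<^sup>2) \<le> C"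
      using log_gradient_bound[of undefined] unfolding \<eta>_def by (elim exE)
    note C = this[rule_format]
    note I = edge_interior_props[OF e]
    have sub: "{x..y} \<subseteq> edge_interval L e" "{x<..<y} \<subseteq> edge_interior L e"
      using e xy by (cases rule: edge_cases; auto)+
    obtain z where z: "z \<in> {x..y}" "\<And>t. t \<in> {x..y} \<Longrightarrow> er \<eta> e z \<le> er \<eta> e t"
      using continuous_attains_inf[of "{x..y}" "er \<eta> e"] xy(3) continuous_on_subset[OF has_graph_derivD(1)[OF h\<eta> e] sub(1)] by auto
    define c where "c = er \<eta> e z"
    have c: "c > 0" unfolding c_def \<eta>_def by (rule er_soliton_pos)
    have "\<bar>ln (er u e y + \<epsilon>) - ln (er u e x + \<epsilon>)\<bar> \<le> (y - x) / 2 + C / (2 * c\<^sup>2)" if \<epsilon>: "\<epsilon> > 0" for \<epsilon>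
    proof (rule closure_bound_oscillation[OF xy(3)])
      have up: "er u e t + \<epsilon> > 0" if "t \<in> edge_interval L e" for t
        using u_nonneg[OF e that] \<epsilon> by simp
      show "continuous_on {x..y} (\<lambda>t. ln (er u e t + \<epsilon>))"
        by (intro continuous_intros continuous_on_subset[OF has_graph_derivD(1)[OF u e] sub(1)])
          (use up sub(1) in \<open>force simp: subset_iff\<close>)
      fix s t assume st: "x < s" "s \<le> t" "t < y"
      let ?V = "\<lambda>t. g e t / (er u e t + \<epsilon>)"
      have "ac_deriv (edge_interior L e) (\<lambda>t. ln (er u e t + \<epsilon>)) (\<lambda>t. (1 / (er u e t + \<epsilon>)) * g e t)"
        by (rule ac_deriv_chain[OF has_graph_derivD(4)[OF u e] I(1), where T="{0..}" and F="\<lambda>t. ln (t + \<epsilon>)"])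
          (use u_nonneg[OF e] I(4) \<epsilon> in \<open>auto simp: is_interval_ci intro!: derivative_eq_intros continuous_intros\<close>)
      then have ac: "ac_deriv (edge_interior L e) (\<lambda>t. ln (er u e t + \<epsilon>)) ?V" by simp
      have stI: "{s..t} \<subseteq> edge_interior L e" using st sub(2) by auto
      have stI': "{s<..t} \<subseteq> edge_interior L e" "{s<..t} \<subseteq> {x..y}" using st stI by auto
      have iV: "set_integrable lborel {s<..t} ?V" using ac_derivD(1)[OF ac st(2) stI] .
      have ia: "set_integrable lborel {s<..t} (\<lambda>r. (er \<eta> e r * ?V r)\<^sup>2)"
        by (rule set_integrable_subset[OF _ _ stI'(1)]) (use C \<epsilon> e in auto)
      have i1: "set_integrable lborel {s<..t} (\<lambda>r. 1/2 :: real)" by (rule set_integrable_continuous_Ioc) auto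
      have i2: "set_integrable lborel {s<..t} (\<lambda>r. 1 / (2 * c\<^sup>2) * (er \<eta> e r * ?V r)\<^sup>2)" using ia by simp
      have "\<bar>ln (er u e t + \<epsilon>) - ln (er u e s + \<epsilon>)\<bar> \<le> (LBINT r:{s<..t}. \<bar>?V r\<bar>)"
        using set_integral_norm_bound[OF iV] ac_derivD(2)[OF ac st(2) stI] by simp
      also have "\<dots> \<le> (LBINT r:{s<..t}. 1/2 + 1 / (2 * c\<^sup>2) * (er \<eta> e r * ?V r)\<^sup>2)"
      proof (intro set_integral_mono set_integrable_abs iV set_integral_add(1) i1 i2)
        fix r assume r: "r \<in> {s<..t}"
        have "c\<^sup>2 \<le> (er \<eta> e r)\<^sup>2" using z(2)[of r] c stI'(2) r unfolding c_def by (intro power_mono) auto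
        then have "c\<^sup>2 * (?V r)\<^sup>2 \<le> (er \<eta> e r * ?V r)\<^sup>2" unfolding power_mult_distrib by (rule mult_right_mono) simp
        moreover have "Y \<le> 1 / c\<^sup>2 * X" if "c\<^sup>2 * Y \<le> X" for X Y :: real
          using that c by (simp add: field_simps)
        ultimately have "(?V r)\<^sup>2 \<le> 1 / c\<^sup>2 * (er \<eta> e r * ?V r)\<^sup>2" by blast
        moreover have "2 * \<bar>Y\<bar> \<le> 1 + Y\<^sup>2" for Y :: real using sum_squares_bound[of 1 "\<bar>Y\<bar>"] by simp
        from this[of "?V r"] have "2 * \<bar>?V r\<bar> \<le> 1 + (?V r)\<^sup>2" .
        ultimately show "\<bar>?V r\<bar> \<le> 1/2 + 1 / (2 * c\<^sup>2) * (er \<eta> e r * ?V r)\<^sup>2" by simp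
      qed
      also have "\<dots> = (t - s) / 2 + 1 / (2 * c\<^sup>2) * (LBINT r:{s<..t}. (er \<eta> e r * ?V r)\<^sup>2)"
        by (subst set_integral_add(2)[OF i1 i2]) (use st(2) in \<open>simp add: set_integral_const\<close>)
      also have "\<dots> \<le> (y - x) / 2 + 1 / (2 * c\<^sup>2) * C"
      proof (intro add_mono mult_left_mono)
        have "(LBINT r:{s<..t}. (er \<eta> e r * ?V r)\<^sup>2) \<le> (LBINT r:edge_interior L e. (er \<eta> e r * ?V r)\<^sup>2)"
          by (rule set_integral_mono_set[OF _ stI'(1)]) (use C \<epsilon> e in auto)
        then show "(LBINT r:{s<..t}. (er \<eta> e r * ?V r)\<^sup>2) \<le> C" using C[OF \<epsilon> e] by linarith
      qed (use st in auto)
      finally show "\<bar>ln (er u e t + \<epsilon>) - ln (er u e s + \<epsilon>)\<bar> \<le> (y - x) / 2 + C / (2 * c\<^sup>2)" by simp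
    qed
    then show ?thesis by blast
  qed
  consider "x < y" | "y < x" | "x = y" by linarith
  then show ?thesis
  proof cases
    case 1 then show ?thesis using less xy by blast
  next
    case 2 then show ?thesis using less[of y x] xy by (simp add: abs_minus_commute)
  next
    case 3 then show ?thesis by (intro exI[of _ 0]) simp
  qed
qed

text \<open>The arc set of a shortest path is chosen before the potential, so one finite sum of edge
  constants serves for ln (u + \<open>\<epsilon>\<close>) with every
  \<open>\<epsilon>\<close>.\<close>

lemma log_oscillation_vertex:
  assumes v: "v \<in> core" and w: "w \<in> core"
  shows "\<exists>K. \<forall>\<epsilon>>0. \<bar>ln (u (Vertex w) + \<epsilon>) - ln (u (Vertex v) + \<epsilon>)\<bar> \<le> K"
proof -
  have "\<exists>K. \<forall>\<epsilon>>0. \<bar>ln (u (Vertex (head G e)) + \<epsilon>) - ln (u (Vertex (tail G e)) + \<epsilon>)\<bar> \<le> K" if e: "e \<in> bounded_arcs" for e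
  proof -
    have "L e \<noteq> \<infinity>" using e by (auto simp: bounded_arcs_def half_lines_def)
    then obtain l where l: "l > 0" "L e = ereal l" "edge_interval L e = {0..l}"
      using edge_cases[OF bounded_arcsD[OF e]] by metis
    then have "er u e 0 = u (Vertex (tail G e))" "er u e l = u (Vertex (head G e))"
      by (auto simp: edge_restrict_def edge_point_def)
    then show ?thesis using log_oscillation_edge[OF bounded_arcsD[OF e], of 0 l] l by simp
  qed
  then obtain K where K: "\<And>e \<epsilon>. e \<in> bounded_arcs \<Longrightarrow> \<epsilon> > 0 \<Longrightarrow>
      \<bar>ln (u (Vertex (head G e)) + \<epsilon>) - ln (u (Vertex (tail G e)) + \<epsilon>)\<bar> \<le> K e" by metis
  obtain F where F: "\<And>(\<psi> :: 'a \<Rightarrow> real) c. (\<forall>e\<in>bounded_arcs. \<bar>\<psi> (head G e) - \<psi> (tail G e)\<bar> \<le> c e) \<Longrightarrow> \<bar>\<psi> w - \<psi> v\<bar> \<le> sum c F"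
    using shortest_path_arcs[OF v w] by metis
  have "\<bar>ln (u (Vertex w) + \<epsilon>) - ln (u (Vertex v) + \<epsilon>)\<bar> \<le> sum K F" if "\<epsilon> > 0" for \<epsilon>
    by (rule F) (use K that in auto)
  then show ?thesis by blast
qed

text \<open>Joining a zero of u to a point with value q > 0 through the tails of their edges would
  bound ln (q + \<open>\<epsilon>\<close>) - ln \<open>\<epsilon>\<close> uniformly, whereas this
  tends to infinity as \<open>\<epsilon>\<close> tends to 0.\<close>

lemma positive_everywhere:
  assumes e0: "e0 \<in> arcs G" "x0 \<in> edge_interval L e0" "er u e0 x0 > 0"
    and e: "e \<in> arcs G" "x \<in> edge_interval L e"
  shows "er u e x > 0"
proof (rule ccontr)
  assume "\<not> ?thesis"
  then have z: "er u e x = 0" using u_nonneg[OF e] by simp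
  have tail: "0 \<in> edge_interval L e'" "er u e' 0 = u (Vertex (tail G e'))" if "e' \<in> arcs G" for e'
    using length_pos[OF that] by (auto simp: edge_interval_def edge_restrict_def edge_point_def zero_ereal_def)
  obtain K1 where K1: "\<And>\<epsilon>. \<epsilon> > 0 \<Longrightarrow> \<bar>ln (er u e x + \<epsilon>) - ln (er u e 0 + \<epsilon>)\<bar> \<le> K1"
    using log_oscillation_edge[OF e(1) tail(1)[OF e(1)] e(2)] by blast
  obtain K2 where K2: "\<And>\<epsilon>. \<epsilon> > 0 \<Longrightarrow> \<bar>ln (er u e0 x0 + \<epsilon>) - ln (er u e0 0 + \<epsilon>)\<bar> \<le> K2"
    using log_oscillation_edge[OF e0(1) tail(1)[OF e0(1)] e0(2)] by blast
  obtain K3 where K3: "\<And>\<epsilon>. \<epsilon> > 0 \<Longrightarrow> \<bar>ln (er u e0 0 + \<epsilon>) - ln (er u e 0 + \<epsilon>)\<bar> \<le> K3"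
    using log_oscillation_vertex[OF tail_core[OF e(1)] tail_core[OF e0(1)]] tail(2)[OF e(1)] tail(2)[OF e0(1)] by metis
  define K where "K = K1 + K2 + K3"
  define q where "q = er u e0 x0"
  have K: "ln (q + \<epsilon>) - ln \<epsilon> \<le> K" if "\<epsilon> > 0" for \<epsilon>
    using K1[OF that] K2[OF that] K3[OF that] z by (simp add: K_def q_def)
  \<comment> \<open>For this value ln q - ln \<open>\<epsilon>\<close> is already \<open>K\<close>,
    and ln (q + \<open>\<epsilon>\<close>) is strictly larger than ln q.\<close>
  define \<epsilon> where "\<epsilon> = q / exp K"
  have \<epsilon>: "\<epsilon> > 0" using e0 by (simp add: \<epsilon>_def q_def)
  have "ln q < ln (q + \<epsilon>)" using e0 \<epsilon> by (simp add: q_def)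
  moreover have "ln \<epsilon> = ln q - K" using e0 by (simp add: \<epsilon>_def q_def ln_div)
  ultimately show False using K[OF \<epsilon>] by simp
qed

end

end

section \<open>Graphs with a single half-line\<close>

text \<open>Every step of a chain changes the coordinate by exactly its length, so no chain is
  shorter than the difference of the coordinates; a single segment attains it.\<close>

lemma isometric_to_ray_single_arc:
  fixes G :: "('v, 'e) pre_digraph"
  assumes l: "L l = \<infinity>" and a: "arcs G = {l}" and v: "verts G = {tail G l, head G l}" and ne: "tail G l \<noteq> head G l"
  shows "isometric_to_ray G L"
proof -
  have I: "edge_interval L l = {0..}" "edge_interior L l = {0<..}"
    using l by (auto simp: edge_interval_def edge_interior_def)
  define f where "f = edge_point G L l"
  have f: "f t = (if t = 0 then Vertex (tail G l) else Inner l t)" for t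
    using l by (simp add: f_def edge_point_def)
  have gp: "graph_points G L = f ` {0..}"
  proof -
    have "half_lines G L = {l}" using a l by (auto simp: half_lines_def)
    then have "graph_points G L = insert (Vertex (tail G l)) (Inner l ` {0<..})"
      using a v ne I by (auto simp: graph_points_def)
    also have "\<dots> = f ` {0..}"
    proof -
      have "{0::real..} = insert 0 {0<..}" by auto
      then show ?thesis by (auto simp: f)
    qed
    finally show ?thesis .
  qed
  have inj: "inj_on f {0..}" by (auto simp: inj_on_def f split: if_splits)
  define coord where "coord p = (case p of Vertex w \<Rightarrow> 0 | Inner e x \<Rightarrow> x)" for p :: "('v, 'e) graph_point"
  have cf: "coord (f t) = t" for t by (simp add: coord_def f)
  have lower: "\<bar>coord p - coord q\<bar> \<le> r" if "graph_chain G L p q r" for p q r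
    using that
  proof (induction rule: graph_chain.induct)
    case (step p e s r t)
    then have "e = l" using a by simp
    then show ?case using step.IH cf[of s] cf[of t] by (auto simp: f_def)
  qed simp
  have upper: "graph_chain G L (f s) (f t) \<bar>s - t\<bar>" if "s \<ge> 0" "t \<ge> 0" for s t
  proof -
    have "graph_chain G L (f s) (edge_point G L l s) 0"
      unfolding f_def[symmetric] by (rule graph_chain.refl) (use gp that in auto)
    then have "graph_chain G L (f s) (edge_point G L l t) (0 + \<bar>s - t\<bar>)"
      by (rule graph_chain.step) (use a I that in auto)
    then show ?thesis by (simp add: f_def)
  qed
  have "graph_dist G L (f s) (f t) = \<bar>s - t\<bar>" if "s \<ge> 0" "t \<ge> 0" for s t
    unfolding graph_dist_def
  proof (rule cInf_eq_minimum)
    show "\<bar>s - t\<bar> \<in> {r. graph_chain G L (f s) (f t) r}" using upper[OF that] by simp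
    show "\<bar>s - t\<bar> \<le> r" if "r \<in> {r. graph_chain G L (f s) (f t) r}" for r
      using lower[of "f s" "f t" r] that cf by simp
  qed
  moreover have "bij_betw f {0..} (graph_points G L)"
    using inj gp by (simp add: bij_betw_def)
  ultimately show ?thesis unfolding isometric_to_ray_def by blast
qed

context noncompact_graph
begin

text \<open>The half-line accounts for one edge end at its vertex. One further end would give degree
  2, which the convention forbids; none would leave only the half-line, by connectedness.\<close>

lemma spare_if_not_ray:
  assumes one: "half_lines G L = {l}" and deg: "no_degree_two G L" and ray: "\<not> isometric_to_ray G L"
  shows "spare (tail G l)"
proof (rule ccontr)
  assume ns: "\<not> spare (tail G l)"
  define v where "v = tail G l"
  have l: "l \<in> arcs G" "L l = \<infinity>" "l \<notin> bounded_arcs" using one by (auto simp: half_lines_def bounded_arcs_def)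
  have arcs: "arcs G = insert l bounded_arcs" using arcs_split(1) one by simp
  have hl: "head G l \<noteq> v" using infinity_not_tail[OF l(1,2) l(1)] by (simp add: v_def)
  have d2: "degree G v \<noteq> 2"
  proof -
    \<comment> \<open>The exceptional presentation of the real line has two half-lines, contrary to
      \<open>one\<close>.\<close>
    have False if "e1 \<noteq> e2" "arcs G = {e1, e2}" "L e1 = \<infinity>" "L e2 = \<infinity>" for e1 e2
    proof -
      have "e1 \<in> half_lines G L" "e2 \<in> half_lines G L" using that by (auto simp: half_lines_def)
      then show False using one that(1) by simp
    qed
    then show ?thesis using deg l(1) by (auto simp: no_degree_two_def v_def)
  qed
  have none: "tail G e \<noteq> v \<and> head G e \<noteq> v" if e: "e \<in> bounded_arcs" for e
  proof (rule ccontr)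
    assume inc: "\<not> ?thesis"
    then have uniq: "f = e \<and> tail G e \<noteq> head G e" if "f \<in> bounded_arcs" "tail G f = v \<or> head G f = v" for f
      using ns e that unfolding spare_def v_def by blast
    have nl: "tail G e \<noteq> head G e" using uniq[OF e] inc by blast
    have only: "f = e" if "f \<in> bounded_arcs" "tail G f = v \<or> head G f = v" for f
      using uniq[OF that] by (rule conjunct1)
    have tl: "tail G l = v" by (simp add: v_def)
    have "l \<noteq> e" using l e by auto
    have "degree G v = 2"
    proof (cases "tail G e = v")
      case True
      have he: "head G e \<noteq> v" using True nl by auto
      have "out_arcs G v = {l, e}"
      proof (intro equalityI subsetI)
        fix d assume "d \<in> out_arcs G v"
        then have "d \<in> insert l bounded_arcs" "tail G d = v" using arcs by (auto simp: out_arcs_def)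
        then show "d \<in> {l, e}" using only[of d] by (elim insertE) simp_all
      next
        fix d assume "d \<in> {l, e}"
        then show "d \<in> out_arcs G v" using True tl l(1) bounded_arcsD[OF e] by (auto simp: out_arcs_def)
      qed
      moreover have "in_arcs G v = {}"
      proof -
        have False if "d \<in> insert l bounded_arcs" "head G d = v" for d
          using that only[of d] hl he by (elim insertE) simp_all
        then show ?thesis unfolding in_arcs_def arcs by blast
      qed
      ultimately show ?thesis using \<open>l \<noteq> e\<close> by (simp add: degree_def in_degree_def out_degree_def)
    next
      case False
      then have he: "head G e = v" using inc by simp
      have "out_arcs G v = {l}"
      proof (intro equalityI subsetI)
        fix d assume "d \<in> out_arcs G v"
        then have "d \<in> insert l bounded_arcs" "tail G d = v" using arcs by (auto simp: out_arcs_def)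
        then show "d \<in> {l}" using only[of d] False by (elim insertE) simp_all
      next
        fix d assume "d \<in> {l}"
        then show "d \<in> out_arcs G v" using tl l(1) by (simp add: out_arcs_def)
      qed
      moreover have "in_arcs G v = {e}"
      proof (intro equalityI subsetI)
        fix d assume "d \<in> in_arcs G v"
        then have "d \<in> insert l bounded_arcs" "head G d = v" using arcs by (auto simp: in_arcs_def)
        then show "d \<in> {e}" using only[of d] hl by (elim insertE) simp_all
      next
        fix d assume "d \<in> {e}"
        then show "d \<in> in_arcs G v" using he bounded_arcsD[OF e] by (simp add: in_arcs_def)
      qed
      ultimately show ?thesis by (simp add: degree_def in_degree_def out_degree_def)
    qed
    then show False using d2 by simp
  qed
  have vs: "{v, head G l} = verts G"
  proof (rule conn)
    show "{v, head G l} \<subseteq> verts G" using l by (auto simp: v_def)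
    show "(tail G e \<in> {v, head G l}) = (head G e \<in> {v, head G l})" if e: "e \<in> arcs G" for e
    proof (cases "e = l")
      case False
      then have "e \<in> bounded_arcs" using arcs e by auto
      then show ?thesis using none infinity_not_tail[OF l(1,2) e] infinity_head_unique[OF l(1,2) e] False by auto
    qed (simp add: v_def)
  qed simp
  have "bounded_arcs = {}"
  proof -
    have False if e: "e \<in> bounded_arcs" for e
    proof -
      have "tail G e \<in> verts G" using bounded_arcsD[OF e] by simp
      then show False using none[OF e] infinity_not_tail[OF l(1,2) bounded_arcsD[OF e]] vs by auto
    qed
    then show ?thesis by auto
  qed
  then have "isometric_to_ray G L"
    using isometric_to_ray_single_arc[of L l G, OF l(2)] arcs vs hl by (auto simp: v_def)
  then show False using ray by simp
qed

section \<open>Ground states at the critical mass\<close>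

lemma energy_eq: "energy G L u = kin u / 2 - pot u / 6"
  by (simp add: energy_def)

lemma ground_state_is_optimizer:
  assumes u: "u \<in> H1_mass G L (critical_mass G L)"
    and E: "ereal (energy G L u) = ground_level G L (critical_mass G L)"
  shows "pot u = 3 * kin u"
proof -
  let ?\<mu> = "critical_mass G L"
  have uH: "u \<in> H1_graph G L" and um: "mass u = ?\<mu>" using u by (auto simp: H1_mass_def)
  have \<mu>: "?\<mu> > 0" by (rule critical_mass(1))
  have "?\<mu>\<^sup>2 * pot u \<le> ?\<mu>\<^sup>2 * (3 * kin u)" using critical_mass(2)[OF uH] um by (simp add: mult_ac)
  then have 1: "pot u \<le> 3 * kin u" using \<mu> by simp
  obtain l where l: "l \<in> half_lines G L" using half_line_exists by auto
  define N where "N = real (card (half_lines G L))"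
  have N: "N > 0" unfolding N_def by (rule card_half_lines_pos)
  \<comment> \<open>Competitor: a half-soliton profile of width 1 / k rescaled to the critical mass.
    Its kinetic term is of order k and its mass at least of order 1 / k before rescaling, so the
    kinetic energy is O(k^2); the potential only lowers the energy.\<close>
  have low: "energy G L u \<le> ?\<mu> * k\<^sup>2" if k: "k > 0" for k
  proof -
    let ?w = "soliton_fun l k 0"
    note hw = has_graph_deriv_soliton[OF k, of l 0] and cs = centred_soliton[OF k l, folded N_def]
    have M: "mass ?w > 0" "N * pi / (2 * k) \<le> mass ?w"
      unfolding cs using N k total_length_nonneg by (auto intro!: add_pos_nonneg divide_pos_pos mult_pos_pos)
    define c where "c = sqrt (?\<mu> / mass ?w)"
    have c: "c\<^sup>2 = ?\<mu> / mass ?w" using M \<mu> by (simp add: c_def)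
    have "(\<lambda>p. c * ?w p) \<in> H1_mass G L ?\<mu>"
      using has_graph_deriv_H1(1)[OF has_graph_deriv_cmult[OF hw]] scale_functionals(1)[OF hw] c M
      by (simp add: H1_mass_def)
    then have "ground_level G L ?\<mu> \<le> ereal (energy G L (\<lambda>p. c * ?w p))"
      unfolding ground_level_def by (rule INF_lower)
    then have "energy G L u \<le> energy G L (\<lambda>p. c * ?w p)" using E by (metis ereal_less_eq(3))
    also have "\<dots> \<le> c\<^sup>2 * kin ?w / 2"
      unfolding energy_eq scale_functionals[OF hw] using pot_nonneg[of ?w] by simp
    also have "\<dots> = ?\<mu> * (N * k * pi / 16) / 2 / mass ?w" unfolding c cs(2) by simp
    also have "\<dots> \<le> ?\<mu> * (N * k * pi / 16) / 2 / (N * pi / (2 * k))"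
      using M N k \<mu> by (intro divide_left_mono mult_pos_pos) auto
    also have "\<dots> = ?\<mu> * k\<^sup>2 / 16" using N k by (simp add: field_simps power2_eq_square)
    also have "\<dots> \<le> ?\<mu> * k\<^sup>2" using \<mu> by simp
    finally show ?thesis .
  qed
  have "energy G L u \<le> 0 + e" if "e > 0" for e
    using low[of "sqrt (e / ?\<mu>)"] that \<mu> by simp
  then have "energy G L u \<le> 0" by (rule field_le_epsilon)
  then show ?thesis using 1 unfolding energy_eq by simp
qed

text \<open>The half-line is calibrated with its own maximum H rather than that of the graph: H^4 m
  / 6 is at most the energy on \<open>l\<close> plus H^4 / 6 times the mass on \<open>l\<close>, and
  the energy is negative.\<close>

lemma mass_half_line_negative_energy:
  assumes u: "has_graph_deriv u g" and l: "l \<in> half_lines G L" and nn: "\<And>x. 0 \<le> x \<Longrightarrow> 0 < er u l x"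
    and neg: "(LBINT t:edge_interior L l. (g l t)\<^sup>2) / 2 < (LBINT t:edge_interior L l. er u l t ^ 6) / 6"
  shows "half_line_mass < (LBINT t:edge_interior L l. (er u l t)\<^sup>2)"
proof -
  note h = half_linesD[OF l]
  note d = has_graph_derivD[OF u h(1), unfolded h(3,4)]
  have decay: "(er u l \<longlongrightarrow> 0) at_top" by (rule half_line_decay[OF u h(1,2)])
  obtain p where p: "p \<ge> 0" "\<And>x. x \<ge> 0 \<Longrightarrow> er u l x \<le> er u l p"
    using continuous_half_line_attains_sup[OF d(1) decay] nn less_imp_le by metis
  define H where "H = er u l p"
  have H: "H > 0" using nn p by (simp add: H_def)
  have "calib H (er u l p) - calib H 0 \<le> (LBINT t:{0<..}. calib_density H (er u l) (g l) t)"
    using nn p(2) calib_density_integral(1)[OF u h(1), unfolded h(3)]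
    by (intro calib_half_line[OF d(4) H _ _ p(1) d(1) decay]) (auto simp: H_def less_imp_le)
  then have "H ^ 4 * half_line_mass / 6 \<le> (LBINT t:{0<..}. calib_density H (er u l) (g l) t)"
    using calib_total[OF H] by (simp add: H_def)
  also have "\<dots> < H ^ 4 * (LBINT t:edge_interior L l. (er u l t)\<^sup>2) / 6"
    using calib_density_integral(2)[OF u h(1), of H] neg by (simp add: h(3))
  finally show ?thesis using H by simp
qed

text \<open>The total energy is 0 and that of \<open>l\<close> nonnegative, so 3 kin <= pot on the
  rest. Strictness uses positivity twice: \<open>l\<close> carries mass, so the mass really drops,
  and the remaining half-line \<open>l'\<close> carries potential.\<close>

lemma critical_mass_remove_less:
  assumes u: "has_graph_deriv u g" and l: "l \<in> half_lines G L" and l': "l' \<in> half_lines G L" "l' \<noteq> l"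
    and pos: "\<And>e x. e \<in> arcs G \<Longrightarrow> x \<in> edge_interval L e \<Longrightarrow> 0 < er u e x"
    and p: "pot u = 3 * kin u"
    and nonneg: "(LBINT t:edge_interior L l. er u l t ^ 6) / 6 \<le> (LBINT t:edge_interior L l. (g l t)\<^sup>2) / 2"
  shows "critical_mass (remove_half_line G l) L < mass u"
proof -
  interpret R: noncompact_graph "remove_half_line G l" L
    by (rule noncompact_graph_remove_half_line[OF noncompact_graph_axioms l l'])
  note s = remove_half_line_simps[OF metric_graph_axioms l]
  have er: "edge_restrict (remove_half_line G l) L u = edge_restrict G L u"
    by (simp add: edge_restrict_def edge_point_def s fun_eq_iff)
  have Ru: "R.has_graph_deriv u g"
    using u unfolding R.has_graph_deriv_def has_graph_deriv_def er s by auto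
  note h = half_linesD[OF l]
  have spl: "sum F (arcs G) = F l + sum F (arcs G - {l})" for F :: "'b \<Rightarrow> real"
    using h(1) by (simp add: sum.remove)
  have M: "mass u = (LBINT t:edge_interior L l. (er u l t)\<^sup>2) + R.mass u"
    unfolding mass_eq R.mass_eq er s spl by simp
  have P: "pot u = (LBINT t:edge_interior L l. er u l t ^ 6) + R.pot u"
    unfolding pot_eq R.pot_eq er s spl by simp
  have K: "kin u = (LBINT t:edge_interior L l. (g l t)\<^sup>2) + R.kin u"
    unfolding has_graph_deriv_H1(2)[OF u] R.has_graph_deriv_H1(2)[OF Ru] s spl by simp
  have sub: "{0<..} \<subseteq> {0::real..}" by auto
  have mid: "1 \<in> edge_interior L e" "edge_interior L e \<subseteq> edge_interval L e" "continuous_on (edge_interior L e) (er u e)"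
    "open (edge_interior L e)" if "e \<in> half_lines G L" for e
    using half_linesD[OF that] has_graph_derivD(1)[OF u half_linesD(1)[OF that]] continuous_on_subset[OF _ sub, of "er u e"]
    by auto
  have p1: "0 < er u e 1" if "e \<in> half_lines G L" for e
    using pos[OF half_linesD(1)[OF that]] mid(1,2)[OF that] by blast
  have Ml: "0 < (LBINT t:edge_interior L l. (er u l t)\<^sup>2)"
    by (rule set_integral_continuous_pos[OF mid(4)[OF l] _ _ L2_onD(2)[OF has_graph_derivD(2)[OF u h(1)]] mid(1)[OF l]])
      (use p1[OF l] mid[OF l] in \<open>auto intro!: continuous_intros\<close>)
  have "0 < (LBINT t:edge_interior L l'. er u l' t ^ 6)"
    by (rule set_integral_continuous_pos[OF mid(4)[OF l'(1)] _ _ power6_integrable[OF u half_linesD(1)[OF l'(1)]] mid(1)[OF l'(1)]])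
      (use p1[OF l'(1)] mid[OF l'(1)] in \<open>auto intro!: continuous_intros\<close>)
  also have "\<dots> \<le> R.pot u"
    unfolding R.pot_eq er s using half_linesD(1)[OF l'(1)] l'(2)
    by (intro member_le_sum) (auto intro!: set_integral_nonneg_real)
  finally have Rp: "0 < R.pot u" .
  have "3 * R.kin u \<le> R.pot u" using p P K nonneg by linarith
  then have "3 * (R.mass u)\<^sup>2 * R.kin u \<le> (R.mass u)\<^sup>2 * R.pot u"
    using mult_left_mono[of "3 * R.kin u" "R.pot u" "(R.mass u)\<^sup>2"] by (simp add: mult_ac)
  also have "\<dots> < (mass u)\<^sup>2 * R.pot u"
    using Rp M Ml R.mass_nonneg[of u] by (intro mult_strict_right_mono power_strict_mono) auto
  finally show ?thesis
    using R.critical_mass_less[OF R.has_graph_deriv_H1(1)[OF Ru], of "mass u"] M Ml R.mass_nonneg[of u] by simp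
qed

lemma ground_state_critical_mass_less:
  assumes u: "u \<in> H1_mass G L (critical_mass G L)"
    and E: "ereal (energy G L u) = ground_level G L (critical_mass G L)"
    and deg: "no_degree_two G L" and ray: "\<not> isometric_to_ray G L"
  shows "\<exists>l \<in> half_lines G L. noncompact (remove_half_line G l) L \<and>
    critical_mass (remove_half_line G l) L < critical_mass G L"
proof -
  let ?\<mu> = "critical_mass G L"
  have uH: "u \<in> H1_graph G L" and um: "mass u = ?\<mu>" using u by (auto simp: H1_mass_def)
  have \<mu>: "?\<mu> > 0" by (rule critical_mass(1))
  define U where "U p = \<bar>u p\<bar>" for p
  define g where "g e x = sgn (er u e x) * dr u e x" for e x
  note hu = H1_graph_has_deriv[OF uH]
  have hU: "has_graph_deriv U g" unfolding U_def g_def by (rule has_graph_deriv_abs[OF hu])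
  have UM: "mass U = ?\<mu>" and "pot U = pot u" and "kin U \<le> kin u"
    using kin_abs_le[OF hu] um unfolding U_def by auto
  have "?\<mu>\<^sup>2 * pot U \<le> ?\<mu>\<^sup>2 * (3 * kin U)"
    using critical_mass(2)[OF has_graph_deriv_H1(1)[OF hU]] UM by (simp add: mult_ac)
  then have "pot U \<le> 3 * kin U" using \<mu> by simp
  \<comment> \<open>Passing to the modulus keeps pot and does not raise kin, while
    Gagliardo-Nirenberg at the critical mass bounds pot by 3 kin; hence both inequalities are
    equalities.\<close>
  then have UP: "pot U = 3 * kin U"
    using ground_state_is_optimizer[OF u E] \<open>pot U = pot u\<close> \<open>kin U \<le> kin u\<close> by simp
  have nn: "nonneg_fun U" by (simp add: nonneg_fun_def U_def edge_restrict_def)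
  note GN = critical_mass(2)
  have EL: "kin_form g k = pot_form U w - 2 * kin U / ?\<mu> * mass_form U w" if "has_graph_deriv w k" for w k
    by (rule euler_lagrange[OF hU that \<mu> GN UM UP])
  obtain h where h: "h \<ge> 0"
    "\<And>e x. e \<in> arcs G \<Longrightarrow> x \<in> edge_interval L e \<Longrightarrow> 0 \<le> er U e x \<and> er U e x \<le> h"
    "\<exists>e\<in>arcs G. \<exists>x\<in>edge_interval L e. er U e x = h"
    using energy_lower_bound[OF hU nn] by metis
  obtain e0 x0 where e0: "e0 \<in> arcs G" "x0 \<in> edge_interval L e0" "er U e0 x0 = h" using h(3) by blast
  have hp: "h > 0"
  proof (rule ccontr)
    assume "\<not> ?thesis"
    then have "er U e x = 0" if "e \<in> arcs G" "x \<in> edge_interior L e" for e x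
      using h(1) h(2)[OF that(1), of x] edge_interior_props(4)[OF that(1)] that(2) by force
    then have "mass U = (\<Sum>e\<in>arcs G. LBINT x:edge_interior L e. 0)"
      unfolding mass_eq using edge_interior_props(3) by (intro sum.cong HOL.refl set_lebesgue_integral_cong) auto
    then show False using UM \<mu> by simp
  qed
  have pos: "0 < er U e x" if "e \<in> arcs G" "x \<in> edge_interval L e" for e x
    by (rule positive_everywhere[OF hU nn _ EL e0(1,2) _ that]) (use kin_nonneg[of U] \<mu> e0 hp in auto)
  show ?thesis
  proof (cases "\<exists>l l'. l \<in> half_lines G L \<and> l' \<in> half_lines G L \<and> l' \<noteq> l")
    case True
    then obtain l1 l2 where l12: "l1 \<in> half_lines G L" "l2 \<in> half_lines G L" "l2 \<noteq> l1" by blast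
    define T where "T l = (LBINT t:edge_interior L l. (g l t)\<^sup>2) / 2" for l
    define S where "S l = (LBINT t:edge_interior L l. er U l t ^ 6) / 6" for l
    have "\<exists>l\<in>half_lines G L. S l \<le> T l"
    proof (rule ccontr)
      assume "\<not> ?thesis"
      then have neg: "T l < S l" if "l \<in> half_lines G L" for l using that by force
      define m where "m l = (LBINT t:edge_interior L l. (er U l t)\<^sup>2)" for l
      have m: "half_line_mass < m l" if "l \<in> half_lines G L" for l
        unfolding m_def using neg[OF that] pos half_linesD[OF that]
        by (intro mass_half_line_negative_energy[OF hU that]) (auto simp: T_def S_def)
      have "sum m {l1, l2} \<le> mass U"
        unfolding mass_eq m_def[symmetric]
        by (rule sum_mono2) (use l12 half_linesD(1) in \<open>auto simp: m_def intro!: set_integral_nonneg_real\<close>)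
      then show False using m[OF l12(1)] m[OF l12(2)] l12(3) UM critical_mass_le_line by simp
    qed
    then obtain l where l: "l \<in> half_lines G L" "S l \<le> T l" by blast
    obtain l' where l': "l' \<in> half_lines G L" "l' \<noteq> l" using l12 by metis
    interpret R: noncompact_graph "remove_half_line G l" L
      by (rule noncompact_graph_remove_half_line[OF noncompact_graph_axioms l(1) l'])
    have "critical_mass (remove_half_line G l) L < ?\<mu>"
      using critical_mass_remove_less[OF hU l(1) l' pos UP] l(2) UM by (simp add: S_def T_def)
    then show ?thesis using l(1) R.half_line_exists unfolding noncompact_def by blast
  next
    case False
    then obtain l where one: "half_lines G L = {l}" using half_line_exists by blast
    then have l: "l \<in> half_lines G L" by simp
    have sp: "spare (tail G l)" by (rule spare_if_not_ray[OF one deg ray])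
    obtain f x y where f: "f \<in> arcs G" "x < y" "{x<..<y} \<subseteq> edge_interior L f"
      "h ^ 4 * half_line_mass / 6 + (LBINT t:{x<..<y}. dens U g h f t) \<le> sum (cost U g h) (arcs G)"
      using calibration(2)[OF hU hp h(2) e0 l sp] by blast
    \<comment> \<open>The energy part of the total cost is 0 by \<open>UP\<close>. As
      \<open>?\<mu>\<close> is at most \<open>half_line_mass\<close>, the calibration leaves nothing
      for the omitted interval.\<close>
    have "sum (cost U g h) (arcs G) = h ^ 4 * ?\<mu> / 6"
      using total_cost[OF hU hp h(2)] UP UM by simp
    also have "\<dots> \<le> h ^ 4 * half_line_mass / 6"
      using critical_mass_le_half_line[OF one] by (simp add: mult_left_mono)
    finally have le0: "(LBINT t:{x<..<y}. dens U g h f t) \<le> 0" using f(4) by simp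
    have dn: "0 \<le> dens U g h f t" if "t \<in> {x<..<y}" for t
      using dens_nonneg[OF hU hp h(2) f(1)] f(3) edge_interior_props(4)[OF f(1)] that by blast
    have di: "set_integrable lborel {x<..<y} (dens U g h f)"
      by (rule set_integrable_subset[OF dens_integrable[OF hU hp h(2) f(1)]]) (use f(3) in auto)
    have "AE t in lborel. indicator {x<..<y} t *\<^sub>R dens U g h f t = 0"
    proof (subst integral_nonneg_eq_0_iff_AE[symmetric])
      show "integrable lborel (\<lambda>t. indicator {x<..<y} t *\<^sub>R dens U g h f t)" using di unfolding set_integrable_def .
      show "AE t in lborel. 0 \<le> indicator {x<..<y} t *\<^sub>R dens U g h f t"
        using dn by (intro AE_I2) (auto simp: indicator_def)
      show "(LINT t|lborel. indicator {x<..<y} t *\<^sub>R dens U g h f t) = 0"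
        using le0 set_integral_nonneg_real[of "{x<..<y}" "dens U g h f", OF dn]
        unfolding set_lebesgue_integral_def by simp
    qed
    then have ae: "AE t in lborel. t \<in> {x<..<y} \<longrightarrow> g f t = 0 \<and> er U f t = h"
    proof eventually_elim
      case (elim t)
      show ?case
      proof
        assume t: "t \<in> {x<..<y}"
        then have tJ: "t \<in> edge_interval L f" using f(3) edge_interior_props(4)[OF f(1)] by blast
        have r: "0 < er U f t" "er U f t \<le> h" using pos[OF f(1) tJ] h(2)[OF f(1) tJ] by auto
        have le: "er U f t ^ 4 \<le> h ^ 4" using r by (intro power_mono) auto
        have "(g f t)\<^sup>2 / 2 + (er U f t)\<^sup>2 * (h ^ 4 - er U f t ^ 4) / 6 = 0"
          using elim t by (simp add: dens_def[OF hU hp h(2)] calib_density_def)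
        moreover have "0 \<le> (er U f t)\<^sup>2 * (h ^ 4 - er U f t ^ 4) / 6" using le by simp
        moreover have "0 \<le> (g f t)\<^sup>2 / 2" by simp
        ultimately have z: "(g f t)\<^sup>2 / 2 = 0" "(er U f t)\<^sup>2 * (h ^ 4 - er U f t ^ 4) / 6 = 0" by linarith+
        have "er U f t ^ 4 = h ^ 4" using z(2) r by simp
        then have "er U f t = h" using r hp by (simp add: power_eq_iff_eq_base)
        then show "g f t = 0 \<and> er U f t = h" using z(1) by simp
      qed
    qed
    have False
      by (rule optimizer_not_locally_max[OF hU \<mu> GN UM UP hp h(2) f(1,2,3) ae])
    then show ?thesis ..
  qed
qed

end

theorem proposition1p2:
  fixes G :: "('v, 'e) pre_digraph" and L :: "'e \<Rightarrow> ereal"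
  assumes "metric_graph G L"
    and "Digraph_Component.connected G"
    and "noncompact G L"
    and "no_degree_two G L"
    and "\<not> isometric_to_ray G L"
    and "ground_level_achieved G L (critical_mass G L)"
  shows "\<exists>l \<in> half_lines G L.
    noncompact (remove_half_line G l) L \<and>
    critical_mass (remove_half_line G l) L < critical_mass G L"
proof -
  interpret noncompact_graph G L by (rule noncompact_graphI[OF assms(1-3)])
  obtain u where "u \<in> H1_mass G L (critical_mass G L)"
    "ereal (energy G L u) = ground_level G L (critical_mass G L)"
    using assms(6) unfolding ground_level_achieved_def by blast
  then show ?thesis using ground_state_critical_mass_less assms(4,5) by blast
qed

end
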